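(* Let $f\in L^2(I;V^* )$, $u_0\in H$, let $u\in\mathcal{W}(I)$ be the solution of the unsteady Navier--Lam\'e equations $\partial_tu(t)+(-\operatorname{div}\mathbb{C}\operatorname{sym}\nabla)u(t)=f(t)$ in $V^*$ for a.e. $t\in I$, $u(0)=u_0$ in $H$, and let $z\coloneqq\mathbb{C}\operatorname{sym}\nabla u$. Then, for every $(y,\lambda)\in L^2(I;Y^*_{\mathrm{sym}})\times\mathcal{W}(I)$ with $\operatorname{div}y=\partial_t\lambda-f$ in $L^2(I;V^* )$, $$\begin{aligned}&\tfrac12\|\mathbb{C}^{-1/2}(y-z)\|_Q^2+\tfrac12\|\mathbb{C}^{1/2}\operatorname{sym}\nabla(\lambda-u)\|_Q^2+\tfrac12\|(\lambda-u)(T)\|_H^2\\&\qquad=\tfrac12\|\mathbb{C}^{-1/2}(y-\mathbb{C}\operatorname{sym}\nabla\lambda)\|_Q^2+\tfrac12\|\lambda(0)-u_0\|_H^2 .\end{aligned}$$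
   Context: $\Omega\subseteq\mathbb{R}^d$ is a bounded Lipschitz domain; $I=(0,T)$, $0<T<\infty$; $Q=I\times\Omega$. $V=W^{1,2}_0(\Omega;\mathbb{R}^d)$ (full Dirichlet boundary), $H=L^2(\Omega;\mathbb{R}^d)$, $Y=Y^*=L^2(\Omega;\mathbb{R}^{d\times d})$, $Y^*_{\mathrm{sym}}=\{y\in Y^*\mid y=y^\top\text{ a.e. in }\Omega\}$. $V\hookrightarrow H\cong H^*\hookrightarrow V^*$ is the usual evolution triple and $\mathcal{W}(I)=\{v\in L^2(I;V)\mid\partial_tv\in L^2(I;V^* )\}\hookrightarrow C^0(\overline I;H)$. $L=\nabla\colon V\to Y$, $\langle L^*y,v\rangle_V=\int_\Omega y:\nabla v\,dx$; in $V^*$, $\operatorname{div}y$ means $-L^*y$. $\operatorname{sym}A=\frac12(A+A^\top)$. Elasticity tensor: for $\mu_{\mathrm L}>0$ and $\lambda_{\mathrm L}>-\frac2d\mu_{\mathrm L}$, $\mathbb{C}A=2\mu_{\mathrm L}A+\lambda_{\mathrm L}\operatorname{tr}(A)\mathrm{I}_d$ for symmetric $A\in\mathbb{R}^{d\times d}$; $\mathbb{C}^{\pm1/2}$ are the powers of this positive definite map. $\langle-\operatorname{div}\mathbb{C}\operatorname{sym}\nabla v,w\rangle_V=\int_\Omega\mathbb{C}\operatorname{sym}\nabla v:\operatorname{sym}\nabla w\,dx$. Operators act pointwise in time. $\|\cdot\|_Q$ is the $L^2(Q)$-norm. *)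

theory Defs
  imports "HOL-Analysis.Analysis"
begin

text \<open>
  Elements of Lebesgue, Sobolev and Bochner spaces are represented by functions; two functions
  stand for the same element iff they agree almost everywhere. Accordingly the norms below are
  seminorms on representatives, and the objects picked by \<open>SOME\<close> (weak gradient, weak time
  derivative, continuous representative) are determined up to null sets.
  The space dimension \<open>d\<close> is \<open>CARD('n)\<close>.
\<close>

subsection \<open>Domains, test functions and Lebesgue spaces\<close>

text \<open>Near each boundary point the domain is, in suitable Cartesian coordinates with last axis \<open>e\<close>,
  the strict subgraph of a Lipschitz function on the hyperplane orthogonal to \<open>e\<close>.\<close>

definition lipschitz_boundary :: "'a::euclidean_space set \<Rightarrow> bool" where
  "lipschitz_boundary \<Omega> \<longleftrightarrow>
     (\<forall>p\<in>frontier \<Omega>. \<exists>r>0. \<exists>e \<gamma> C. norm e = 1 \<and> C-lipschitz_on {x. x \<bullet> e = 0} \<gamma> \<and>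
        \<Omega> \<inter> ball p r = {x \<in> ball p r. x \<bullet> e < (\<gamma> (x - (x \<bullet> e) *\<^sub>R e) :: real)})"

definition bounded_lipschitz_domain :: "'a::euclidean_space set \<Rightarrow> bool" where
  "bounded_lipschitz_domain \<Omega> \<longleftrightarrow>
     \<Omega> \<noteq> {} \<and> open \<Omega> \<and> connected \<Omega> \<and> bounded \<Omega> \<and> lipschitz_boundary \<Omega>"

primrec times_cont_diff :: "nat \<Rightarrow> ('a::euclidean_space \<Rightarrow> 'b::real_normed_vector) \<Rightarrow> bool" where
  "times_cont_diff 0 f \<longleftrightarrow> continuous_on UNIV f"
| "times_cont_diff (Suc k) f \<longleftrightarrow>
     (\<forall>x. f differentiable (at x)) \<and> (\<forall>h. times_cont_diff k (\<lambda>x. frechet_derivative f (at x) h))"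

definition test_funs :: "'a::euclidean_space set \<Rightarrow> ('a \<Rightarrow> 'b::real_normed_vector) set" where
  "test_funs \<Omega> = {\<phi>. (\<forall>k. times_cont_diff k \<phi>) \<and>
     compact (closure {x. \<phi> x \<noteq> 0}) \<and> closure {x. \<phi> x \<noteq> 0} \<subseteq> \<Omega>}"

definition L2 :: "'a::euclidean_space set \<Rightarrow> ('a \<Rightarrow> 'b::euclidean_space) set" where
  "L2 \<Omega> = {v. v \<in> borel_measurable (lebesgue_on \<Omega>) \<and>
     integrable (lebesgue_on \<Omega>) (\<lambda>x. (norm (v x))\<^sup>2)}"

definition L2_inner :: "'a::euclidean_space set \<Rightarrow> ('a \<Rightarrow> 'b::euclidean_space) \<Rightarrow> ('a \<Rightarrow> 'b) \<Rightarrow> real" where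
  "L2_inner \<Omega> v w = (LINT x|lebesgue_on \<Omega>. v x \<bullet> w x)"

definition L2_norm :: "'a::euclidean_space set \<Rightarrow> ('a \<Rightarrow> 'b::euclidean_space) \<Rightarrow> real" where
  "L2_norm \<Omega> v = sqrt (LINT x|lebesgue_on \<Omega>. (norm (v x))\<^sup>2)"

subsection \<open>Sobolev spaces of vector fields\<close>

text \<open>\<open>G x $ i $ j\<close> is the weak derivative of the \<open>i\<close>-th component in direction \<open>j\<close>. On
  \<^typ>\<open>real^'n^'n\<close> the library's inner product and norm are the Frobenius ones.\<close>

definition is_weak_grad ::
  "(real^'n) set \<Rightarrow> (real^'n \<Rightarrow> real^'n) \<Rightarrow> (real^'n \<Rightarrow> real^'n^'n) \<Rightarrow> bool" where
  "is_weak_grad \<Omega> v G \<longleftrightarrow>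
     (\<forall>\<phi>\<in>test_funs \<Omega>. \<forall>i j.
        (LINT x|lebesgue_on \<Omega>. v x $ i * frechet_derivative \<phi> (at x) (axis j 1)) =
        - (LINT x|lebesgue_on \<Omega>. G x $ i $ j * \<phi> x))"

definition W12 :: "(real^'n) set \<Rightarrow> (real^'n \<Rightarrow> real^'n) set" where
  "W12 \<Omega> = {v \<in> L2 \<Omega>. \<exists>G\<in>L2 \<Omega>. is_weak_grad \<Omega> v G}"

definition wgrad :: "(real^'n) set \<Rightarrow> (real^'n \<Rightarrow> real^'n) \<Rightarrow> real^'n \<Rightarrow> real^'n^'n" where
  "wgrad \<Omega> v = (SOME G. G \<in> L2 \<Omega> \<and> is_weak_grad \<Omega> v G)"

definition W12_norm :: "(real^'n) set \<Rightarrow> (real^'n \<Rightarrow> real^'n) \<Rightarrow> real" where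
  "W12_norm \<Omega> v = sqrt ((L2_norm \<Omega> v)\<^sup>2 + (L2_norm \<Omega> (wgrad \<Omega> v))\<^sup>2)"

definition W12_0 :: "(real^'n) set \<Rightarrow> (real^'n \<Rightarrow> real^'n) set" where
  "W12_0 \<Omega> = {v \<in> W12 \<Omega>. \<exists>\<phi>. (\<forall>k::nat. \<phi> k \<in> test_funs \<Omega>) \<and>
     (\<lambda>k. W12_norm \<Omega> (\<lambda>x. \<phi> k x - v x)) \<longlonglongrightarrow> 0}"

text \<open>Functionals matter only through their values on \<^term>\<open>W12_0 \<Omega>\<close>: equality in the dual
  space is equality there. Boundedness makes them well defined on a.e.-classes.\<close>

definition W12_dual :: "(real^'n) set \<Rightarrow> ((real^'n \<Rightarrow> real^'n) \<Rightarrow> real) set" where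
  "W12_dual \<Omega> = {F.
     (\<forall>v\<in>W12_0 \<Omega>. \<forall>w\<in>W12_0 \<Omega>. F (\<lambda>x. v x + w x) = F v + F w) \<and>
     (\<forall>c. \<forall>v\<in>W12_0 \<Omega>. F (\<lambda>x. c *\<^sub>R v x) = c * F v) \<and>
     (\<exists>C. \<forall>v\<in>W12_0 \<Omega>. \<bar>F v\<bar> \<le> C * W12_norm \<Omega> v)}"

definition dual_norm :: "(real^'n) set \<Rightarrow> ((real^'n \<Rightarrow> real^'n) \<Rightarrow> real) \<Rightarrow> real" where
  "dual_norm \<Omega> F = (SUP v\<in>{v \<in> W12_0 \<Omega>. W12_norm \<Omega> v \<le> 1}. \<bar>F v\<bar>)"

subsection \<open>Bochner spaces\<close>

text \<open>\<open>L\<^sup>2(I;X)\<close> for a space \<open>X\<close> of representatives with (semi)norm \<open>N\<close>: a.e. limits, in the norm of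
  \<open>X\<close>, of \<open>X\<close>-valued simple functions, with square integrable norm.\<close>

definition bochner_L2 :: "real set \<Rightarrow> 'x::minus set \<Rightarrow> ('x \<Rightarrow> real) \<Rightarrow> (real \<Rightarrow> 'x) set" where
  "bochner_L2 I X N = {v.
     (AE t in lebesgue_on I. v t \<in> X) \<and>
     (\<exists>s. (\<forall>k::nat. simple_function (lebesgue_on I) (s k) \<and> s k ` I \<subseteq> X) \<and>
          (AE t in lebesgue_on I. (\<lambda>k. N (s k t - v t)) \<longlonglongrightarrow> 0)) \<and>
     integrable (lebesgue_on I) (\<lambda>t. (N (v t))\<^sup>2)}"

definition L2_V :: "real \<Rightarrow> (real^'n) set \<Rightarrow> (real \<Rightarrow> real^'n \<Rightarrow> real^'n) set" where
  "L2_V T \<Omega> = bochner_L2 {0<..<T} (W12_0 \<Omega>) (W12_norm \<Omega>)"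

definition L2_Vdual :: "real \<Rightarrow> (real^'n) set \<Rightarrow> (real \<Rightarrow> (real^'n \<Rightarrow> real^'n) \<Rightarrow> real) set" where
  "L2_Vdual T \<Omega> = bochner_L2 {0<..<T} (W12_dual \<Omega>) (dual_norm \<Omega>)"

definition Y_sym :: "(real^'n) set \<Rightarrow> (real^'n \<Rightarrow> real^'n^'n) set" where
  "Y_sym \<Omega> = {y \<in> L2 \<Omega>. AE x in lebesgue_on \<Omega>. y x = transpose (y x)}"

definition L2_Ysym :: "real \<Rightarrow> (real^'n) set \<Rightarrow> (real \<Rightarrow> real^'n \<Rightarrow> real^'n^'n) set" where
  "L2_Ysym T \<Omega> = bochner_L2 {0<..<T} (Y_sym \<Omega>) (L2_norm \<Omega>)"

text \<open>The norm of \<open>L\<^sup>2(Q)\<close>, \<open>Q = (0,T) \<times> \<Omega>\<close>, under the identification \<open>L\<^sup>2(Q) = L\<^sup>2(I;L\<^sup>2(\<Omega>))\<close>.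
  The iterated integral is used because a representative of a Bochner function need not be
  jointly measurable.\<close>

definition norm_Q :: "real \<Rightarrow> (real^'n) set \<Rightarrow> (real \<Rightarrow> real^'n \<Rightarrow> 'b::euclidean_space) \<Rightarrow> real" where
  "norm_Q T \<Omega> w = sqrt (LINT t|lebesgue_on {0<..<T}. LINT x|lebesgue_on \<Omega>. (norm (w t x))\<^sup>2)"

subsection \<open>The energy space of the evolution triple\<close>

text \<open>\<open>\<integral> \<phi>' v dt = - \<integral> \<phi> g dt\<close> in the dual space, where \<open>v t\<close> acts on the dual pairing through
  the inner product of \<open>L\<^sup>2(\<Omega>)\<close>.\<close>

definition is_time_deriv :: "real \<Rightarrow> (real^'n) set \<Rightarrow> (real \<Rightarrow> real^'n \<Rightarrow> real^'n) \<Rightarrow>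
    (real \<Rightarrow> (real^'n \<Rightarrow> real^'n) \<Rightarrow> real) \<Rightarrow> bool" where
  "is_time_deriv T \<Omega> v g \<longleftrightarrow>
     (\<forall>\<phi>\<in>test_funs {0<..<T}. \<forall>w\<in>W12_0 \<Omega>.
        (LINT t|lebesgue_on {0<..<T}. deriv \<phi> t * L2_inner \<Omega> (v t) w) =
        - (LINT t|lebesgue_on {0<..<T}. \<phi> t * g t w))"

definition W_space :: "real \<Rightarrow> (real^'n) set \<Rightarrow> (real \<Rightarrow> real^'n \<Rightarrow> real^'n) set" where
  "W_space T \<Omega> = {v \<in> L2_V T \<Omega>. \<exists>g\<in>L2_Vdual T \<Omega>. is_time_deriv T \<Omega> v g}"

definition time_deriv :: "real \<Rightarrow> (real^'n) set \<Rightarrow> (real \<Rightarrow> real^'n \<Rightarrow> real^'n) \<Rightarrow>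
    real \<Rightarrow> (real^'n \<Rightarrow> real^'n) \<Rightarrow> real" where
  "time_deriv T \<Omega> v = (SOME g. g \<in> L2_Vdual T \<Omega> \<and> is_time_deriv T \<Omega> v g)"

definition is_cont_rep :: "real \<Rightarrow> (real^'n) set \<Rightarrow> (real \<Rightarrow> real^'n \<Rightarrow> real^'n) \<Rightarrow>
    (real \<Rightarrow> real^'n \<Rightarrow> real^'n) \<Rightarrow> bool" where
  "is_cont_rep T \<Omega> v c \<longleftrightarrow>
     (\<forall>t\<in>{0..T}. c t \<in> L2 \<Omega> \<and>
        ((\<lambda>s. L2_norm \<Omega> (\<lambda>x. c s x - c t x)) \<longlongrightarrow> 0) (at t within {0..T})) \<and>
     (AE t in lebesgue_on {0<..<T}. AE x in lebesgue_on \<Omega>. c t x = v t x)"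

text \<open>Point evaluation in time on the closed interval, via the embedding into \<open>C\<^sup>0([0,T];L\<^sup>2(\<Omega>))\<close>.\<close>

definition eval_at :: "real \<Rightarrow> (real^'n) set \<Rightarrow> (real \<Rightarrow> real^'n \<Rightarrow> real^'n) \<Rightarrow>
    real \<Rightarrow> real^'n \<Rightarrow> real^'n" where
  "eval_at T \<Omega> v = (SOME c. is_cont_rep T \<Omega> v c)"

subsection \<open>Linear elasticity\<close>

definition sym_part :: "real^'n^'n \<Rightarrow> real^'n^'n" where
  "sym_part A = (1/2) *\<^sub>R (A + transpose A)"

definition sym_mats :: "(real^'n^'n) set" where
  "sym_mats = {A. transpose A = A}"

text \<open>\<open>\<kappa>\<close> is the second Lame constant, usually written \<open>\<lambda>\<close>.\<close>

definition elast :: "real \<Rightarrow> real \<Rightarrow> real^'n^'n \<Rightarrow> real^'n^'n" where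
  "elast \<mu> \<kappa> A = (2 * \<mu>) *\<^sub>R A + (\<kappa> * trace A) *\<^sub>R mat 1"

definition pos_def_on :: "'a::euclidean_space set \<Rightarrow> ('a \<Rightarrow> 'a) \<Rightarrow> bool" where
  "pos_def_on S B \<longleftrightarrow> linear B \<and> B ` S \<subseteq> S \<and> (\<forall>a\<in>S. \<forall>b\<in>S. B a \<bullet> b = a \<bullet> B b) \<and>
     (\<forall>a\<in>S. a \<noteq> 0 \<longrightarrow> 0 < B a \<bullet> a)"

text \<open>The positive definite square root of a positive definite map \<open>A\<close> of the subspace \<open>S\<close>; only its
  values on \<open>S\<close> are determined (uniquely).\<close>

definition sqrt_map :: "'a::euclidean_space set \<Rightarrow> ('a \<Rightarrow> 'a) \<Rightarrow> 'a \<Rightarrow> 'a" where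
  "sqrt_map S A = (SOME B. pos_def_on S B \<and> (\<forall>a\<in>S. B (B a) = A a))"

definition elast_sqrt :: "real \<Rightarrow> real \<Rightarrow> real^'n^'n \<Rightarrow> real^'n^'n" where
  "elast_sqrt \<mu> \<kappa> = sqrt_map sym_mats (elast \<mu> \<kappa>)"

definition elast_inv_sqrt :: "real \<Rightarrow> real \<Rightarrow> real^'n^'n \<Rightarrow> real^'n^'n" where
  "elast_inv_sqrt \<mu> \<kappa> = inv_into sym_mats (elast_sqrt \<mu> \<kappa>)"

definition sym_grad :: "(real^'n) set \<Rightarrow> (real^'n \<Rightarrow> real^'n) \<Rightarrow> real^'n \<Rightarrow> real^'n^'n" where
  "sym_grad \<Omega> v x = sym_part (wgrad \<Omega> v x)"

text \<open>\<open>- div C sym \<nabla> v\<close> as an element of the dual space.\<close>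

definition lame_op :: "real \<Rightarrow> real \<Rightarrow> (real^'n) set \<Rightarrow> (real^'n \<Rightarrow> real^'n) \<Rightarrow>
    (real^'n \<Rightarrow> real^'n) \<Rightarrow> real" where
  "lame_op \<mu> \<kappa> \<Omega> v w = (LINT x|lebesgue_on \<Omega>. elast \<mu> \<kappa> (sym_grad \<Omega> v x) \<bullet> sym_grad \<Omega> w x)"

definition div_dual :: "(real^'n) set \<Rightarrow> (real^'n \<Rightarrow> real^'n^'n) \<Rightarrow> (real^'n \<Rightarrow> real^'n) \<Rightarrow> real" where
  "div_dual \<Omega> y v = - (LINT x|lebesgue_on \<Omega>. y x \<bullet> wgrad \<Omega> v x)"

definition navier_lame_solution :: "real \<Rightarrow> (real^'n) set \<Rightarrow> real \<Rightarrow> real \<Rightarrow>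
    (real \<Rightarrow> (real^'n \<Rightarrow> real^'n) \<Rightarrow> real) \<Rightarrow> (real^'n \<Rightarrow> real^'n) \<Rightarrow>
    (real \<Rightarrow> real^'n \<Rightarrow> real^'n) \<Rightarrow> bool" where
  "navier_lame_solution T \<Omega> \<mu> \<kappa> f u0 u \<longleftrightarrow> u \<in> W_space T \<Omega> \<and>
     (AE t in lebesgue_on {0<..<T}. \<forall>v\<in>W12_0 \<Omega>.
        time_deriv T \<Omega> u t v + lame_op \<mu> \<kappa> \<Omega> (u t) v = f t v) \<and>
     (AE x in lebesgue_on \<Omega>. eval_at T \<Omega> u 0 x = u0 x)"

end

theory Submission
  imports Defs
begin

text \<open>
  Put \<open>w = \<lambda> - u\<close>, \<open>e = sym \<nabla> w\<close> and \<open>p = y - z\<close>. Since \<open>y - \<C> sym \<nabla> \<lambda> = p - \<C> e\<close>, expanding the square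
  gives \<open>|\<C>\<^sup>-\<^sup>1\<^sup>/\<^sup>2 (p - \<C> e)|\<^sup>2 = |\<C>\<^sup>-\<^sup>1\<^sup>/\<^sup>2 p|\<^sup>2 - 2 p : e + |\<C>\<^sup>1\<^sup>/\<^sup>2 e|\<^sup>2\<close>, and subtracting the two evolution
  equations gives \<open>\<langle>\<partial>\<^sub>t w, w\<rangle> = - \<integral> p : e\<close>. So the claim is the energy identity
  \<open>|w(T)|\<^sup>2 - |w(0)|\<^sup>2 = 2 \<integral> \<langle>\<partial>\<^sub>t w, w\<rangle> dt\<close> in \<open>\<W>(I)\<close>.

  The energy identity is obtained without integrating vector-valued functions. Du Bois-Reymond's
  lemma, applied to the scalar functions \<open>(v(\<cdot>), x)\<close>, shows for \<open>s\<close>, \<open>t\<close> outside a null set that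
  \<open>(v(t) - v(s), x) = \<integral>\<^sub>s\<^sup>t \<langle>g, x\<rangle>\<close> for all \<open>x\<close> among the values of \<open>v\<close>, where \<open>g = \<partial>\<^sub>t v\<close>. Hence
  \<open>|v(t)|\<^sup>2 - |v(s)|\<^sup>2 - 2 \<integral>\<^sub>s\<^sup>t \<langle>g, v\<rangle>\<close> equals \<open>\<integral>\<^sub>s\<^sup>t \<langle>g(r), (v(t) - v(r)) + (v(s) - v(r))\<rangle> dr\<close>. It is additive
  in the interval, and summing it over a fine partition whose points avoid large values of the
  approximation error of \<open>v\<close> by simple functions shows that it vanishes.
\<close>

subsection \<open>Smooth cut-off functions\<close>

text \<open>Single times carry no information: \<open>v\<close> is only square integrable with
  values in \<open>W12_0 \<Omega>\<close>, and gradients, time derivatives and values at a time are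
  choices. Two obstacles follow. The null set of the scalar identity depends on the test element,
  while the identity is needed with the values of \<open>v\<close> as test elements. It becomes
  uniform by testing with the countably many values of the approximating simple functions and
  passing to the limit at those times at which they converge. Moreover, the remainder over a short
  interval contains the error at its end points, and no bound holds at every time. But each cell of
  a uniform partition contains a good time whose error is at most average, and the sum over such
  times is controlled by an integral. The same choice of an intermediate time bounds the increments
  of \<open>v\<close> in \<open>L2 \<Omega>\<close> by those of a continuous monotone function; this
  yields the continuous representative, makes \<open>eval_at\<close> meaningful and carries the
  identity to 0 and \<open>T\<close>. The cut-offs serve twice: for the uniqueness of weak gradients
  and for Du Bois-Reymond's lemma.\<close>

lemma times_cont_diff_SucI:
  assumes "\<And>x. (f has_derivative D x) (at x)" and "\<And>h. times_cont_diff k (\<lambda>x. D x h)"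
  shows "times_cont_diff (Suc k) f"
proof -
  have "frechet_derivative f (at x) = D x" for x
    using frechet_derivative_at[OF assms(1)] by simp
  then show ?thesis
    using assms by (auto simp: differentiable_def)
qed

lemma times_cont_diff_SucD:
  assumes "times_cont_diff (Suc k) f"
  shows "(f has_derivative frechet_derivative f (at x)) (at x)"
    and "times_cont_diff k (\<lambda>x. frechet_derivative f (at x) h)"
  using assms by (auto simp: frechet_derivative_works[symmetric])

lemma times_cont_diff_Suc_le: "times_cont_diff (Suc k) f \<Longrightarrow> times_cont_diff k f"
proof (induction k arbitrary: f)
  case 0
  then show ?case
    by (auto intro!: continuous_at_imp_continuous_on differentiable_imp_continuous_within)
next
  case (Suc k)
  then show ?case
    by (metis times_cont_diff.simps(2))
qed

lemma times_cont_diff_const: "times_cont_diff k (\<lambda>x. c)"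
proof (induction k arbitrary: c)
  case (Suc k)
  then show ?case
    by (auto simp del: times_cont_diff.simps intro!: times_cont_diff_SucI[where D = "\<lambda>x h. 0"])
qed simp

lemma times_cont_diff_add:
  "times_cont_diff k f \<Longrightarrow> times_cont_diff k g \<Longrightarrow> times_cont_diff k (\<lambda>x. f x + g x)"
proof (induction k arbitrary: f g)
  case 0
  then show ?case by (simp add: continuous_on_add)
next
  case (Suc k)
  show ?case
    by (rule times_cont_diff_SucI[OF has_derivative_add[OF times_cont_diff_SucD(1)[OF Suc.prems(1)]
            times_cont_diff_SucD(1)[OF Suc.prems(2)]]])
      (intro Suc.IH times_cont_diff_SucD(2) Suc.prems)
qed

lemma times_cont_diff_scaleR:
  "times_cont_diff k f \<Longrightarrow> times_cont_diff k g \<Longrightarrow> times_cont_diff k (\<lambda>x. f x *\<^sub>R g x)"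
proof (induction k arbitrary: f g)
  case 0
  then show ?case by (simp add: continuous_on_scaleR)
next
  case (Suc k)
  show ?case
    by (rule times_cont_diff_SucI[OF has_derivative_scaleR[OF times_cont_diff_SucD(1)[OF Suc.prems(1)]
            times_cont_diff_SucD(1)[OF Suc.prems(2)]]])
      (intro Suc.IH times_cont_diff_add times_cont_diff_SucD(2) Suc.prems[THEN times_cont_diff_Suc_le] Suc.prems)
qed

lemma times_cont_diff_mult:
  fixes f g :: "_ \<Rightarrow> real"
  shows "times_cont_diff k f \<Longrightarrow> times_cont_diff k g \<Longrightarrow> times_cont_diff k (\<lambda>x. f x * g x)"
  using times_cont_diff_scaleR[of k f g] by simp

lemma times_cont_diff_prod:
  fixes f :: "_ \<Rightarrow> _ \<Rightarrow> real"
  shows "(\<And>i. i \<in> S \<Longrightarrow> times_cont_diff k (f i)) \<Longrightarrow> times_cont_diff k (\<lambda>x. \<Prod>i\<in>S. f i x)"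
  by (induction S rule: infinite_finite_induct)
    (simp_all add: times_cont_diff_const times_cont_diff_mult)

lemma times_cont_diff_linear_compose:
  assumes L: "bounded_linear L"
  shows "times_cont_diff k f \<Longrightarrow> times_cont_diff k (\<lambda>x. L (f x))"
proof (induction k arbitrary: f)
  case 0
  then show ?case using L by (simp add: bounded_linear.continuous_on)
next
  case (Suc k)
  show ?case
    by (rule times_cont_diff_SucI[OF bounded_linear.has_derivative[OF L times_cont_diff_SucD(1)[OF Suc.prems]]])
      (intro Suc.IH times_cont_diff_SucD(2)[OF Suc.prems])
qed

text \<open>The chain rule for an affine inner function keeps the form: a directional derivative is
  a constant times the derivative of \<open>g\<close> after the same affine map, so the induction on
  \<open>k\<close> closes.\<close>

lemma times_cont_diff_compose_affine:
  fixes g :: "real \<Rightarrow> real"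
  shows "times_cont_diff k g \<Longrightarrow> times_cont_diff k (\<lambda>x. g (c * (x \<bullet> b) + e))"
proof (induction k arbitrary: g)
  case 0
  then have "continuous_on UNIV g" by simp
  then have "continuous_on UNIV (\<lambda>x. g (c * (x \<bullet> b) + e))"
    by (rule continuous_on_compose2) (auto intro!: continuous_intros)
  then show ?case by simp
next
  case (Suc k)
  let ?D = "\<lambda>y. frechet_derivative g (at y)"
  have 1: "((\<lambda>x. g (c * (x \<bullet> b) + e)) has_derivative (\<lambda>h. ?D (c * (x \<bullet> b) + e) (c * (h \<bullet> b)))) (at x)" for x
    by (rule has_derivative_compose[OF _ times_cont_diff_SucD(1)[OF Suc.prems]])
      (auto intro!: derivative_eq_intros)
  \<comment> \<open>A linear map on the reals is determined by its value at 1, so the induction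
    hypothesis can be applied to the scalar function \<open>?D y 1\<close> of
    \<open>y\<close>.\<close>
  have "linear (?D y)" for y
    using times_cont_diff_SucD(1)[OF Suc.prems] has_derivative_linear by blast
  then have 2: "?D y s = s * ?D y 1" for y s
    by (metis linear_scale_real mult.right_neutral)
  show ?case
  proof (rule times_cont_diff_SucI[OF 1])
    fix h
    have "times_cont_diff k (\<lambda>x. (c * (h \<bullet> b)) * ?D (c * (x \<bullet> b) + e) 1)"
      by (intro times_cont_diff_mult times_cont_diff_const Suc.IH[of "\<lambda>y. ?D y 1"] times_cont_diff_SucD(2) Suc.prems)
    then show "times_cont_diff k (\<lambda>x. ?D (c * (x \<bullet> b) + e) (c * (h \<bullet> b)))"
      by (subst 2)
  qed
qed

text \<open>The functions \<open>t \<mapsto> p (1/t) exp (-1/t)\<close>, extended by \<open>0\<close>, are closed under differentiation.\<close>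

definition exp_bump :: "real poly \<Rightarrow> real \<Rightarrow> real" where
  "exp_bump p t = (if t > 0 then poly p (1 / t) * exp (- (1 / t)) else 0)"

lemma poly_div_exp_tendsto_0: "((\<lambda>x. poly p x * exp (- x)) \<longlongrightarrow> (0::real)) at_top"
proof -
  have "((\<lambda>x. \<Sum>i\<le>degree p. coeff p i * (x ^ i / exp x)) \<longlongrightarrow> (\<Sum>i\<le>degree p. coeff p i * 0)) at_top"
    by (intro tendsto_sum tendsto_mult tendsto_const tendsto_power_div_exp_0)
  then show ?thesis
    by (simp add: poly_altdef exp_minus field_simps sum_distrib_left)
qed

text \<open>With s = 1/t the derivative of p(s) exp(-s) in t is s^2 (p - p')(s) exp(-s); the
  polynomial \<open>[:0,0,1:]\<close> is the factor s^2. At 0 the right difference quotient is s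
  p(s) exp(-s), which tends to 0 as s grows.\<close>

lemma exp_bump_has_derivative:
  "(exp_bump p has_real_derivative exp_bump ([:0,0,1:] * (p - pderiv p)) t) (at t)"
proof -
  consider "t > 0" | "t < 0" | "t = 0" by linarith
  then show ?thesis
  proof cases
    case 1
    have "((\<lambda>t. poly p (1 / t) * exp (- (1 / t))) has_real_derivative
       exp_bump ([:0,0,1:] * (p - pderiv p)) t) (at t)"
      using 1 by (auto intro!: derivative_eq_intros poly_DERIV[THEN DERIV_chain2]
          simp: exp_bump_def field_simps power2_eq_square)
    then show ?thesis
      by (rule has_field_derivative_transform_within_open[where S = "{0<..}"])
        (use 1 in \<open>auto simp: exp_bump_def\<close>)
  next
    case 2
    show ?thesis
      by (rule has_field_derivative_transform_within_open[where S = "{..<0}" and f = "\<lambda>_. 0"])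
        (use 2 in \<open>auto simp: exp_bump_def\<close>)
  next
    case 3
    have r: "((\<lambda>t. exp_bump p t / t) \<longlongrightarrow> 0) (at_right 0)"
    proof -
      have "((\<lambda>t. poly ([:0,1:] * p) (1/t) * exp (- (1/t))) \<longlongrightarrow> 0) (at_right (0::real))"
        by (rule filterlim_compose[OF poly_div_exp_tendsto_0])
          (use filterlim_inverse_at_top_right in \<open>simp add: inverse_eq_divide\<close>)
      then show ?thesis
        by (rule Lim_transform_eventually)
          (auto simp: eventually_at_right_less exp_bump_def eventually_at_filter)
    qed
    have l: "((\<lambda>t. exp_bump p t / t) \<longlongrightarrow> 0) (at_left 0)"
      by (rule Lim_transform_eventually[OF tendsto_const])
        (auto simp: exp_bump_def eventually_at_filter)
    have "((\<lambda>t. exp_bump p t / t) \<longlongrightarrow> 0) (at 0)"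
      using l r by (simp add: filterlim_split_at)
    then show ?thesis
      using 3 by (simp add: DERIV_def exp_bump_def)
  qed
qed

lemma times_cont_diff_exp_bump: "times_cont_diff k (exp_bump p)"
proof (induction k arbitrary: p)
  case 0
  then show ?case
    by (auto intro!: continuous_at_imp_continuous_on DERIV_isCont[OF exp_bump_has_derivative])
next
  case (Suc k)
  show ?case
    by (rule times_cont_diff_SucI[OF exp_bump_has_derivative[unfolded has_field_derivative_def]])
      (intro times_cont_diff_mult times_cont_diff_const Suc.IH)
qed

text \<open>Positive exactly on the open box, with values between 0 and 1. Since exp(-1/((n+1) s))
  tends to 1 for s > 0, the dilation by n + 1 makes these functions tend to the indicator of the
  box.\<close>

definition box_bump :: "nat \<Rightarrow> 'a::euclidean_space \<Rightarrow> 'a \<Rightarrow> 'a \<Rightarrow> real" where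
  "box_bump n a b x =
     (\<Prod>i\<in>Basis. exp_bump 1 (real (Suc n) * ((x - a) \<bullet> i)) * exp_bump 1 (real (Suc n) * ((b - x) \<bullet> i)))"

lemma exp_bump_1_le: "0 \<le> exp_bump 1 t" "exp_bump 1 t \<le> 1"
  by (auto simp: exp_bump_def)

lemma exp_bump_1_eq_0_iff: "exp_bump 1 t = 0 \<longleftrightarrow> t \<le> 0"
  by (auto simp: exp_bump_def)

lemma box_bump_bounds: "0 \<le> box_bump n a b x" "box_bump n a b x \<le> 1"
  unfolding box_bump_def
  by (auto intro!: prod_nonneg prod_le_1 mult_le_one mult_nonneg_nonneg simp: exp_bump_1_le)

lemma box_bump_eq_0_iff: "box_bump n a b x = 0 \<longleftrightarrow> x \<notin> box a b"
proof -
  have "0 < real (Suc n) * s \<longleftrightarrow> 0 < s" for s by (simp add: zero_less_mult_iff)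
  then show ?thesis
    by (auto simp: box_bump_def exp_bump_1_eq_0_iff mem_box inner_diff_left not_le not_less mult_le_0_iff)
qed

lemma times_cont_diff_box_bump: "times_cont_diff k (box_bump n a b)"
proof -
  have "times_cont_diff k (\<lambda>x. exp_bump 1 (real (Suc n) * (x \<bullet> i) + - (real (Suc n) * (a \<bullet> i))) *
     exp_bump 1 ((- real (Suc n)) * (x \<bullet> i) + real (Suc n) * (b \<bullet> i)))" for i
    by (intro times_cont_diff_mult times_cont_diff_compose_affine times_cont_diff_exp_bump)
  then have "times_cont_diff k (\<lambda>x. \<Prod>i\<in>Basis. exp_bump 1 (real (Suc n) * (x \<bullet> i) + - (real (Suc n) * (a \<bullet> i))) *
     exp_bump 1 ((- real (Suc n)) * (x \<bullet> i) + real (Suc n) * (b \<bullet> i)))"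
    by (intro times_cont_diff_prod)
  then show ?thesis
    by (simp add: box_bump_def[abs_def] inner_diff_left algebra_simps)
qed

lemma box_bump_test_fun:
  assumes "cbox a b \<subseteq> U"
  shows "box_bump n a b \<in> test_funs U"
proof -
  have "closure {x. box_bump n a b x \<noteq> 0} \<subseteq> cbox a b"
    by (rule closure_minimal) (auto simp: box_bump_eq_0_iff box_subset_cbox[THEN subsetD])
  moreover from this have "compact (closure {x. box_bump n a b x \<noteq> 0})"
    by (meson bounded_cbox bounded_subset closed_closure compact_eq_bounded_closed)
  ultimately show ?thesis
    using assms by (auto simp: test_funs_def times_cont_diff_box_bump)
qed

lemma box_bump_tendsto: "(\<lambda>n. box_bump n a b x) \<longlonglongrightarrow> indicator (box a b) x"
proof (cases "x \<in> box a b")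
  case False
  then show ?thesis by (simp add: box_bump_eq_0_iff[THEN iffD2])
next
  case True
  have *: "(\<lambda>n. exp_bump 1 (real (Suc n) * s)) \<longlonglongrightarrow> 1" if "s > 0" for s
  proof -
    have "(\<lambda>n. exp (- (inverse (real (Suc n)) * (1 / s)))) \<longlonglongrightarrow> exp (- (0 * (1 / s)))"
      by (intro tendsto_intros LIMSEQ_inverse_real_of_nat)
    moreover have "exp_bump 1 (real (Suc n) * s) = exp (- (inverse (real (Suc n)) * (1 / s)))" for n
      using that by (simp add: exp_bump_def field_simps add_pos_nonneg)
    ultimately show ?thesis by simp
  qed
  have "(\<lambda>n. box_bump n a b x) \<longlonglongrightarrow> (\<Prod>i\<in>(Basis::'a set). 1 * 1)"
    unfolding box_bump_def using True
    by (intro tendsto_prod tendsto_mult *) (auto simp: mem_box inner_diff_left)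
  then show ?thesis using True by simp
qed

subsection \<open>Test functions and weak derivatives\<close>

text \<open>Open boxes are stable under intersection and generate the Borel sets, so a Dynkin
  argument extends the vanishing of the integrals from sub-boxes to
  \<open>A \<inter> box a b\<close> for every Borel \<open>A\<close>. The sets where
  \<open>f\<close> is positive and where it is negative then decide.\<close>

lemma integral_zero_imp_AE_zero_box:
  fixes f :: "'a::euclidean_space \<Rightarrow> real"
  assumes f: "integrable lborel f"
    and 0: "\<And>c d. cbox c d \<subseteq> cbox a b \<Longrightarrow> (LINT x|lborel. indicator (box c d) x * f x) = 0"
  shows "AE x in lborel. x \<in> box a b \<longrightarrow> f x = 0"
proof -
  have meas[measurable]: "f \<in> borel_measurable borel"
    using borel_measurable_integrable[OF f] by simp
  let ?K = "box a b"
  have int: "integrable lborel (\<lambda>x. indicator A x * f x)" if [measurable]: "A \<in> sets borel" for A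
    by (rule Bochner_Integration.integrable_bound[OF f]) (auto split: split_indicator)
  have key: "(LINT x|lborel. indicator (A \<inter> ?K) x * f x) = 0" if "A \<in> sets borel" for A
  proof -
    have A: "A \<in> sigma_sets UNIV (range (\<lambda>(a, b). box a b))"
      using that by (subst (asm) borel_eq_box) (simp add: sets_measure_of)
    have Int: "Int_stable (range (\<lambda>(a, b). box a b) :: 'a set set)"
      by (auto simp: Int_stable_def Int_interval box_Int_box)
    have sb: "sigma_sets UNIV (range (\<lambda>(a, b). box a b) :: 'a set set) = sets borel"
      by (subst borel_eq_box) (simp add: sets_measure_of)
    have cl: "range (\<lambda>(a, b). box a b) \<subseteq> Pow (UNIV :: 'a set)" by simp
    show ?thesis
      using Int cl A
    proof (induction rule: sigma_sets_induct_disjoint)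
      case (basic A)
      then obtain c d where A: "A = box c d" by auto
      obtain c' d' where cd: "A \<inter> ?K = box c' d'"
        unfolding A box_Int_box by blast
      show ?case
      \<comment> \<open>For an empty open box nothing is known about \<open>cbox c' d'\<close>, but
        its integral is trivially 0; otherwise \<open>cbox c' d'\<close> is the closure of the open
        box.\<close>
      proof (cases "box c' d' = {}")
        case True
        then show ?thesis by (simp add: cd)
      next
        case False
        then have "cbox c' d' \<subseteq> cbox a b"
          using cd by (metis box_subset_cbox closure_box closure_minimal closed_cbox inf_le2 order_trans)
        then show ?thesis unfolding cd by (rule 0)
      qed
    next
      case empty
      then show ?case by simp
    next
      case (compl A)
      then have [measurable]: "A \<in> sets borel" by (simp add: sb)
      have "(LINT x|lborel. indicator ((UNIV - A) \<inter> ?K) x * f x) =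
        (LINT x|lborel. indicator ?K x * f x - indicator (A \<inter> ?K) x * f x)"
        by (intro Bochner_Integration.integral_cong) (auto split: split_indicator)
      also have "\<dots> = 0"
        by (subst Bochner_Integration.integral_diff) (auto intro!: int simp: 0 compl)
      finally show ?case .
    next
      case (union A)
      then have [measurable]: "A i \<in> sets borel" for i by (auto simp: sb)
      have "(LINT x:(\<Union>i. A i \<inter> ?K)|lborel. f x) = (\<Sum>i. (LINT x:(A i \<inter> ?K)|lborel. f x))"
        by (rule lebesgue_integral_countable_add)
          (use union(1) in \<open>auto simp: disjoint_family_on_def set_integrable_def intro!: int[simplified]\<close>)
      then show ?case
        using union(3) by (simp add: set_lebesgue_integral_def)
    qed
  qed
  have pos: "{x. f x > 0} \<in> sets borel" and neg: "{x. f x < 0} \<in> sets borel" by measurable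
  have "AE x in lborel. indicator ({x. f x > 0} \<inter> ?K) x * f x = 0"
    by (rule integral_nonneg_eq_0_iff_AE[THEN iffD1, OF _ _ key[OF pos]])
      (use pos in \<open>auto intro!: int split: split_indicator\<close>)
  moreover have "AE x in lborel. - (indicator ({x. f x < 0} \<inter> ?K) x * f x) = 0"
    by (rule integral_nonneg_eq_0_iff_AE[THEN iffD1])
      (use neg key[OF neg] in \<open>auto intro!: int integrable_minus split: split_indicator\<close>)
  ultimately show ?thesis
    by eventually_elim (auto split: split_indicator_asm)
qed

lemma integral_eq_0_on:
  fixes f :: "'a::euclidean_space \<Rightarrow> real"
  shows "(\<And>x. x \<in> S \<Longrightarrow> f x = 0) \<Longrightarrow> integral S f = 0"
  using Henstock_Kurzweil_Integration.integral_cong[of S f "\<lambda>_. 0"] by simp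

lemma integrable_lebesgue_on_iff:
  fixes f :: "'a::euclidean_space \<Rightarrow> 'b::{banach, second_countable_topology}"
  assumes "U \<in> sets lebesgue"
  shows "integrable (lebesgue_on U) f \<longleftrightarrow> integrable lebesgue (\<lambda>x. indicator U x *\<^sub>R f x)"
  using assms by (intro integrable_restrict_space) auto

lemma integrable_lebesgue_on_subset:
  fixes f :: "'a::euclidean_space \<Rightarrow> 'b::{banach, second_countable_topology}"
  assumes "integrable (lebesgue_on S) f" "A \<subseteq> S" "A \<in> sets lebesgue" "S \<in> sets lebesgue"
  shows "integrable (lebesgue_on A) f"
  using set_integrable_subset[of lebesgue S f A] assms by (simp add: integrable_lebesgue_on_iff set_integrable_def)

lemma LINT_lebesgue_on_eq:
  fixes f :: "'a::euclidean_space \<Rightarrow> 'b::{banach, second_countable_topology}"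
  assumes "U \<in> sets lebesgue"
  shows "(LINT x|lebesgue_on U. f x) = (LINT x|lebesgue. indicator U x *\<^sub>R f x)"
  using assms by (intro integral_restrict_space) auto

text \<open>The fundamental lemma of the calculus of variations. The function is extended by 0 and
  replaced by a Borel version \<open>F'\<close>; the bumps give its integrals over boxes by
  dominated convergence, and an open set is a countable union of closed boxes.\<close>

lemma test_funs_integral_zero_imp_AE_zero:
  fixes f :: "'a::euclidean_space \<Rightarrow> real"
  assumes U: "open U" and f: "integrable (lebesgue_on U) f"
    and 0: "\<And>\<phi>. \<phi> \<in> test_funs U \<Longrightarrow> (LINT x|lebesgue_on U. f x * \<phi> x) = 0"
  shows "AE x in lebesgue_on U. f x = 0"
proof -
  have Us[measurable]: "U \<in> sets borel" "U \<in> sets lebesgue" using U by auto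
  define F where "F x = indicator U x * f x" for x
  have F: "integrable lebesgue F"
    using f Us by (simp add: integrable_lebesgue_on_iff F_def[abs_def])
  obtain F' where F'[measurable]: "F' \<in> borel_measurable lborel" and ae: "AE x in lborel. F x = F' x"
    using completion_ex_borel_measurable_real[OF borel_measurable_integrable[OF F]] by blast
  have ae': "AE x in lebesgue. F x = F' x"
    using AE_completion[OF ae] .
  have F'm: "F' \<in> borel_measurable lebesgue"
    by (rule measurable_completion) simp
  have int': "integrable lebesgue F'"
    by (rule integrable_cong_AE_imp[OF F F'm ae'])
  then have int: "integrable lborel F'"
    by (simp add: integrable_completion)
  have test: "(LINT x|lborel. F' x * \<phi> x) = 0" if \<phi>: "\<phi> \<in> test_funs U" for \<phi>
  proof -
    have "\<forall>k. times_cont_diff k \<phi>" using \<phi> by (simp add: test_funs_def)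
    then have "continuous_on UNIV \<phi>" by (metis times_cont_diff.simps(1))
    then have [measurable]: "\<phi> \<in> borel_measurable borel" by (rule borel_measurable_continuous_onI)
    have [measurable]: "\<phi> \<in> borel_measurable lebesgue" by (rule measurable_completion) simp
    have "(LINT x|lborel. F' x * \<phi> x) = (LINT x|lebesgue. F' x * \<phi> x)"
      by (rule integral_completion[symmetric]) simp
    also have "\<dots> = (LINT x|lebesgue. F x * \<phi> x)"
      by (rule integral_cong_AE) (use ae' F F'm in \<open>auto intro!: borel_measurable_times\<close>)
    also have "\<dots> = (LINT x|lebesgue_on U. f x * \<phi> x)"
      using Us by (simp add: LINT_lebesgue_on_eq F_def mult_ac)
    finally show ?thesis using 0[OF \<phi>] by simp
  qed
  have box0: "AE x in lborel. x \<in> box a b \<longrightarrow> F' x = 0" if ab: "cbox a b \<subseteq> U" for a b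
  proof (rule integral_zero_imp_AE_zero_box[OF int])
    fix c d assume "cbox c d \<subseteq> cbox a b"
    then have cd: "cbox c d \<subseteq> U" using ab by blast
    have "continuous_on UNIV (box_bump n c d)" for n
      using times_cont_diff_box_bump[of 0 n c d] by simp
    then have [measurable]: "box_bump n c d \<in> borel_measurable borel" for n
      by (rule borel_measurable_continuous_onI)
    have "(\<lambda>n. LINT x|lborel. F' x * box_bump n c d x) \<longlonglongrightarrow> (LINT x|lborel. F' x * indicator (box c d) x)"
    proof (rule integral_dominated_convergence[where w = "\<lambda>x. \<bar>F' x\<bar>"])
      show "AE x in lborel. norm (F' x * box_bump n c d x) \<le> \<bar>F' x\<bar>" for n
        using box_bump_bounds[of n c d] by (auto simp: abs_mult mult_left_le)
    qed (use int in \<open>auto intro!: tendsto_mult box_bump_tendsto\<close>)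
    then show "(LINT x|lborel. indicator (box c d) x * F' x) = 0"
      using test[OF box_bump_test_fun[OF cd]] by (simp add: LIMSEQ_const_iff mult.commute)
  qed
  \<comment> \<open>The covering of \<open>U\<close> uses closed boxes; the boundary of a box is a
    null set.\<close>
  have cbox0: "AE x in lborel. x \<in> cbox a b \<longrightarrow> F' x = 0" if ab: "cbox a b \<subseteq> U" for a b
  proof -
    have "cbox a b - box a b \<in> null_sets lborel"
      by (simp add: null_sets_def emeasure_lborel_cbox_eq emeasure_lborel_box_eq emeasure_Diff box_subset_cbox)
    from AE_not_in[OF this] box0[OF ab] show ?thesis
      by eventually_elim auto
  qed
  obtain \<D> where \<D>: "countable \<D>" "\<And>X. X \<in> \<D> \<Longrightarrow> X \<subseteq> U \<and> (\<exists>a b. X = cbox a b)" "\<Union>\<D> = U"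
    using open_countable_Union_open_cbox[OF U] by (metis PowD subset_iff)
  have "AE x in lborel. \<forall>X\<in>\<D>. x \<in> X \<longrightarrow> F' x = 0"
    by (subst AE_ball_countable[OF \<D>(1)]) (metis \<D>(2) cbox0)
  with ae have "AE x in lborel. x \<in> U \<longrightarrow> f x = 0"
  proof eventually_elim
    case (elim x)
    show ?case
    proof
      assume x: "x \<in> U"
      then have "F' x = 0" using elim(2) \<D>(3) by blast
      then show "f x = 0" using elim(1) x by (simp add: F_def)
    qed
  qed
  then show ?thesis
    using AE_completion Us by (subst AE_restrict_space_iff) auto
qed

section \<open>Integrals of derivatives of compactly supported functions\<close>

lemma integral_lborel_translate:
  fixes f :: "'a::euclidean_space \<Rightarrow> real"
  assumes [measurable]: "f \<in> borel_measurable borel"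
  shows "(LINT x|lborel. f (c + x)) = (LINT x|lborel. f x)"
    and "integrable lborel f \<Longrightarrow> integrable lborel (\<lambda>x. f (c + x))"
proof -
  have "(LINT x|lborel. f x) = (LINT x|distr lborel borel ((+) c). f x)"
    by (simp add: lborel_distr_plus)
  then show "(LINT x|lborel. f (c + x)) = (LINT x|lborel. f x)"
    by (subst (asm) integral_distr) auto
  assume "integrable lborel f"
  then have "integrable (distr lborel borel ((+) c)) f"
    by (simp add: lborel_distr_plus)
  then show "integrable lborel (\<lambda>x. f (c + x))"
    by (subst (asm) integrable_distr_eq) auto
qed

lemma integrable_lborel_compact_support:
  fixes f :: "'a::euclidean_space \<Rightarrow> real"
  assumes "continuous_on UNIV f" "compact K" "\<And>x. x \<notin> K \<Longrightarrow> f x = 0"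
  shows "integrable lborel f"
proof -
  have "integrable lborel (\<lambda>x. indicator K x *\<^sub>R f x)"
    using borel_integrable_compact[of K f] assms by (meson continuous_on_subset subset_UNIV)
  moreover have "(\<lambda>x. indicator K x *\<^sub>R f x) = f"
    using assms(3) by (auto split: split_indicator)
  ultimately show ?thesis by simp
qed

lemma frechet_derivative_zero_outside_support:
  assumes "x \<notin> closure {x. F x \<noteq> 0}"
  shows "frechet_derivative F (at x) = (\<lambda>h. 0)"
proof -
  have F0: "F y = 0" if "y \<notin> closure {x. F x \<noteq> 0}" for y
    using that closure_subset[of "{x. F x \<noteq> 0}"] by auto
  have "(F has_derivative (\<lambda>h. 0)) (at x)"
  proof (rule has_derivative_transform_within_open[OF has_derivative_const[of 0 "at x"]])
    show "x \<in> - closure {x. F x \<noteq> 0}" using assms by blast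
    show "0 = F y" if "y \<in> - closure {x. F x \<noteq> 0}" for y using F0[of y] that by fastforce
  qed (rule open_Compl[OF closed_closure])
  then show ?thesis
    using frechet_derivative_at by metis
qed

text \<open>The difference quotients of \<open>F\<close> integrate to zero by translation invariance.\<close>

lemma integral_frechet_derivative_eq_0:
  fixes F :: "'a::euclidean_space \<Rightarrow> real"
  assumes F: "times_cont_diff 1 F" and K: "compact (closure {x. F x \<noteq> 0})"
  shows "integrable lborel (\<lambda>x. frechet_derivative F (at x) j)"
    and "(LINT x|lborel. frechet_derivative F (at x) j) = 0"
proof -
  let ?K = "closure {x. F x \<noteq> 0}"
  define D where "D x = frechet_derivative F (at x) j" for x
  have F1: "times_cont_diff (Suc 0) F" using F by simp
  have contD: "continuous_on UNIV D"
    using times_cont_diff_SucD(2)[OF F1, of j] by (simp add: D_def[abs_def])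
  have contF: "continuous_on UNIV F"
    using times_cont_diff_Suc_le[OF F1] by simp
  have F0: "F x = 0" if "x \<notin> ?K" for x
    using that closure_subset[of "{x. F x \<noteq> 0}"] by auto
  have D0: "D x = 0" if "x \<notin> ?K" for x
    unfolding D_def by (subst frechet_derivative_zero_outside_support[OF that]) (rule refl)
  show intD: "integrable lborel (\<lambda>x. frechet_derivative F (at x) j)"
    using integrable_lborel_compact_support[OF contD K D0] by (simp add: D_def[abs_def])
  have intF: "integrable lborel F"
    using integrable_lborel_compact_support[OF contF K F0] .
  have [measurable]: "F \<in> borel_measurable borel" "D \<in> borel_measurable borel"
    using contF contD by (auto intro: borel_measurable_continuous_onI)
  have "bounded (D ` ?K)"
    by (intro compact_imp_bounded compact_continuous_image K continuous_on_subset[OF contD]) auto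
  then obtain B where B: "B > 0" "\<And>x. x \<in> ?K \<Longrightarrow> \<bar>D x\<bar> \<le> B"
    by (auto simp: bounded_pos)
  then have B': "\<bar>D x\<bar> \<le> B" for x
    using D0[of x] by (cases "x \<in> ?K") auto
  obtain R where R: "R > 0" "\<And>x. x \<in> ?K \<Longrightarrow> norm x \<le> R"
    using compact_imp_bounded[OF K] by (auto simp: bounded_pos)
  define h where "h n = inverse (real (Suc n))" for n
  have h: "0 < h n" "h n \<le> 1" for n by (auto simp: h_def field_simps)
  define q where "q n x = (F (h n *\<^sub>R j + x) - F x) / h n" for n x
  have hd: "((\<lambda>s. F (x + s *\<^sub>R j)) has_real_derivative D (x + s *\<^sub>R j)) (at s)" for x s
  proof -
    have FD: "(F has_derivative frechet_derivative F (at (x + s *\<^sub>R j))) (at (x + s *\<^sub>R j))"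
      by (rule times_cont_diff_SucD(1)[OF F1])
    have "((\<lambda>s. F (x + s *\<^sub>R j)) has_derivative (\<lambda>t. frechet_derivative F (at (x + s *\<^sub>R j)) (t *\<^sub>R j))) (at s)"
      by (rule has_derivative_compose[of "\<lambda>s. x + s *\<^sub>R j" _ s UNIV F, OF _ FD])
        (auto intro!: derivative_eq_intros)
    moreover have "frechet_derivative F (at (x + s *\<^sub>R j)) (t *\<^sub>R j) = t * D (x + s *\<^sub>R j)" for t
      using has_derivative_linear[OF FD] by (simp add: D_def linear_scale)
    moreover have "(\<lambda>t. t * D (x + s *\<^sub>R j)) = (*) (D (x + s *\<^sub>R j))"
      by (simp add: fun_eq_iff mult.commute)
    ultimately show ?thesis
      by (simp add: has_field_derivative_def)
  qed
  \<comment> \<open>By the mean value theorem the quotient is a value of \<open>D\<close> at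
    distance at most \<open>norm j\<close> from \<open>x\<close>. So it is bounded by
    \<open>B\<close> and vanishes outside a fixed ball, which gives an integrable majorant
    independent of \<open>n\<close>.\<close>
  have qB: "\<bar>q n x\<bar> \<le> B * indicator (cball 0 (R + norm j)) x" for n x
  proof -
    obtain z where z: "0 < z" "z < h n" "F (x + h n *\<^sub>R j) - F (x + 0 *\<^sub>R j) = (h n - 0) * D (x + z *\<^sub>R j)"
      using MVT2[OF h(1)[of n] hd[of x]] by blast
    then have q: "q n x = D (x + z *\<^sub>R j)"
      using h(1)[of n] by (simp add: q_def add.commute)
    show ?thesis
    proof (cases "x + z *\<^sub>R j \<in> ?K")
      case True
      have "norm x \<le> norm (x + z *\<^sub>R j) + norm (z *\<^sub>R j)"
        by (metis add_diff_cancel_right' norm_triangle_ineq4)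
      also have "norm (z *\<^sub>R j) \<le> 1 * norm j"
        using z(1,2) h(2)[of n] unfolding norm_scaleR by (intro mult_right_mono) auto
      finally have "norm x \<le> R + norm j" using R(2)[OF True] by simp
      then show ?thesis using q B' by simp
    next
      case False
      then show ?thesis using q D0 B(1) by (simp add: indicator_def)
    qed
  qed
  have q0: "(LINT x|lborel. q n x) = 0" for n
    unfolding q_def using integral_lborel_translate[of F "h n *\<^sub>R j"] intF by simp
  have "(\<lambda>n. LINT x|lborel. q n x) \<longlonglongrightarrow> (LINT x|lborel. D x)"
  proof (rule integral_dominated_convergence)
    show "integrable lborel (\<lambda>x. B * indicator (cball 0 (R + norm j)) x)"
      by (intro integrable_mult_right integrable_real_indicator) (use emeasure_bounded_finite[OF bounded_cball] in auto)
    show "AE x in lborel. norm (q n x) \<le> B * indicator (cball 0 (R + norm j)) x" for n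
      using qB by simp
    show "AE x in lborel. (\<lambda>n. q n x) \<longlonglongrightarrow> D x"
    proof (rule AE_I2)
      fix x
      have "((\<lambda>s. (F (x + s *\<^sub>R j) - F x) / s) \<longlongrightarrow> D x) (at 0)"
        using hd[of x 0] by (simp add: DERIV_def)
      moreover have "filterlim h (at 0) sequentially"
        unfolding filterlim_at h_def using LIMSEQ_inverse_real_of_nat by auto
      ultimately have "(\<lambda>n. (F (x + h n *\<^sub>R j) - F x) / h n) \<longlonglongrightarrow> D x"
        by (rule filterlim_compose)
      then show "(\<lambda>n. q n x) \<longlonglongrightarrow> D x"
        by (simp add: q_def add.commute)
    qed
  qed (auto simp: q_def)
  then show "(LINT x|lborel. frechet_derivative F (at x) j) = 0"
    using q0 by (simp add: LIMSEQ_const_iff D_def[abs_def])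
qed

section \<open>Weak derivatives on an interval\<close>

lemma real_test_fun_bounds:
  fixes \<phi> :: "real \<Rightarrow> real"
  assumes "\<phi> \<in> test_funs {0<..<T}" "0 < T"
  obtains a b where "0 < a" "a \<le> b" "b < T" "\<And>t. t \<notin> {a..b} \<Longrightarrow> \<phi> t = 0"
proof -
  let ?K = "closure {x. \<phi> x \<noteq> 0}"
  have K: "compact ?K" "?K \<subseteq> {0<..<T}" using assms by (auto simp: test_funs_def)
  have 0: "\<phi> t = 0" if "t \<notin> ?K" for t using that closure_subset[of "{x. \<phi> x \<noteq> 0}"] by auto
  show thesis
  proof (cases "?K = {}")
    case True
    \<comment> \<open>The zero function has no support from which to read off bounds; any point of
      the interval serves.\<close>
    show ?thesis
    proof (rule that[of "T/2" "T/2"])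
      show "\<phi> t = 0" for t using 0[of t] True by blast
    qed (use assms(2) in auto)
  next
    case False
    obtain a where a: "a \<in> ?K" "\<And>t. t \<in> ?K \<Longrightarrow> a \<le> t" using compact_attains_inf[OF K(1) False] by auto
    obtain b where b: "b \<in> ?K" "\<And>t. t \<in> ?K \<Longrightarrow> t \<le> b" using compact_attains_sup[OF K(1) False] by auto
    show ?thesis
    proof (rule that)
      show "0 < a" "b < T" "a \<le> b" using a b K(2) by auto
      show "\<phi> t = 0" if "t \<notin> {a..b}" for t
        using that a(2) b(2) by (intro 0) force
    qed
  qed
qed

lemma real_test_funI:
  fixes \<phi> :: "real \<Rightarrow> real"
  assumes "\<And>k. times_cont_diff k \<phi>" "0 < a" "b < T" "\<And>t. t \<notin> {a..b} \<Longrightarrow> \<phi> t = 0"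
  shows "\<phi> \<in> test_funs {0<..<T}"
proof -
  have sub: "closure {x. \<phi> x \<noteq> 0} \<subseteq> {a..b}"
    by (rule closure_minimal) (use assms(4) in blast, simp)
  then have "compact (closure {x. \<phi> x \<noteq> 0})"
    by (meson bounded_closed_interval bounded_subset closed_closure compact_eq_bounded_closed)
  then show ?thesis using assms(1-3) sub by (auto simp: test_funs_def dest!: subsetD[OF sub])
qed

lemma test_fun_deriv:
  fixes \<phi> :: "real \<Rightarrow> real"
  assumes "\<phi> \<in> test_funs U"
  shows "(\<phi> has_real_derivative deriv \<phi> t) (at t)" "continuous_on UNIV (deriv \<phi>)" "continuous_on UNIV \<phi>"
proof -
  have s: "times_cont_diff k \<phi>" for k using assms by (simp add: test_funs_def)
  have "(\<phi> has_derivative frechet_derivative \<phi> (at t)) (at t)" for t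
    by (rule times_cont_diff_SucD(1)[OF s[of "Suc 0"]])
  then have *: "(\<phi> has_real_derivative frechet_derivative \<phi> (at t) 1) (at t)" for t
    by (metis has_derivative_imp_has_field_derivative has_derivative_linear linear_scale_real mult.commute mult.right_neutral)
  then have d: "deriv \<phi> t = frechet_derivative \<phi> (at t) 1" for t
    by (rule DERIV_imp_deriv)
  show "(\<phi> has_real_derivative deriv \<phi> t) (at t)" using * d by simp
  show "continuous_on UNIV (deriv \<phi>)"
    using times_cont_diff_SucD(2)[OF s[of "Suc 0"], of 1] by (simp add: d[abs_def])
  show "continuous_on UNIV \<phi>" using s[of 0] by simp
qed


text \<open>Fubini on the triangle r < t: integrating in r first gives the indefinite integral of
  \<open>g\<close>, integrating in t first gives \<open>- (\<phi> r * g r)\<close>, because \<phi>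
  vanishes at \<open>T\<close>. Thus the indefinite integral of a merely integrable \<open>g\<close>
  has the weak derivative \<open>g\<close>.\<close>

lemma integral_indefinite_by_parts:
  fixes g \<phi> :: "real \<Rightarrow> real"
  assumes T: "0 < T" and g: "integrable (lebesgue_on {0<..<T}) g" and \<phi>: "\<phi> \<in> test_funs {0<..<T}"
  shows "integrable (lebesgue_on {0<..<T}) (\<lambda>t. deriv \<phi> t * integral {0..t} g)"
    and "(LINT t|lebesgue_on {0<..<T}. deriv \<phi> t * integral {0..t} g) = - (LINT t|lebesgue_on {0<..<T}. \<phi> t * g t)"
proof -
  let ?M = "lebesgue_on {0<..<T}"
  have I: "{0<..<T} \<in> lmeasurable" by (metis box_real(1) lmeasurable_box)
  have Is: "{0<..<T} \<in> sets lebesgue" by simp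
  interpret M: finite_measure ?M by (rule finite_measure_lebesgue_on[OF I])
  interpret pair_sigma_finite ?M ?M ..
  have [measurable]: "g \<in> borel_measurable ?M" using g by simp
  have contm[measurable]: "h \<in> borel_measurable ?M" if "continuous_on UNIV h" for h :: "real \<Rightarrow> real"
    by (rule continuous_imp_measurable_on_sets_lebesgue[OF continuous_on_subset[OF that]]) auto
  have idm[measurable]: "(\<lambda>t. t) \<in> borel_measurable ?M" by (rule contm) simp
  have dm[measurable]: "deriv \<phi> \<in> borel_measurable ?M" by (rule contm[OF test_fun_deriv(2)[OF \<phi>]])
  obtain a b where ab: "0 < a" "a \<le> b" "b < T" "\<And>t. t \<notin> {a..b} \<Longrightarrow> \<phi> t = 0"
    using real_test_fun_bounds[OF \<phi> T] by metis
  have "bounded (deriv \<phi> ` {0..T})"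
    by (intro compact_imp_bounded compact_continuous_image continuous_on_subset[OF test_fun_deriv(2)[OF \<phi>]]) auto
  then obtain B where B: "B > 0" "\<And>t. t \<in> {0..T} \<Longrightarrow> \<bar>deriv \<phi> t\<bar> \<le> B"
    by (auto simp: bounded_pos)
  define f where "f t r = deriv \<phi> t * (if r < t then g r else 0)" for t r
  have fm[measurable]: "case_prod f \<in> borel_measurable (?M \<Otimes>\<^sub>M ?M)"
    unfolding f_def by measurable
  have "integrable (?M \<Otimes>\<^sub>M ?M) (\<lambda>(t, r). B * \<bar>g r\<bar>)"
    by (rule Fubini_integrable) (use g in auto)
  then have int: "integrable (?M \<Otimes>\<^sub>M ?M) (case_prod f)"
  proof (rule Bochner_Integration.integrable_bound)
    show "AE x in ?M \<Otimes>\<^sub>M ?M. norm (case_prod f x) \<le> norm (case x of (t, r) \<Rightarrow> B * \<bar>g r\<bar>)"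
    proof (rule AE_I2)
      fix x assume "x \<in> space (?M \<Otimes>\<^sub>M ?M)"
      then obtain t r where x: "x = (t, r)" "t \<in> {0<..<T}" by (auto simp: space_pair_measure)
      have "\<bar>deriv \<phi> t\<bar> * \<bar>if r < t then g r else 0\<bar> \<le> B * \<bar>g r\<bar>"
        using B x by (intro mult_mono) auto
      then show "norm (case_prod f x) \<le> norm (case x of (t, r) \<Rightarrow> B * \<bar>g r\<bar>)"
        using x B by (simp add: f_def abs_mult)
    qed
  qed fact
  have inner1: "(LINT r|?M. f t r) = deriv \<phi> t * integral {0..t} g" if "t \<in> {0<..<T}" for t
  proof -
    have "(LINT r|?M. (if r \<in> {0<..<t} then g r else 0)) = (LINT r|lebesgue_on {0<..<t}. g r)"
      by (rule integral_restrict) (use that in auto)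
    also have "\<dots> = integral {0<..<t} g"
    proof (rule lebesgue_integral_eq_integral)
      show "integrable (lebesgue_on {0<..<t}) g"
        by (rule integrable_lebesgue_on_subset[OF g]) (use that in auto)
    qed auto
    also have "\<dots> = integral {0..t} g" by (rule integral_open_interval_real[symmetric])
    finally have "(LINT r|?M. (if r \<in> {0<..<t} then g r else 0)) = integral {0..t} g" .
    moreover have "(LINT r|?M. f t r) = (LINT r|?M. deriv \<phi> t * (if r \<in> {0<..<t} then g r else 0))"
      by (rule Bochner_Integration.integral_cong) (auto simp: f_def)
    ultimately show ?thesis by simp
  qed
  have inner2: "(LINT t|?M. f t r) = - (\<phi> r * g r)" if "r \<in> {0<..<T}" for r
  proof -
    have ftc: "(deriv \<phi> has_integral (\<phi> T - \<phi> r)) {r..T}"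
      by (rule fundamental_theorem_of_calculus)
        (use that test_fun_deriv(1)[OF \<phi>] in \<open>auto simp: has_real_derivative_iff_has_vector_derivative[symmetric] intro: has_field_derivative_at_within\<close>)
    have "(LINT t|?M. (if t \<in> {r<..<T} then deriv \<phi> t else 0)) = (LINT t|lebesgue_on {r<..<T}. deriv \<phi> t)"
      by (rule integral_restrict) (use that in auto)
    also have "\<dots> = integral {r<..<T} (deriv \<phi>)"
    proof (rule lebesgue_integral_eq_integral)
      have "integrable (lebesgue_on {r..T}) (deriv \<phi>)"
        by (intro continuous_imp_integrable_real continuous_on_subset[OF test_fun_deriv(2)[OF \<phi>]]) auto
      then show "integrable (lebesgue_on {r<..<T}) (deriv \<phi>)"
        by (rule integrable_lebesgue_on_subset) auto
    qed auto
    also have "\<dots> = integral {r..T} (deriv \<phi>)" by (rule integral_open_interval_real[symmetric])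
    also have "\<dots> = - \<phi> r" using ftc ab by (simp add: integral_unique)
    finally have "(LINT t|?M. (if t \<in> {r<..<T} then deriv \<phi> t else 0)) = - \<phi> r" .
    moreover have "(LINT t|?M. f t r) = (LINT t|?M. (if t \<in> {r<..<T} then deriv \<phi> t else 0) * g r)"
      by (rule Bochner_Integration.integral_cong) (auto simp: f_def)
    ultimately show ?thesis by simp
  qed
  have "integrable ?M (\<lambda>t. LINT r|?M. f t r)"
    using integrable_fst[OF int] .
  then show "integrable ?M (\<lambda>t. deriv \<phi> t * integral {0..t} g)"
    by (rule Bochner_Integration.integrable_cong[THEN iffD1, rotated -1]) (auto simp: inner1)
  have "(LINT t|?M. deriv \<phi> t * integral {0..t} g) = (LINT t|?M. LINT r|?M. f t r)"
    by (rule Bochner_Integration.integral_cong) (auto simp: inner1)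
  also have "\<dots> = (LINT r|?M. LINT t|?M. f t r)"
    using Fubini_integral[OF int] by simp
  also have "\<dots> = (LINT r|?M. - (\<phi> r * g r))"
    by (rule Bochner_Integration.integral_cong) (auto simp: inner2)
  finally show "(LINT t|?M. deriv \<phi> t * integral {0..t} g) = - (LINT t|?M. \<phi> t * g t)"
    by simp
qed

text \<open>The primitive from 0 vanishes to the left of the support of \<eta>, and to the right of
  it because \<eta> has mean 0; so it is again compactly supported in the open interval.\<close>

lemma real_test_fun_antiderivative:
  fixes \<eta> :: "real \<Rightarrow> real"
  assumes \<eta>: "\<eta> \<in> test_funs {0<..<T}" and T: "0 < T" and 0: "integral {0..T} \<eta> = 0"
  obtains \<phi> where "\<phi> \<in> test_funs {0<..<T}" "deriv \<phi> = \<eta>"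
proof -
  obtain a b where ab: "0 < a" "a \<le> b" "b < T" "\<And>t. t \<notin> {a..b} \<Longrightarrow> \<eta> t = 0"
    using real_test_fun_bounds[OF \<eta> T] by metis
  have c: "continuous_on UNIV \<eta>" by (rule test_fun_deriv(3)[OF \<eta>])
  have i: "\<eta> integrable_on {s..t}" for s t
    by (intro integrable_continuous_interval continuous_on_subset[OF c]) auto
  define \<phi> where "\<phi> t = integral {0..t} \<eta>" for t
  have zero: "\<phi> t = 0" if "t < a" for t
    unfolding \<phi>_def by (rule integral_eq_0_on) (use ab that in auto)
  have zero': "\<phi> t = 0" if "t > b" for t
  proof -
    \<comment> \<open>Integrating up to \<open>max t T\<close> treats t < T and t > T at once: the
      interval is split at \<open>T\<close> and then at \<open>t\<close>, and \<eta> vanishes beyond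
      either point.\<close>
    have "integral {0..max t T} \<eta> = integral {0..T} \<eta> + integral {T..max t T} \<eta>"
      by (rule Henstock_Kurzweil_Integration.integral_combine[symmetric]) (use T i in auto)
    also have "integral {T..max t T} \<eta> = 0" by (rule integral_eq_0_on) (use ab in auto)
    finally have 1: "integral {0..max t T} \<eta> = 0" using 0 by simp
    have "integral {0..max t T} \<eta> = integral {0..t} \<eta> + integral {t..max t T} \<eta>"
      by (rule Henstock_Kurzweil_Integration.integral_combine[symmetric]) (use T i ab that in auto)
    also have "integral {t..max t T} \<eta> = 0" by (rule integral_eq_0_on) (use ab that in auto)
    finally show ?thesis using 1 by (simp add: \<phi>_def)
  qed
  have d: "(\<phi> has_real_derivative \<eta> t) (at t)" for t
  proof (cases "t < a")
    case True
    have "((\<lambda>_. 0) has_real_derivative \<eta> t) (at t)" using True ab(4) by simp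
    then show ?thesis
      by (rule has_field_derivative_transform_within_open[where S = "{..<a}"]) (use True zero in auto)
  next
    case False
    \<comment> \<open>Here \<open>a \<le> t\<close>, so t > 0 is an interior point of
      \<open>{0..t+1}\<close> and the derivative within that interval is two-sided.\<close>
    have "(\<phi> has_vector_derivative \<eta> t) (at t within {0..t+1})"
      unfolding \<phi>_def using False ab
      by (intro integral_has_vector_derivative continuous_on_subset[OF c]) auto
    moreover have "at t within {0..t+1} = at t"
      using False ab by (intro at_within_interior) auto
    ultimately show ?thesis by (simp add: has_real_derivative_iff_has_vector_derivative)
  qed
  have s\<eta>: "times_cont_diff k \<eta>" for k using \<eta> by (simp add: test_funs_def)
  have s: "times_cont_diff (Suc k) \<phi>" for k
    by (rule times_cont_diff_SucI[OF d[unfolded has_field_derivative_def]])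
      (intro times_cont_diff_mult times_cont_diff_const s\<eta>)
  show thesis
  proof
    show "\<phi> \<in> test_funs {0<..<T}"
    proof (rule real_test_funI[of _ a b])
      show "times_cont_diff k \<phi>" for k by (rule times_cont_diff_Suc_le[OF s])
      show "\<phi> t = 0" if "t \<notin> {a..b}" for t using that zero[of t] zero'[of t] by force
    qed (use ab in auto)
    show "deriv \<phi> = \<eta>" using DERIV_imp_deriv[OF d] by auto
  qed
qed

lemma test_fun_product_integrable:
  fixes f \<phi> :: "real \<Rightarrow> real"
  assumes f: "integrable (lebesgue_on {0<..<T}) f" and c: "continuous_on UNIV \<phi>"
  shows "integrable (lebesgue_on {0<..<T}) (\<lambda>t. \<phi> t * f t)"
proof -
  have "bounded (\<phi> ` {0..T})"
    by (intro compact_imp_bounded compact_continuous_image continuous_on_subset[OF c]) auto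
  then obtain B where B: "B > 0" "\<And>t. t \<in> {0..T} \<Longrightarrow> \<bar>\<phi> t\<bar> \<le> B"
    by (auto simp: bounded_pos)
  have [measurable]: "\<phi> \<in> borel_measurable (lebesgue_on {0<..<T})"
    by (rule continuous_imp_measurable_on_sets_lebesgue[OF continuous_on_subset[OF c]]) auto
  have [measurable]: "f \<in> borel_measurable (lebesgue_on {0<..<T})" using f by simp
  show ?thesis
  proof (rule Bochner_Integration.integrable_bound)
    show "integrable (lebesgue_on {0<..<T}) (\<lambda>t. B * f t)" using f by simp
    show "AE t in lebesgue_on {0<..<T}. norm (\<phi> t * f t) \<le> norm (B * f t)"
      using B by (intro AE_I2) (auto simp: abs_mult intro!: mult_right_mono)
  qed measurable
qed

text \<open>Du Bois-Reymond's lemma. Subtracting the indefinite integral of \<open>g\<close> leaves a function \<open>k\<close> with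
  weak derivative \<open>0\<close>; a test function minus the right multiple of a fixed bump \<open>\<rho>\<close> is the derivative of
  a test function, so \<open>k\<close> is constant.\<close>

lemma weak_deriv_imp_AE_indefinite_integral:
  fixes f g :: "real \<Rightarrow> real"
  assumes T: "0 < T" and f: "integrable (lebesgue_on {0<..<T}) f" and g: "integrable (lebesgue_on {0<..<T}) g"
    and weak: "\<And>\<phi>. \<phi> \<in> test_funs {0<..<T} \<Longrightarrow>
      (LINT t|lebesgue_on {0<..<T}. deriv \<phi> t * f t) = - (LINT t|lebesgue_on {0<..<T}. \<phi> t * g t)"
  obtains c where "AE t in lebesgue_on {0<..<T}. f t = c + integral {0..t} g"
proof -
  let ?M = "lebesgue_on {0<..<T}"
  interpret M: finite_measure ?M
    by (rule finite_measure_lebesgue_on) (metis box_real(1) lmeasurable_box)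
  have "g integrable_on {0<..<T}" by (rule integrable_on_lebesgue_on[OF g]) auto
  then have gi: "g integrable_on {0..T}" by (simp add: integrable_on_open_interval_real)
  have "continuous_on {0..T} (\<lambda>t. integral {0..t} g)"
    by (rule indefinite_integral_continuous_1[OF gi])
  then have "integrable (lebesgue_on {0..T}) (\<lambda>t. integral {0..t} g)"
    by (rule continuous_imp_integrable_real)
  then have Gi: "integrable ?M (\<lambda>t. integral {0..t} g)"
    by (rule integrable_lebesgue_on_subset) auto
  define k where "k t = f t - integral {0..t} g" for t
  have k: "integrable ?M k" using f Gi by (simp add: k_def[abs_def])
  have k0: "(LINT t|?M. deriv \<phi> t * k t) = 0" if \<phi>: "\<phi> \<in> test_funs {0<..<T}" for \<phi>
  proof -
    have "(LINT t|?M. deriv \<phi> t * k t) = (LINT t|?M. deriv \<phi> t * f t - deriv \<phi> t * integral {0..t} g)"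
      by (simp add: k_def right_diff_distrib)
    also have "\<dots> = (LINT t|?M. deriv \<phi> t * f t) - (LINT t|?M. deriv \<phi> t * integral {0..t} g)"
      by (intro Bochner_Integration.integral_diff integral_indefinite_by_parts(1) T g \<phi>
          test_fun_product_integrable f test_fun_deriv(2)[OF \<phi>])
    finally show ?thesis using weak[OF \<phi>] integral_indefinite_by_parts(2)[OF T g \<phi>] by simp
  qed
  have LI: "integral {0..T} \<psi> = (LINT t|?M. \<psi> t)" "integrable ?M \<psi>" "\<psi> integrable_on {0..T}"
    if "continuous_on UNIV \<psi>" for \<psi> :: "real \<Rightarrow> real"
  proof -
    have "integrable (lebesgue_on {0..T}) \<psi>"
      by (intro continuous_imp_integrable_real continuous_on_subset[OF that]) auto
    then show "integrable ?M \<psi>" by (rule integrable_lebesgue_on_subset) auto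
    from lebesgue_integral_eq_integral[OF this] show "integral {0..T} \<psi> = (LINT t|?M. \<psi> t)"
      by (simp add: integral_open_interval_real)
    show "\<psi> integrable_on {0..T}"
      by (intro integrable_continuous_interval continuous_on_subset[OF that]) auto
  qed
  \<comment> \<open>A bump on the middle third, so that its support stays inside the open interval;
    divided by its integral \<open>m\<close> it becomes \<rho>.\<close>
  define \<rho>0 where "\<rho>0 = box_bump 0 (T/3) (2*T/3)"
  have \<rho>0: "\<rho>0 \<in> test_funs {0<..<T}"
    unfolding \<rho>0_def using T by (intro box_bump_test_fun) auto
  have c\<rho>0: "continuous_on UNIV \<rho>0" by (rule test_fun_deriv(3)[OF \<rho>0])
  define m where "m = integral {0..T} \<rho>0"
  have "m \<noteq> 0"
  proof
    assume "m = 0"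
    then have "\<rho>0 (T/2) = 0"
      using T unfolding m_def
      by (subst (asm) integral_eq_0_iff)
        (auto simp: \<rho>0_def box_bump_bounds intro: continuous_on_subset[OF c\<rho>0[unfolded \<rho>0_def]])
    then show False using T by (auto simp: \<rho>0_def box_bump_eq_0_iff)
  qed
  define \<rho> where "\<rho> t = \<rho>0 t / m" for t
  have c\<rho>: "continuous_on UNIV \<rho>" unfolding \<rho>_def[abs_def] by (intro continuous_intros c\<rho>0) (use \<open>m \<noteq> 0\<close> in simp)
  have \<rho>1: "integral {0..T} \<rho> = 1"
    unfolding \<rho>_def[abs_def] using \<open>m \<noteq> 0\<close> by (simp add: m_def)
  define c where "c = (LINT t|?M. \<rho> t * k t)"
  have kc: "AE t in ?M. k t - c = 0"
  proof (rule test_funs_integral_zero_imp_AE_zero)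
    show "integrable ?M (\<lambda>t. k t - c)" using k by simp
    fix \<psi> :: "real \<Rightarrow> real" assume \<psi>: "\<psi> \<in> test_funs {0<..<T}"
    have c\<psi>: "continuous_on UNIV \<psi>" by (rule test_fun_deriv(3)[OF \<psi>])
    define n where "n = integral {0..T} \<psi>"
    \<comment> \<open>This is \<psi> minus \<open>n\<close> times \<rho>, which has mean 0; it is
      written with \<open>\<rho>0\<close>, which is already known to be a test function.\<close>
    define \<eta> where "\<eta> t = \<psi> t + (- n / m) * \<rho>0 t" for t
    obtain a b where ab: "0 < a" "a \<le> b" "b < T" "\<And>t. t \<notin> {a..b} \<Longrightarrow> \<psi> t = 0"
      using real_test_fun_bounds[OF \<psi> T] by metis
    obtain a' b' where ab': "0 < a'" "a' \<le> b'" "b' < T" "\<And>t. t \<notin> {a'..b'} \<Longrightarrow> \<rho>0 t = 0"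
      using real_test_fun_bounds[OF \<rho>0 T] by metis
    have \<eta>: "\<eta> \<in> test_funs {0<..<T}"
    proof (rule real_test_funI[of _ "min a a'" "max b b'"])
      show "times_cont_diff k \<eta>" for k
        unfolding \<eta>_def[abs_def] using \<psi> \<rho>0
        by (intro times_cont_diff_add times_cont_diff_mult times_cont_diff_const) (auto simp: test_funs_def)
      show "\<eta> t = 0" if "t \<notin> {min a a'..max b b'}" for t
      proof -
        have "t \<notin> {a..b}" "t \<notin> {a'..b'}" using that by auto
        then show ?thesis using ab(4) ab'(4) by (simp add: \<eta>_def)
      qed
    qed (use ab ab' in auto)
    have \<eta>\<rho>: "\<eta> t = \<psi> t - n * \<rho> t" for t by (simp add: \<eta>_def \<rho>_def)
    have "integral {0..T} \<eta> = n - n * integral {0..T} \<rho>"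
      unfolding \<eta>\<rho>[abs_def] n_def
      by (subst Henstock_Kurzweil_Integration.integral_diff)
        (auto intro!: LI c\<psi> continuous_on_mult_left c\<rho>)
    then have "integral {0..T} \<eta> = 0" using \<rho>1 by simp
    then obtain \<phi> where \<phi>: "\<phi> \<in> test_funs {0<..<T}" "deriv \<phi> = \<eta>"
      using real_test_fun_antiderivative[OF \<eta> T] by blast
    have ki: "integrable ?M (\<lambda>t. \<psi> t * k t)" "integrable ?M (\<lambda>t. \<rho> t * k t)"
      by (intro test_fun_product_integrable k c\<psi> c\<rho>)+
    have "0 = (LINT t|?M. \<psi> t * k t - n * (\<rho> t * k t))"
      using k0[OF \<phi>(1)] by (simp add: \<phi>(2) \<eta>\<rho> left_diff_distrib mult.assoc)
    also have "\<dots> = (LINT t|?M. \<psi> t * k t) - n * c"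
      using ki by (simp add: c_def)
    also have "n = (LINT t|?M. \<psi> t)" unfolding n_def by (rule LI[OF c\<psi>])
    also have "(LINT t|?M. \<psi> t * k t) - (LINT t|?M. \<psi> t) * c = (LINT t|?M. \<psi> t * k t - \<psi> t * c)"
      using ki LI(2)[OF c\<psi>] by simp
    finally show "(LINT t|?M. (k t - c) * \<psi> t) = 0" by (simp add: algebra_simps)
  qed (use k in auto)
  show thesis
    by (rule that[of c]) (use kc in \<open>eventually_elim, auto simp: k_def\<close>)
qed

subsection \<open>The space \<open>L\<^sup>2\<close>\<close>

text \<open>Completeness of Lebesgue measure. Objects picked by \<open>SOME\<close> are known only
  up to null sets, so measurability has to pass along equality almost everywhere.\<close>

lemma AE_eq_borel_measurable_lebesgue_on:
  fixes f g :: "'a::euclidean_space \<Rightarrow> 'b::euclidean_space"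
  assumes S: "S \<in> sets lebesgue" and f: "f \<in> borel_measurable (lebesgue_on S)"
    and ae: "AE x in lebesgue_on S. f x = g x"
  shows "g \<in> borel_measurable (lebesgue_on S)"
proof -
  obtain N where N: "N \<in> null_sets (lebesgue_on S)" "{x\<in>S. f x \<noteq> g x} \<subseteq> N"
    using ae by (auto elim!: AE_E simp: null_sets_def)
  have "f \<in> borel_measurable (lebesgue_on (S - N))"
    by (rule borel_measurable_diff_null[OF N(1) S, THEN iffD2, OF f])
  then have "g \<in> borel_measurable (lebesgue_on (S - N))"
    by (rule measurable_cong[THEN iffD1, rotated]) (use N in auto)
  then show ?thesis
    by (rule borel_measurable_diff_null[OF N(1) S, THEN iffD1])
qed

lemma L2_measurable: "v \<in> L2 \<Omega> \<Longrightarrow> v \<in> borel_measurable (lebesgue_on \<Omega>)"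
  by (simp add: L2_def)

lemma L2_integrable_norm_sq: "v \<in> L2 \<Omega> \<Longrightarrow> integrable (lebesgue_on \<Omega>) (\<lambda>x. (norm (v x))\<^sup>2)"
  by (simp add: L2_def)

lemma L2I_bound:
  assumes "v \<in> borel_measurable (lebesgue_on \<Omega>)" "integrable (lebesgue_on \<Omega>) h"
    "AE x in lebesgue_on \<Omega>. (norm (v x))\<^sup>2 \<le> h x"
  shows "v \<in> L2 \<Omega>"
proof -
  have "integrable (lebesgue_on \<Omega>) (\<lambda>x. (norm (v x))\<^sup>2)"
    by (rule Bochner_Integration.integrable_bound[OF assms(2)]) (use assms(1,3) in auto)
  then show ?thesis using assms(1) by (simp add: L2_def)
qed

lemma L2_zero: "(\<lambda>x. 0) \<in> L2 \<Omega>"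
  by (simp add: L2_def)

lemma norm_add_sq_le: "(norm (a + b))\<^sup>2 \<le> 2 * (norm a)\<^sup>2 + 2 * (norm b)\<^sup>2"
proof -
  have "(norm (a + b))\<^sup>2 \<le> (norm a + norm b)\<^sup>2"
    by (intro power_mono norm_triangle_ineq) auto
  also have "\<dots> \<le> 2 * (norm a)\<^sup>2 + 2 * (norm b)\<^sup>2"
    using sum_squares_bound[of "norm a" "norm b"] by (simp add: power2_sum)
  finally show ?thesis .
qed

lemma L2_add:
  assumes "v \<in> L2 \<Omega>" "w \<in> L2 \<Omega>"
  shows "(\<lambda>x. v x + w x) \<in> L2 \<Omega>"
proof (rule L2I_bound)
  show "integrable (lebesgue_on \<Omega>) (\<lambda>x. 2 * (norm (v x))\<^sup>2 + 2 * (norm (w x))\<^sup>2)"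
    using assms by (intro Bochner_Integration.integrable_add integrable_mult_right L2_integrable_norm_sq)
qed (use assms[THEN L2_measurable] in \<open>auto intro!: borel_measurable_add norm_add_sq_le\<close>)

lemma L2_linear:
  fixes L :: "'b::euclidean_space \<Rightarrow> 'c::euclidean_space"
  assumes v: "v \<in> L2 \<Omega>" and L: "linear L"
  shows "(\<lambda>x. L (v x)) \<in> L2 \<Omega>"
proof -
  obtain K where K: "\<And>x. norm (L x) \<le> norm x * K"
    using bounded_linear.bounded[OF linear_conv_bounded_linear[THEN iffD1, OF L]] by blast
  have [measurable]: "L \<in> borel_measurable borel"
    using L by (intro borel_measurable_continuous_onI linear_continuous_on) (simp add: linear_conv_bounded_linear)
  note [measurable] = L2_measurable[OF v]
  show ?thesis
  proof (rule L2I_bound)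
    show "(\<lambda>x. L (v x)) \<in> borel_measurable (lebesgue_on \<Omega>)" by measurable
    show "integrable (lebesgue_on \<Omega>) (\<lambda>x. K\<^sup>2 * (norm (v x))\<^sup>2)"
      using L2_integrable_norm_sq[OF v] by simp
    show "AE x in lebesgue_on \<Omega>. (norm (L (v x)))\<^sup>2 \<le> K\<^sup>2 * (norm (v x))\<^sup>2"
    proof (rule AE_I2)
      fix x
      have "(norm (L (v x)))\<^sup>2 \<le> (norm (v x) * K)\<^sup>2" by (intro power_mono K) auto
      then show "(norm (L (v x)))\<^sup>2 \<le> K\<^sup>2 * (norm (v x))\<^sup>2" by (simp add: power_mult_distrib mult.commute)
    qed
  qed
qed

lemma L2_scaleR: "v \<in> L2 \<Omega> \<Longrightarrow> (\<lambda>x. c *\<^sub>R v x) \<in> L2 \<Omega>"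
  by (rule L2_linear[where L = "\<lambda>a. c *\<^sub>R a"]) (auto intro!: linearI simp: algebra_simps)

lemma L2_diff: "v \<in> L2 \<Omega> \<Longrightarrow> w \<in> L2 \<Omega> \<Longrightarrow> (\<lambda>x. v x - w x) \<in> L2 \<Omega>"
  using L2_add[of v \<Omega> "\<lambda>x. (-1) *\<^sub>R w x"] L2_scaleR[of w \<Omega> "-1"] by simp

lemma L2_inner_integrable:
  assumes "v \<in> L2 \<Omega>" "w \<in> L2 \<Omega>"
  shows "integrable (lebesgue_on \<Omega>) (\<lambda>x. v x \<bullet> w x)"
proof (rule Bochner_Integration.integrable_bound)
  show "integrable (lebesgue_on \<Omega>) (\<lambda>x. (norm (v x))\<^sup>2 + (norm (w x))\<^sup>2)"
    using assms by (intro Bochner_Integration.integrable_add L2_integrable_norm_sq)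
  have "norm (v x \<bullet> w x) \<le> norm ((norm (v x))\<^sup>2 + (norm (w x))\<^sup>2)" for x
  proof -
    have "\<bar>v x \<bullet> w x\<bar> \<le> norm (v x) * norm (w x)" by (rule Cauchy_Schwarz_ineq2)
    also have "\<dots> \<le> (norm (v x))\<^sup>2 + (norm (w x))\<^sup>2"
      using sum_squares_bound[of "norm (v x)" "norm (w x)"] mult_nonneg_nonneg[OF norm_ge_zero norm_ge_zero, of "v x" "w x"]
      unfolding mult.assoc by linarith
    finally show ?thesis by simp
  qed
  then show "AE x in lebesgue_on \<Omega>. norm (v x \<bullet> w x) \<le> norm ((norm (v x))\<^sup>2 + (norm (w x))\<^sup>2)" by simp
qed (use assms[THEN L2_measurable] in \<open>auto intro!: borel_measurable_inner\<close>)

lemma L2_norm_nonneg: "0 \<le> L2_norm \<Omega> v"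
  by (simp add: L2_norm_def)

lemma L2_norm_sq: "(L2_norm \<Omega> v)\<^sup>2 = (LINT x|lebesgue_on \<Omega>. (norm (v x))\<^sup>2)"
  by (simp add: L2_norm_def)

lemma L2_inner_self: "L2_inner \<Omega> v v = (L2_norm \<Omega> v)\<^sup>2"
  by (simp add: L2_norm_sq L2_inner_def power2_norm_eq_inner)

lemma L2_inner_commute: "L2_inner \<Omega> v w = L2_inner \<Omega> w v"
  by (simp add: L2_inner_def inner_commute)

lemma L2_inner_diff_left:
  "\<lbrakk>v \<in> L2 \<Omega>; w \<in> L2 \<Omega>; u \<in> L2 \<Omega>\<rbrakk> \<Longrightarrow> L2_inner \<Omega> (\<lambda>x. v x - w x) u = L2_inner \<Omega> v u - L2_inner \<Omega> w u"
  by (simp add: L2_inner_def inner_diff_left L2_inner_integrable)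

lemma L2_inner_diff_right:
  "\<lbrakk>v \<in> L2 \<Omega>; w \<in> L2 \<Omega>; u \<in> L2 \<Omega>\<rbrakk> \<Longrightarrow> L2_inner \<Omega> u (\<lambda>x. v x - w x) = L2_inner \<Omega> u v - L2_inner \<Omega> u w"
  by (simp add: L2_inner_def inner_diff_right L2_inner_integrable)

lemma L2_norm_diff_sq:
  assumes "v \<in> L2 \<Omega>" "w \<in> L2 \<Omega>"
  shows "(L2_norm \<Omega> (\<lambda>x. v x - w x))\<^sup>2 = (L2_norm \<Omega> v)\<^sup>2 - 2 * L2_inner \<Omega> v w + (L2_norm \<Omega> w)\<^sup>2"
  using assms L2_diff[OF assms]
  by (simp add: L2_inner_self[symmetric] L2_inner_diff_left L2_inner_diff_right L2_inner_commute[of \<Omega> w v])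

lemma L2_Cauchy_Schwarz:
  assumes v: "v \<in> L2 \<Omega>" and w: "w \<in> L2 \<Omega>"
  shows "\<bar>L2_inner \<Omega> v w\<bar> \<le> L2_norm \<Omega> v * L2_norm \<Omega> w"
proof -
  define A B C where "A = (L2_norm \<Omega> v)\<^sup>2" and "B = (L2_norm \<Omega> w)\<^sup>2" and "C = L2_inner \<Omega> v w"
  have q: "0 \<le> A - 2 * t * C + t\<^sup>2 * B" for t
  proof -
    have sw: "(L2_norm \<Omega> (\<lambda>x. t *\<^sub>R w x))\<^sup>2 = t\<^sup>2 * B"
      by (simp add: L2_norm_sq B_def power_mult_distrib)
    have "L2_inner \<Omega> v (\<lambda>x. t *\<^sub>R w x) = t * C"
      by (simp add: C_def L2_inner_def)
    then have "(L2_norm \<Omega> (\<lambda>x. v x - t *\<^sub>R w x))\<^sup>2 = A - 2 * t * C + t\<^sup>2 * B"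
      using L2_norm_diff_sq[OF v L2_scaleR[OF w, of t]] sw by (simp add: A_def)
    then show ?thesis by (metis zero_le_power2)
  qed
  have "C\<^sup>2 \<le> A * B"
  proof (cases "B = 0")
    case True
    have "C = 0"
    proof (rule ccontr)
      assume "C \<noteq> 0"
      \<comment> \<open>For \<open>B = 0\<close> the quadratic is affine in \<open>t\<close>; at
        this \<open>t\<close> its value is -1.\<close>
      then show False using q[of "(A + 1) / (2 * C)"] True by simp
    qed
    then show ?thesis using True by simp
  next
    case False
    then have "B > 0" by (simp add: B_def)
    have "0 \<le> A - C\<^sup>2 / B"
      using q[of "C / B"] False by (simp add: field_simps power2_eq_square)
    then show ?thesis using \<open>B > 0\<close> by (simp add: field_simps)
  qed
  then have "\<bar>C\<bar> \<le> sqrt (A * B)"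
    by (metis real_sqrt_abs real_sqrt_le_mono)
  then show ?thesis
    by (simp add: A_def B_def C_def real_sqrt_mult L2_norm_nonneg)
qed

lemma L2_norm_minus_commute: "L2_norm \<Omega> (\<lambda>x. v x - w x) = L2_norm \<Omega> (\<lambda>x. w x - v x)"
  by (simp add: L2_norm_def norm_minus_commute)

lemma L2_norm_scaleR: "L2_norm \<Omega> (\<lambda>x. c *\<^sub>R v x) = \<bar>c\<bar> * L2_norm \<Omega> v"
  by (simp add: L2_norm_def power_mult_distrib real_sqrt_mult)

lemma L2_norm_triangle_diff:
  assumes v: "v \<in> L2 \<Omega>" and w: "w \<in> L2 \<Omega>"
  shows "L2_norm \<Omega> (\<lambda>x. v x - w x) \<le> L2_norm \<Omega> v + L2_norm \<Omega> w"
proof (rule power2_le_imp_le)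
  show "(L2_norm \<Omega> (\<lambda>x. v x - w x))\<^sup>2 \<le> (L2_norm \<Omega> v + L2_norm \<Omega> w)\<^sup>2"
    using L2_Cauchy_Schwarz[OF v w] by (simp add: L2_norm_diff_sq[OF v w] power2_sum)
qed (simp add: L2_norm_nonneg)

lemma L2_norm_triangle_add:
  assumes v: "v \<in> L2 \<Omega>" and w: "w \<in> L2 \<Omega>"
  shows "L2_norm \<Omega> (\<lambda>x. v x + w x) \<le> L2_norm \<Omega> v + L2_norm \<Omega> w"
  using L2_norm_triangle_diff[OF v L2_scaleR[OF w, of "-1"]] L2_norm_scaleR[of \<Omega> "-1" w] by simp

lemma L2_norm_triangle3:
  assumes "u \<in> L2 \<Omega>" "v \<in> L2 \<Omega>" "w \<in> L2 \<Omega>"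
  shows "L2_norm \<Omega> (\<lambda>x. u x - w x) \<le> L2_norm \<Omega> (\<lambda>x. u x - v x) + L2_norm \<Omega> (\<lambda>x. v x - w x)"
  using L2_norm_triangle_add[OF L2_diff[OF assms(1,2)] L2_diff[OF assms(2,3)]] by simp

lemma L2_AE_cong:
  assumes \<Omega>: "\<Omega> \<in> sets lebesgue" and v: "v \<in> L2 \<Omega>" and ae: "AE x in lebesgue_on \<Omega>. v x = w x"
  shows "w \<in> L2 \<Omega>"
proof -
  have "w \<in> borel_measurable (lebesgue_on \<Omega>)"
    by (rule AE_eq_borel_measurable_lebesgue_on[OF \<Omega> L2_measurable[OF v] ae])
  then show ?thesis
    by (rule L2I_bound[OF _ L2_integrable_norm_sq[OF v]]) (use ae in auto)
qed

lemma L2_norm_AE_cong: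
  assumes "v \<in> L2 \<Omega>" "w \<in> L2 \<Omega>" "AE x in lebesgue_on \<Omega>. v x = w x"
  shows "L2_norm \<Omega> v = L2_norm \<Omega> w"
  unfolding L2_norm_def
  by (intro arg_cong[where f = sqrt] integral_cong_AE) (use assms in \<open>auto dest: L2_measurable\<close>)

lemma L2_norm_eq_0_iff:
  assumes "v \<in> L2 \<Omega>"
  shows "L2_norm \<Omega> v = 0 \<longleftrightarrow> (AE x in lebesgue_on \<Omega>. v x = 0)"
  using integral_nonneg_eq_0_iff_AE[OF L2_integrable_norm_sq[OF assms]]
  by (simp add: L2_norm_def)

lemma L2_integrable:
  fixes v :: "'a::euclidean_space \<Rightarrow> real"
  assumes "\<Omega> \<in> lmeasurable" "v \<in> L2 \<Omega>"
  shows "integrable (lebesgue_on \<Omega>) v"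
proof -
  interpret finite_measure "lebesgue_on \<Omega>" by (rule finite_measure_lebesgue_on[OF assms(1)])
  have "(\<lambda>x. 1 :: real) \<in> L2 \<Omega>" by (simp add: L2_def)
  from L2_inner_integrable[OF assms(2) this] show ?thesis by simp
qed

text \<open>Riesz-Fischer for a geometrically convergent sequence of representatives. On a domain of
  finite measure the increments are summable almost everywhere, which gives a pointwise limit;
  Fatou's lemma turns it into a limit in \<open>L2 \<Omega>\<close>.\<close>

lemma L2_complete:
  fixes v :: "nat \<Rightarrow> 'a::euclidean_space \<Rightarrow> 'b::euclidean_space"
  assumes \<Omega>: "\<Omega> \<in> lmeasurable" and v: "\<And>n. v n \<in> L2 \<Omega>"
    and step: "\<And>n. L2_norm \<Omega> (\<lambda>x. v (Suc n) x - v n x) \<le> (1/2) ^ n"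
  obtains w where "w \<in> L2 \<Omega>" "(\<lambda>n. L2_norm \<Omega> (\<lambda>x. v n x - w x)) \<longlonglongrightarrow> 0"
proof -
  let ?M = "lebesgue_on \<Omega>"
  interpret finite_measure ?M by (rule finite_measure_lebesgue_on[OF \<Omega>])
  note [measurable] = L2_measurable[OF v]
  define d where "d n x = norm (v (Suc n) x - v n x)" for n x
  have d2: "(\<integral>\<^sup>+x. ennreal ((norm (f x))\<^sup>2) \<partial>?M) = ennreal ((L2_norm \<Omega> f)\<^sup>2)" if "f \<in> L2 \<Omega>" for f :: "'a \<Rightarrow> 'b"
    using L2_integrable_norm_sq[OF that] by (simp add: nn_integral_eq_integral L2_norm_sq)
  have dn: "(\<integral>\<^sup>+x. ennreal (d n x) \<partial>?M) \<le> ennreal ((1/2) ^ n * (measure ?M \<Omega> + 1))" for n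
  proof -
    have i: "integrable ?M (\<lambda>x. (d n x)\<^sup>2)"
      unfolding d_def using L2_integrable_norm_sq[OF L2_diff[OF v[of "Suc n"] v[of n]]] .
    have "(LINT x|?M. (1/2) ^ n + 2 ^ n * (d n x)\<^sup>2) = (1/2) ^ n * measure ?M \<Omega> + 2 ^ n * (L2_norm \<Omega> (\<lambda>x. v (Suc n) x - v n x))\<^sup>2"
      using i by (simp add: L2_norm_sq d_def)
    also have "\<dots> \<le> (1/2) ^ n * measure ?M \<Omega> + 2 ^ n * ((1/2) ^ n)\<^sup>2"
      using step[of n] L2_norm_nonneg by (intro add_left_mono mult_left_mono power_mono) auto
    also have "2 ^ n * ((1/2) ^ n)\<^sup>2 = (1/2::real) ^ n"
      by (simp add: power2_eq_square power_divide)
    finally have le: "(LINT x|?M. (1/2) ^ n + 2 ^ n * (d n x)\<^sup>2) \<le> (1/2) ^ n * (measure ?M \<Omega> + 1)"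
      by (simp add: algebra_simps)
    \<comment> \<open>The increments are controlled in square mean, while summability needs their
      mean. The weight 2^n makes both summands contribute at most a multiple of 2^-n, since the
      squared norm is at most 4^-n.\<close>
    have "d n x \<le> (1/2) ^ n + 2 ^ n * (d n x)\<^sup>2" for x
    proof (cases "d n x \<le> (1/2) ^ n")
      case False
      then have "1 \<le> 2 ^ n * d n x" by (simp add: power_divide field_simps)
      then have "1 * d n x \<le> (2 ^ n * d n x) * d n x" by (intro mult_right_mono) (auto simp: d_def)
      then have "d n x \<le> 2 ^ n * (d n x)\<^sup>2" by (simp add: power2_eq_square mult_ac)
      then show ?thesis by (simp add: add_increasing)
    next
      case True
      then show ?thesis by (simp add: add_increasing2)
    qed
    then have "(\<integral>\<^sup>+x. ennreal (d n x) \<partial>?M) \<le> (\<integral>\<^sup>+x. ennreal ((1/2) ^ n + 2 ^ n * (d n x)\<^sup>2) \<partial>?M)"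
      by (intro nn_integral_mono ennreal_leI)
    also have "\<dots> = ennreal (LINT x|?M. (1/2) ^ n + 2 ^ n * (d n x)\<^sup>2)"
      using i by (intro nn_integral_eq_integral) auto
    finally show ?thesis using le by (meson ennreal_leI order_trans)
  qed
  have "(\<integral>\<^sup>+x. (\<Sum>n. ennreal (d n x)) \<partial>?M) = (\<Sum>n. \<integral>\<^sup>+x. ennreal (d n x) \<partial>?M)"
    by (rule nn_integral_suminf) (simp add: d_def)
  also have "\<dots> \<le> (\<Sum>n. ennreal ((1/2) ^ n * (measure ?M \<Omega> + 1)))"
    by (intro suminf_le dn) auto
  also have "\<dots> = ennreal (\<Sum>n. (1/2) ^ n * (measure ?M \<Omega> + 1))"
    by (rule suminf_ennreal2) (auto intro!: summable_mult2 simp: summable_geometric)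
  also have "\<dots> < \<infinity>" by (metis ennreal_less_top infinity_ennreal_def)
  finally have fin: "(\<integral>\<^sup>+x. (\<Sum>n. ennreal (d n x)) \<partial>?M) < \<infinity>" .
  have "(\<lambda>x. \<Sum>n. ennreal (d n x)) \<in> borel_measurable ?M"
    unfolding d_def by measurable
  then have "AE x in ?M. (\<Sum>n. ennreal (d n x)) \<noteq> \<infinity>"
    by (rule nn_integral_PInf_AE) (use fin in simp)
  then have conv: "AE x in ?M. convergent (\<lambda>n. v n x)"
  proof eventually_elim
    case (elim x)
    have "summable (\<lambda>n. d n x)"
      using elim by (intro summable_suminf_not_top) (auto simp: d_def)
    then have "summable (\<lambda>n. v (Suc n) x - v n x)"
      unfolding d_def by (rule summable_norm_cancel)
    then have "convergent (\<lambda>n. \<Sum>i<n. v (Suc i) x - v i x)"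
      by (rule summable_iff_convergent[THEN iffD1])
    moreover have "(\<Sum>i<n. v (Suc i) x - v i x) = v n x - v 0 x" for n
      by (rule sum_lessThan_telescope)
    ultimately have "convergent (\<lambda>n. v n x - v 0 x)" by simp
    from convergent_add[OF this convergent_const[of "v 0 x"]] show ?case
      by simp
  qed
  define w where "w x = lim (\<lambda>n. v n x)" for x
  have wm[measurable]: "w \<in> borel_measurable ?M"
    unfolding w_def by (intro borel_measurable_lim_metric) measurable
  have lim: "AE x in ?M. (\<lambda>n. v n x) \<longlonglongrightarrow> w x"
    using conv by eventually_elim (simp add: w_def convergent_LIMSEQ_iff)
  \<comment> \<open>The exact geometric sum, with its subtracted last term, is what makes the
    induction on \<open>m\<close> close; afterwards that term is dropped.\<close>
  have tail: "L2_norm \<Omega> (\<lambda>x. v n x - v (n + m) x) \<le> 2 * (1/2) ^ n - 2 * (1/2) ^ (n + m)" for n m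
  proof (induction m)
    case 0
    then show ?case by (simp add: L2_norm_def)
  next
    case (Suc m)
    have "L2_norm \<Omega> (\<lambda>x. v n x - v (n + Suc m) x) \<le>
      L2_norm \<Omega> (\<lambda>x. v n x - v (n + m) x) + L2_norm \<Omega> (\<lambda>x. v (n + m) x - v (n + Suc m) x)"
      by (intro L2_norm_triangle3 v)
    also have "L2_norm \<Omega> (\<lambda>x. v (n + m) x - v (n + Suc m) x) \<le> (1/2) ^ (n + m)"
      using step[of "n + m"] L2_norm_minus_commute[of \<Omega> "v (n+m)" "v (n + Suc m)"] by simp
    finally show ?case using Suc by simp
  qed
  have fatou: "(\<integral>\<^sup>+x. ennreal ((norm (v n x - w x))\<^sup>2) \<partial>?M) \<le> ennreal ((2 * (1/2) ^ n)\<^sup>2)" for n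
  proof -
    have "(\<integral>\<^sup>+x. ennreal ((norm (v n x - w x))\<^sup>2) \<partial>?M) =
      (\<integral>\<^sup>+x. liminf (\<lambda>m. ennreal ((norm (v n x - v (n + m) x))\<^sup>2)) \<partial>?M)"
    proof (rule nn_integral_cong_AE, use lim in eventually_elim)
      case (elim x)
      have "(\<lambda>m. v (n + m) x) \<longlonglongrightarrow> w x"
        using LIMSEQ_ignore_initial_segment[OF elim, of n] by (simp add: add.commute)
      then have "(\<lambda>m. ennreal ((norm (v n x - v (n + m) x))\<^sup>2)) \<longlonglongrightarrow> ennreal ((norm (v n x - w x))\<^sup>2)"
        by (intro tendsto_intros)
      then show ?case
        by (rule lim_imp_Liminf[symmetric, OF sequentially_bot])
    qed
    also have "\<dots> \<le> liminf (\<lambda>m. \<integral>\<^sup>+x. ennreal ((norm (v n x - v (n + m) x))\<^sup>2) \<partial>?M)"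
      by (rule nn_integral_liminf) measurable
    also have "\<dots> \<le> liminf (\<lambda>m. ennreal ((2 * (1/2) ^ n)\<^sup>2))"
    proof (intro Liminf_mono always_eventually allI)
      fix m
      have "L2_norm \<Omega> (\<lambda>x. v n x - v (n + m) x) \<le> 2 * (1/2) ^ n"
        using tail[of n m] by (rule order_trans) simp
      then show "(\<integral>\<^sup>+x. ennreal ((norm (v n x - v (n + m) x))\<^sup>2) \<partial>?M) \<le> ennreal ((2 * (1/2) ^ n)\<^sup>2)"
        unfolding d2[OF L2_diff[OF v v]] by (intro ennreal_leI power_mono L2_norm_nonneg)
    qed
    finally show ?thesis by (simp add: Liminf_const)
  qed
  have vw: "(\<lambda>x. v n x - w x) \<in> L2 \<Omega>" for n
  proof -
    have "integrable ?M (\<lambda>x. (norm (v n x - w x))\<^sup>2)"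
      by (rule integrableI_bounded) (use fatou[of n] in \<open>auto simp: less_top[symmetric] top_unique\<close>)
    then show ?thesis by (simp add: L2_def)
  qed
  show thesis
  proof
    show "w \<in> L2 \<Omega>" using L2_diff[OF v vw, of 0 0] by simp
    have le: "L2_norm \<Omega> (\<lambda>x. v n x - w x) \<le> 2 * (1/2) ^ n" for n
    proof (rule power2_le_imp_le)
      show "(L2_norm \<Omega> (\<lambda>x. v n x - w x))\<^sup>2 \<le> (2 * (1/2) ^ n)\<^sup>2"
        by (rule ennreal_le_iff[THEN iffD1, OF zero_le_power2]) (use fatou[of n] in \<open>simp only: d2[OF vw]\<close>)
    qed simp
    have "(\<lambda>n. 2 * (1/2::real) ^ n) \<longlonglongrightarrow> 2 * 0"
      by (intro tendsto_mult tendsto_const LIMSEQ_power_zero) simp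
    then have lim: "(\<lambda>n. 2 * (1/2::real) ^ n) \<longlonglongrightarrow> 0"
      unfolding mult_zero_right .
    show "(\<lambda>n. L2_norm \<Omega> (\<lambda>x. v n x - w x)) \<longlonglongrightarrow> 0"
    proof (rule Lim_null_comparison[OF always_eventually lim], rule allI)
      show "norm (L2_norm \<Omega> (\<lambda>x. v n x - w x)) \<le> 2 * (1/2) ^ n" for n
        using le[of n] L2_norm_nonneg[of \<Omega> "\<lambda>x. v n x - w x"] by (simp only: real_norm_def abs_of_nonneg)
    qed
  qed
qed

subsection \<open>Sobolev spaces\<close>

lemma continuous_compact_support_L2:
  fixes f :: "'a::euclidean_space \<Rightarrow> 'b::euclidean_space"
  assumes \<Omega>: "\<Omega> \<in> sets lebesgue" and c: "continuous_on UNIV f" and K: "compact K"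
    and 0: "\<And>x. x \<notin> K \<Longrightarrow> f x = 0"
  shows "f \<in> L2 \<Omega>"
proof -
  have c2: "continuous_on UNIV (\<lambda>x. (norm (f x))\<^sup>2)"
    by (intro continuous_on_power continuous_on_norm c)
  have "integrable lborel (\<lambda>x. (norm (f x))\<^sup>2)"
    by (rule integrable_lborel_compact_support[OF c2 K]) (simp add: 0)
  moreover have "(\<lambda>x. (norm (f x))\<^sup>2) \<in> borel_measurable lborel"
    using borel_measurable_continuous_onI[OF c2] by simp
  ultimately have "integrable (lebesgue_on UNIV) (\<lambda>x. (norm (f x))\<^sup>2)"
    unfolding lebesgue_on_UNIV_eq by (subst integrable_completion)
  then have "integrable (lebesgue_on \<Omega>) (\<lambda>x. (norm (f x))\<^sup>2)"
    by (rule integrable_lebesgue_on_subset) (use \<Omega> in auto)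
  moreover have "f \<in> borel_measurable (lebesgue_on \<Omega>)"
    by (rule continuous_imp_measurable_on_sets_lebesgue[OF continuous_on_subset[OF c subset_UNIV] \<Omega>])
  ultimately show ?thesis by (simp add: L2_def)
qed

lemma test_funs_zero_outside: "x \<notin> closure {x. \<phi> x \<noteq> 0} \<Longrightarrow> \<phi> x = 0"
  using closure_subset[of "{x. \<phi> x \<noteq> 0}"] by blast

lemma test_fun_L2:
  fixes \<phi> :: "'a::euclidean_space \<Rightarrow> 'b::euclidean_space"
  assumes \<Omega>: "\<Omega> \<in> sets lebesgue" and \<phi>: "\<phi> \<in> test_funs U"
  shows "\<phi> \<in> L2 \<Omega>" and "(\<lambda>x. frechet_derivative \<phi> (at x) h) \<in> L2 \<Omega>"
proof -
  have s: "times_cont_diff k \<phi>" for k using \<phi> unfolding test_funs_def by blast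
  have K: "compact (closure {x. \<phi> x \<noteq> 0})" using \<phi> unfolding test_funs_def by blast
  have c: "continuous_on UNIV \<phi>" using s[of 0] by simp
  have cd: "continuous_on UNIV (\<lambda>x. frechet_derivative \<phi> (at x) h)"
    using times_cont_diff_SucD(2)[OF s[of "Suc 0"], of h] by simp
  show "\<phi> \<in> L2 \<Omega>"
    by (rule continuous_compact_support_L2[OF \<Omega> c K]) (rule test_funs_zero_outside)
  show "(\<lambda>x. frechet_derivative \<phi> (at x) h) \<in> L2 \<Omega>"
    by (rule continuous_compact_support_L2[OF \<Omega> cd K])
      (subst frechet_derivative_zero_outside_support, assumption, rule refl)
qed

lemma test_funs_add:
  assumes "\<phi> \<in> test_funs U" "\<psi> \<in> test_funs U"
  shows "(\<lambda>x. \<phi> x + \<psi> x) \<in> test_funs U"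
proof -
  let ?K = "closure {x. \<phi> x \<noteq> 0} \<union> closure {x. \<psi> x \<noteq> 0}"
  have "{x. \<phi> x + \<psi> x \<noteq> 0} \<subseteq> {x. \<phi> x \<noteq> 0} \<union> {x. \<psi> x \<noteq> 0}" by auto
  then have sub: "closure {x. \<phi> x + \<psi> x \<noteq> 0} \<subseteq> ?K"
    unfolding closure_Un[symmetric] by (rule closure_mono)
  have K: "compact ?K" "?K \<subseteq> U"
    using assms unfolding test_funs_def by auto
  have "compact (closure {x. \<phi> x + \<psi> x \<noteq> 0})"
    by (rule compact_closure[THEN iffD2], rule bounded_subset[OF compact_imp_bounded[OF K(1)]])
      (rule order_trans[OF closure_subset sub])
  moreover have "times_cont_diff k (\<lambda>x. \<phi> x + \<psi> x)" for k
    using assms unfolding test_funs_def by (intro times_cont_diff_add) blast+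
  ultimately show ?thesis
    using sub K(2) unfolding test_funs_def by blast
qed

lemma test_funs_scaleR:
  assumes "\<phi> \<in> test_funs U"
  shows "(\<lambda>x. c *\<^sub>R \<phi> x) \<in> test_funs U"
proof -
  have "{x. c *\<^sub>R \<phi> x \<noteq> 0} \<subseteq> {x. \<phi> x \<noteq> 0}" by auto
  then have sub: "closure {x. c *\<^sub>R \<phi> x \<noteq> 0} \<subseteq> closure {x. \<phi> x \<noteq> 0}"
    by (rule closure_mono)
  have K: "compact (closure {x. \<phi> x \<noteq> 0})" "closure {x. \<phi> x \<noteq> 0} \<subseteq> U"
    using assms unfolding test_funs_def by auto
  have "compact (closure {x. c *\<^sub>R \<phi> x \<noteq> 0})"
    by (rule compact_closure[THEN iffD2], rule bounded_subset[OF compact_imp_bounded[OF K(1)]])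
      (rule order_trans[OF closure_subset sub])
  moreover have "times_cont_diff k (\<lambda>x. c *\<^sub>R \<phi> x)" for k
    using assms unfolding test_funs_def by (intro times_cont_diff_scaleR times_cont_diff_const) blast
  ultimately show ?thesis
    using sub K(2) unfolding test_funs_def by blast
qed

text \<open>The double index as a single linear map, the form in which \<open>L2_linear\<close>
  accepts it.\<close>

definition mat_entry :: "'n \<Rightarrow> 'n \<Rightarrow> real^'n^'n \<Rightarrow> real" where
  "mat_entry i j A = A $ i $ j"

lemma linear_mat_entry: "linear (mat_entry i j)"
  by (rule linearI) (simp_all add: mat_entry_def)

section \<open>Weak gradients and vector fields with zero boundary values\<close>

locale bounded_open =
  fixes \<Omega> :: "(real^'n) set"
  assumes open_dom: "open \<Omega>" and bounded_dom: "bounded \<Omega>"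
begin

lemma dom_lmeasurable: "\<Omega> \<in> lmeasurable"
  using open_dom bounded_dom by (simp add: lmeasurable_open)

lemma dom_sets: "\<Omega> \<in> sets lebesgue"
  using dom_lmeasurable by (rule fmeasurableD)

lemma weak_grad_integrable:
  fixes v :: "real^'n \<Rightarrow> real^'n" and G :: "real^'n \<Rightarrow> real^'n^'n" and \<phi> :: "real^'n \<Rightarrow> real"
  assumes "v \<in> L2 \<Omega>" "G \<in> L2 \<Omega>" "\<phi> \<in> test_funs \<Omega>"
  shows "integrable (lebesgue_on \<Omega>) (\<lambda>x. v x $ i * frechet_derivative \<phi> (at x) (axis j 1))"
    and "integrable (lebesgue_on \<Omega>) (\<lambda>x. G x $ i $ j * \<phi> x)"
proof -
  have "(\<lambda>x. v x $ i) \<in> L2 \<Omega>" by (rule L2_linear[OF assms(1) bounded_linear.linear[OF bounded_linear_vec_nth]])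
  from L2_inner_integrable[OF this test_fun_L2(2)[OF dom_sets assms(3)]]
  show "integrable (lebesgue_on \<Omega>) (\<lambda>x. v x $ i * frechet_derivative \<phi> (at x) (axis j 1))" by simp
  have "(\<lambda>x. G x $ i $ j) \<in> L2 \<Omega>"
    using L2_linear[OF assms(2) linear_mat_entry] by (simp add: mat_entry_def)
  from L2_inner_integrable[OF this test_fun_L2(1)[OF dom_sets assms(3)]]
  show "integrable (lebesgue_on \<Omega>) (\<lambda>x. G x $ i $ j * \<phi> x)" by simp
qed

lemma weak_grad_add:
  assumes "v \<in> L2 \<Omega>" "G \<in> L2 \<Omega>" "is_weak_grad \<Omega> v G" "w \<in> L2 \<Omega>" "H \<in> L2 \<Omega>" "is_weak_grad \<Omega> w H"
  shows "is_weak_grad \<Omega> (\<lambda>x. v x + w x) (\<lambda>x. G x + H x)"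
  unfolding is_weak_grad_def
proof (intro ballI allI)
  fix \<phi> :: "real^'n \<Rightarrow> real" and i j :: 'n assume \<phi>: "\<phi> \<in> test_funs \<Omega>"
  note I = weak_grad_integrable[OF assms(1,2) \<phi>, of i j] weak_grad_integrable[OF assms(4,5) \<phi>, of i j]
  have "(LINT x|lebesgue_on \<Omega>. v x $ i * frechet_derivative \<phi> (at x) (axis j 1)) = - (LINT x|lebesgue_on \<Omega>. G x $ i $ j * \<phi> x)"
    "(LINT x|lebesgue_on \<Omega>. w x $ i * frechet_derivative \<phi> (at x) (axis j 1)) = - (LINT x|lebesgue_on \<Omega>. H x $ i $ j * \<phi> x)"
    using assms(3,6) \<phi> unfolding is_weak_grad_def by blast+
  then show "(LINT x|lebesgue_on \<Omega>. (v x + w x) $ i * frechet_derivative \<phi> (at x) (axis j 1)) =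
    - (LINT x|lebesgue_on \<Omega>. (G x + H x) $ i $ j * \<phi> x)"
    using I by (simp add: distrib_right)
qed

lemma weak_grad_scaleR:
  assumes "is_weak_grad \<Omega> v G"
  shows "is_weak_grad \<Omega> (\<lambda>x. c *\<^sub>R v x) (\<lambda>x. c *\<^sub>R G x)"
  unfolding is_weak_grad_def
proof (intro ballI allI)
  fix \<phi> :: "real^'n \<Rightarrow> real" and i j :: 'n assume \<phi>: "\<phi> \<in> test_funs \<Omega>"
  have "(LINT x|lebesgue_on \<Omega>. v x $ i * frechet_derivative \<phi> (at x) (axis j 1)) = - (LINT x|lebesgue_on \<Omega>. G x $ i $ j * \<phi> x)"
    using assms \<phi> unfolding is_weak_grad_def by blast
  then show "(LINT x|lebesgue_on \<Omega>. (c *\<^sub>R v x) $ i * frechet_derivative \<phi> (at x) (axis j 1)) =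
    - (LINT x|lebesgue_on \<Omega>. (c *\<^sub>R G x) $ i $ j * \<phi> x)"
    by (simp add: mult.assoc)
qed

text \<open>The fundamental lemma in each of the finitely many entries. This is what gives content
  to the choice in \<open>wgrad\<close>: every rule for it comes from comparing two weak gradients
  of the same field.\<close>

lemma weak_grad_unique:
  assumes "G \<in> L2 \<Omega>" "H \<in> L2 \<Omega>" "is_weak_grad \<Omega> v G" "is_weak_grad \<Omega> v H"
  shows "AE x in lebesgue_on \<Omega>. G x = H x"
proof -
  have *: "AE x in lebesgue_on \<Omega>. G x $ i $ j - H x $ i $ j = 0" for i j
  proof (rule test_funs_integral_zero_imp_AE_zero[OF open_dom])
    have "(\<lambda>x. G x $ i $ j) \<in> L2 \<Omega>" "(\<lambda>x. H x $ i $ j) \<in> L2 \<Omega>"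
      using L2_linear[OF assms(1) linear_mat_entry] L2_linear[OF assms(2) linear_mat_entry]
      by (simp_all add: mat_entry_def)
    then show "integrable (lebesgue_on \<Omega>) (\<lambda>x. G x $ i $ j - H x $ i $ j)"
      by (intro Bochner_Integration.integrable_diff L2_integrable[OF dom_lmeasurable])
    fix \<phi> :: "real^'n \<Rightarrow> real" assume \<phi>: "\<phi> \<in> test_funs \<Omega>"
    have "- (LINT x|lebesgue_on \<Omega>. G x $ i $ j * \<phi> x) = - (LINT x|lebesgue_on \<Omega>. H x $ i $ j * \<phi> x)"
      using assms(3)[unfolded is_weak_grad_def, rule_format, OF \<phi>, of i j]
        assms(4)[unfolded is_weak_grad_def, rule_format, OF \<phi>, of i j] by (rule trans[OF sym])
    then have "(LINT x|lebesgue_on \<Omega>. G x $ i $ j * \<phi> x) = (LINT x|lebesgue_on \<Omega>. H x $ i $ j * \<phi> x)"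
      by (rule neg_equal_iff_equal[THEN iffD1])
    then show "(LINT x|lebesgue_on \<Omega>. (G x $ i $ j - H x $ i $ j) * \<phi> x) = 0"
      using weak_grad_integrable(2)[OF L2_zero assms(1) \<phi>, of i j] weak_grad_integrable(2)[OF L2_zero assms(2) \<phi>, of i j]
      by (simp add: left_diff_distrib)
  qed
  have "AE x in lebesgue_on \<Omega>. \<forall>i\<in>UNIV. \<forall>j\<in>UNIV. G x $ i $ j - H x $ i $ j = 0"
    by (intro AE_finite_allI * finite)
  then show ?thesis
    by eventually_elim (simp add: vec_eq_iff)
qed

text \<open>The classical gradient is a weak one, because a component of \<phi> times a scalar test
  function is compactly supported and its partial derivatives integrate to 0. Thus the approximants
  in \<open>W12_0\<close> obey the triangle inequality of \<open>W12_norm\<close>, which is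
  available only within \<open>W12 \<Omega>\<close>.\<close>

lemma test_fun_W12:
  assumes \<phi>: "\<phi> \<in> test_funs \<Omega>"
  shows "\<phi> \<in> W12 \<Omega>"
proof -
  define G :: "real^'n \<Rightarrow> real^'n^'n" where "G x = (\<chi> i j. frechet_derivative \<phi> (at x) (axis j 1) $ i)" for x
  have sp: "times_cont_diff k \<phi>" for k using \<phi> unfolding test_funs_def by blast
  have K: "compact (closure {x. \<phi> x \<noteq> 0})" using \<phi> unfolding test_funs_def by blast
  have cD: "continuous_on UNIV (\<lambda>x. frechet_derivative \<phi> (at x) h)" for h
    using times_cont_diff_SucD(2)[OF sp[of "Suc 0"], of h] by simp
  have cG: "continuous_on UNIV G"
    unfolding G_def by (intro continuous_on_vec_lambda continuous_on_component cD)
  have G: "G \<in> L2 \<Omega>"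
  proof (rule continuous_compact_support_L2[OF dom_sets cG K])
    fix x assume "x \<notin> closure {x. \<phi> x \<noteq> 0}"
    then show "G x = 0" unfolding G_def
      by (subst frechet_derivative_zero_outside_support) (simp_all add: vec_eq_iff)
  qed
  have "is_weak_grad \<Omega> \<phi> G"
    unfolding is_weak_grad_def
  proof (intro ballI allI)
    fix \<psi> :: "real^'n \<Rightarrow> real" and i j :: 'n
    assume \<psi>: "\<psi> \<in> test_funs \<Omega>"
    define F where "F x = \<phi> x $ i * \<psi> x" for x
    have s\<psi>: "times_cont_diff k \<psi>" for k using \<psi> unfolding test_funs_def by blast
    have K\<psi>: "compact (closure {x. \<psi> x \<noteq> 0})" "closure {x. \<psi> x \<noteq> 0} \<subseteq> \<Omega>"
      using \<psi> unfolding test_funs_def by blast+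
    have sF: "times_cont_diff 1 F"
      unfolding F_def by (intro times_cont_diff_mult s\<psi> times_cont_diff_linear_compose[OF bounded_linear_vec_nth] sp)
    have "{x. F x \<noteq> 0} \<subseteq> {x. \<psi> x \<noteq> 0}" by (auto simp: F_def)
    then have sub: "closure {x. F x \<noteq> 0} \<subseteq> closure {x. \<psi> x \<noteq> 0}" by (rule closure_mono)
    have KF: "compact (closure {x. F x \<noteq> 0})"
      by (rule compact_closure[THEN iffD2], rule bounded_subset[OF compact_imp_bounded[OF K\<psi>(1)]])
        (rule order_trans[OF closure_subset sub])
    define D where "D x = frechet_derivative F (at x) (axis j 1)" for x
    have D: "D x = \<phi> x $ i * frechet_derivative \<psi> (at x) (axis j 1) + G x $ i $ j * \<psi> x" for x
    proof -
      have "((\<lambda>x. \<phi> x $ i * \<psi> x) has_derivative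
        (\<lambda>h. \<phi> x $ i * frechet_derivative \<psi> (at x) h + frechet_derivative \<phi> (at x) h $ i * \<psi> x)) (at x)"
        by (intro has_derivative_mult bounded_linear.has_derivative[OF bounded_linear_vec_nth]
            times_cont_diff_SucD(1)[OF s\<psi>[of "Suc 0"]] times_cont_diff_SucD(1)[OF sp[of "Suc 0"]])
      then have "(F has_derivative
        (\<lambda>h. \<phi> x $ i * frechet_derivative \<psi> (at x) h + frechet_derivative \<phi> (at x) h $ i * \<psi> x)) (at x)"
        unfolding F_def .
      from frechet_derivative_at[OF this, symmetric] show ?thesis
        by (simp add: D_def G_def)
    qed
    \<comment> \<open>The support of \<psi> lies in the domain, so the integral over \<Omega> is one
      over the whole space.\<close>
    have D0: "D x = 0" if "x \<notin> \<Omega>" for x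
      unfolding D_def using that sub K\<psi>(2)
      by (subst frechet_derivative_zero_outside_support) (blast, rule refl)
    have "(LINT x|lebesgue_on \<Omega>. D x) = (LINT x|lebesgue. indicator \<Omega> x *\<^sub>R D x)"
      by (rule LINT_lebesgue_on_eq[OF dom_sets])
    also have "\<dots> = (LINT x|lebesgue. D x)"
      by (rule Bochner_Integration.integral_cong) (auto simp: D0 split: split_indicator)
    also have "\<dots> = (LINT x|lborel. D x)"
      using borel_measurable_integrable[OF integral_frechet_derivative_eq_0(1)[OF sF KF, of "axis j 1"]]
      by (intro integral_completion) (simp add: D_def)
    also have "\<dots> = 0"
      unfolding D_def by (rule integral_frechet_derivative_eq_0(2)[OF sF KF])
    finally have "(LINT x|lebesgue_on \<Omega>. \<phi> x $ i * frechet_derivative \<psi> (at x) (axis j 1) + G x $ i $ j * \<psi> x) = 0"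
      by (simp add: D)
    then show "(LINT x|lebesgue_on \<Omega>. \<phi> x $ i * frechet_derivative \<psi> (at x) (axis j 1)) =
      - (LINT x|lebesgue_on \<Omega>. G x $ i $ j * \<psi> x)"
      using weak_grad_integrable[OF test_fun_L2(1)[OF dom_sets \<phi>] G \<psi>, of i j] by simp
  qed
  then show ?thesis
    using G test_fun_L2(1)[OF dom_sets \<phi>] unfolding W12_def by blast
qed

lemma W12_L2: "v \<in> W12 \<Omega> \<Longrightarrow> v \<in> L2 \<Omega>"
  by (simp add: W12_def)

lemma wgrad:
  assumes "v \<in> W12 \<Omega>"
  shows "wgrad \<Omega> v \<in> L2 \<Omega>" "is_weak_grad \<Omega> v (wgrad \<Omega> v)"
proof -
  have "\<exists>G. G \<in> L2 \<Omega> \<and> is_weak_grad \<Omega> v G" using assms by (auto simp: W12_def)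
  from someI_ex[OF this] show "wgrad \<Omega> v \<in> L2 \<Omega>" "is_weak_grad \<Omega> v (wgrad \<Omega> v)"
    by (auto simp: wgrad_def)
qed

text \<open>Since \<open>wgrad\<close> is a choice, its additivity holds only almost everywhere, by
  uniqueness; the same goes for multiples and differences below.\<close>

lemma W12_add:
  assumes "v \<in> W12 \<Omega>" "w \<in> W12 \<Omega>"
  shows "(\<lambda>x. v x + w x) \<in> W12 \<Omega>"
    and "AE x in lebesgue_on \<Omega>. wgrad \<Omega> (\<lambda>x. v x + w x) x = wgrad \<Omega> v x + wgrad \<Omega> w x"
proof -
  note W = wgrad[OF assms(1)] wgrad[OF assms(2)]
  have G: "(\<lambda>x. wgrad \<Omega> v x + wgrad \<Omega> w x) \<in> L2 \<Omega>" by (rule L2_add[OF W(1,3)])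
  have g: "is_weak_grad \<Omega> (\<lambda>x. v x + w x) (\<lambda>x. wgrad \<Omega> v x + wgrad \<Omega> w x)"
    by (intro weak_grad_add W assms[THEN W12_L2])
  show 1: "(\<lambda>x. v x + w x) \<in> W12 \<Omega>"
    using L2_add[OF assms[THEN W12_L2]] G g unfolding W12_def by blast
  show "AE x in lebesgue_on \<Omega>. wgrad \<Omega> (\<lambda>x. v x + w x) x = wgrad \<Omega> v x + wgrad \<Omega> w x"
    by (rule weak_grad_unique[OF wgrad(1)[OF 1] G wgrad(2)[OF 1] g])
qed

lemma W12_scaleR:
  assumes "v \<in> W12 \<Omega>"
  shows "(\<lambda>x. c *\<^sub>R v x) \<in> W12 \<Omega>"
    and "AE x in lebesgue_on \<Omega>. wgrad \<Omega> (\<lambda>x. c *\<^sub>R v x) x = c *\<^sub>R wgrad \<Omega> v x"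
proof -
  note W = wgrad[OF assms(1)]
  have G: "(\<lambda>x. c *\<^sub>R wgrad \<Omega> v x) \<in> L2 \<Omega>" by (rule L2_scaleR[OF W(1)])
  have g: "is_weak_grad \<Omega> (\<lambda>x. c *\<^sub>R v x) (\<lambda>x. c *\<^sub>R wgrad \<Omega> v x)"
    by (intro weak_grad_scaleR W)
  show 1: "(\<lambda>x. c *\<^sub>R v x) \<in> W12 \<Omega>"
    using L2_scaleR[OF assms[THEN W12_L2]] G g unfolding W12_def by blast
  show "AE x in lebesgue_on \<Omega>. wgrad \<Omega> (\<lambda>x. c *\<^sub>R v x) x = c *\<^sub>R wgrad \<Omega> v x"
    by (rule weak_grad_unique[OF wgrad(1)[OF 1] G wgrad(2)[OF 1] g])
qed

lemma W12_diff:
  assumes "v \<in> W12 \<Omega>" "w \<in> W12 \<Omega>"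
  shows "(\<lambda>x. v x - w x) \<in> W12 \<Omega>"
    and "AE x in lebesgue_on \<Omega>. wgrad \<Omega> (\<lambda>x. v x - w x) x = wgrad \<Omega> v x - wgrad \<Omega> w x"
proof -
  note m = W12_scaleR[OF assms(2), of "-1"]
  note a = W12_add[OF assms(1) m(1)]
  show "(\<lambda>x. v x - w x) \<in> W12 \<Omega>" using a(1) by simp
  have "AE x in lebesgue_on \<Omega>. wgrad \<Omega> (\<lambda>x. v x - w x) x = wgrad \<Omega> v x + wgrad \<Omega> (\<lambda>x. (-1) *\<^sub>R w x) x"
    using a(2) by simp
  then show "AE x in lebesgue_on \<Omega>. wgrad \<Omega> (\<lambda>x. v x - w x) x = wgrad \<Omega> v x - wgrad \<Omega> w x"
    using m(2) by eventually_elim simp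
qed

lemma wgrad_norm_diff:
  assumes "v \<in> W12 \<Omega>" "w \<in> W12 \<Omega>"
  shows "L2_norm \<Omega> (wgrad \<Omega> (\<lambda>x. v x - w x)) = L2_norm \<Omega> (\<lambda>x. wgrad \<Omega> v x - wgrad \<Omega> w x)"
  by (rule L2_norm_AE_cong[OF wgrad(1)[OF W12_diff(1)[OF assms]]
        L2_diff[OF wgrad(1)[OF assms(1)] wgrad(1)[OF assms(2)]] W12_diff(2)[OF assms]])

lemma W12_norm_nonneg: "0 \<le> W12_norm \<Omega> v"
  by (simp add: W12_norm_def)

lemma L2_norm_le_W12_norm: "L2_norm \<Omega> v \<le> W12_norm \<Omega> v"
  unfolding W12_norm_def by (rule real_le_rsqrt) simp

lemma wgrad_norm_le_W12_norm: "L2_norm \<Omega> (wgrad \<Omega> v) \<le> W12_norm \<Omega> v"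
  unfolding W12_norm_def by (rule real_le_rsqrt) simp

lemma W12_norm_scaleR:
  assumes "v \<in> W12 \<Omega>"
  shows "W12_norm \<Omega> (\<lambda>x. c *\<^sub>R v x) = \<bar>c\<bar> * W12_norm \<Omega> v"
proof -
  have "L2_norm \<Omega> (wgrad \<Omega> (\<lambda>x. c *\<^sub>R v x)) = L2_norm \<Omega> (\<lambda>x. c *\<^sub>R wgrad \<Omega> v x)"
    by (rule L2_norm_AE_cong[OF wgrad(1)[OF W12_scaleR(1)[OF assms]]
          L2_scaleR[OF wgrad(1)[OF assms]] W12_scaleR(2)[OF assms]])
  then have "W12_norm \<Omega> (\<lambda>x. c *\<^sub>R v x) = sqrt (c\<^sup>2 * ((L2_norm \<Omega> v)\<^sup>2 + (L2_norm \<Omega> (wgrad \<Omega> v))\<^sup>2))"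
    by (simp add: W12_norm_def L2_norm_scaleR power_mult_distrib distrib_left)
  then show ?thesis
    by (simp add: W12_norm_def real_sqrt_mult)
qed

lemma W12_norm_triangle_diff:
  assumes "v \<in> W12 \<Omega>" "w \<in> W12 \<Omega>"
  shows "W12_norm \<Omega> (\<lambda>x. v x - w x) \<le> W12_norm \<Omega> v + W12_norm \<Omega> w"
proof -
  have "W12_norm \<Omega> (\<lambda>x. v x - w x) \<le> sqrt ((L2_norm \<Omega> v + L2_norm \<Omega> w)\<^sup>2 +
    (L2_norm \<Omega> (wgrad \<Omega> v) + L2_norm \<Omega> (wgrad \<Omega> w))\<^sup>2)"
    unfolding W12_norm_def wgrad_norm_diff[OF assms]
    by (intro real_sqrt_le_mono add_mono power_mono L2_norm_triangle_diff L2_norm_nonneg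
        W12_L2 wgrad assms)
  also have "\<dots> \<le> W12_norm \<Omega> v + W12_norm \<Omega> w"
    unfolding W12_norm_def by (rule real_sqrt_sum_squares_triangle_ineq)
  finally show ?thesis .
qed

lemma W12_norm_triangle_add:
  assumes "v \<in> W12 \<Omega>" "w \<in> W12 \<Omega>"
  shows "W12_norm \<Omega> (\<lambda>x. v x + w x) \<le> W12_norm \<Omega> v + W12_norm \<Omega> w"
  using W12_norm_triangle_diff[OF assms(1) W12_scaleR(1)[OF assms(2), of "-1"]]
    W12_norm_scaleR[OF assms(2), of "-1"] by simp

lemma W12_0_W12: "v \<in> W12_0 \<Omega> \<Longrightarrow> v \<in> W12 \<Omega>"
  by (simp add: W12_0_def)

lemma W12_0_L2: "v \<in> W12_0 \<Omega> \<Longrightarrow> v \<in> L2 \<Omega>"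
  by (intro W12_L2 W12_0_W12)

lemma W12_0_add:
  assumes "v \<in> W12_0 \<Omega>" "w \<in> W12_0 \<Omega>"
  shows "(\<lambda>x. v x + w x) \<in> W12_0 \<Omega>"
proof -
  obtain \<phi> where \<phi>: "\<And>k::nat. \<phi> k \<in> test_funs \<Omega>" "(\<lambda>k. W12_norm \<Omega> (\<lambda>x. \<phi> k x - v x)) \<longlonglongrightarrow> 0"
    using assms(1) unfolding W12_0_def by blast
  obtain \<psi> where \<psi>: "\<And>k::nat. \<psi> k \<in> test_funs \<Omega>" "(\<lambda>k. W12_norm \<Omega> (\<lambda>x. \<psi> k x - w x)) \<longlonglongrightarrow> 0"
    using assms(2) unfolding W12_0_def by blast
  note v = assms(1)[THEN W12_0_W12] and w = assms(2)[THEN W12_0_W12]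
  have lim: "(\<lambda>k. W12_norm \<Omega> (\<lambda>x. \<phi> k x - v x) + W12_norm \<Omega> (\<lambda>x. \<psi> k x - w x)) \<longlonglongrightarrow> 0"
    using tendsto_add[OF \<phi>(2) \<psi>(2)] by simp
  have "(\<lambda>k. W12_norm \<Omega> (\<lambda>x. (\<phi> k x + \<psi> k x) - (v x + w x))) \<longlonglongrightarrow> 0"
  proof (rule Lim_null_comparison[OF always_eventually lim], rule allI)
    fix k
    have "(\<lambda>x. (\<phi> k x + \<psi> k x) - (v x + w x)) = (\<lambda>x. (\<phi> k x - v x) + (\<psi> k x - w x))"
      by (simp add: fun_eq_iff)
    then show "norm (W12_norm \<Omega> (\<lambda>x. (\<phi> k x + \<psi> k x) - (v x + w x))) \<le>
      W12_norm \<Omega> (\<lambda>x. \<phi> k x - v x) + W12_norm \<Omega> (\<lambda>x. \<psi> k x - w x)"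
      using W12_norm_triangle_add[OF W12_diff(1)[OF test_fun_W12[OF \<phi>(1)[of k]] v]
          W12_diff(1)[OF test_fun_W12[OF \<psi>(1)[of k]] w]] W12_norm_nonneg by simp
  qed
  then show ?thesis
    unfolding W12_0_def using W12_add(1)[OF v w] test_funs_add[OF \<phi>(1) \<psi>(1)]
    by (intro CollectI conjI exI[of _ "\<lambda>k x. \<phi> k x + \<psi> k x"] allI)
qed

lemma W12_0_scaleR:
  assumes "v \<in> W12_0 \<Omega>"
  shows "(\<lambda>x. c *\<^sub>R v x) \<in> W12_0 \<Omega>"
proof -
  obtain \<phi> where \<phi>: "\<And>k::nat. \<phi> k \<in> test_funs \<Omega>" "(\<lambda>k. W12_norm \<Omega> (\<lambda>x. \<phi> k x - v x)) \<longlonglongrightarrow> 0"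
    using assms(1) unfolding W12_0_def by blast
  note v = assms(1)[THEN W12_0_W12]
  have "W12_norm \<Omega> (\<lambda>x. c *\<^sub>R \<phi> k x - c *\<^sub>R v x) = \<bar>c\<bar> * W12_norm \<Omega> (\<lambda>x. \<phi> k x - v x)" for k
    using W12_norm_scaleR[OF W12_diff(1)[OF test_fun_W12[OF \<phi>(1)[of k]] v], of c]
    by (simp add: scaleR_diff_right)
  then have "(\<lambda>k. W12_norm \<Omega> (\<lambda>x. c *\<^sub>R \<phi> k x - c *\<^sub>R v x)) \<longlonglongrightarrow> 0"
    using tendsto_mult_right_zero[OF \<phi>(2), of "\<bar>c\<bar>"] by simp
  then show ?thesis
    unfolding W12_0_def using W12_scaleR(1)[OF v] test_funs_scaleR[OF \<phi>(1)]
    by (intro CollectI conjI exI[of _ "\<lambda>k x. c *\<^sub>R \<phi> k x"] allI)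
qed

lemma W12_0_diff:
  assumes "v \<in> W12_0 \<Omega>" "w \<in> W12_0 \<Omega>"
  shows "(\<lambda>x. v x - w x) \<in> W12_0 \<Omega>"
  using W12_0_add[OF assms(1) W12_0_scaleR[OF assms(2), of "-1"]] by simp

lemma W12_zero: "(\<lambda>x. 0) \<in> W12 \<Omega>"
proof -
  have "is_weak_grad \<Omega> (\<lambda>x. 0) (\<lambda>x. 0)" by (simp add: is_weak_grad_def)
  then show ?thesis unfolding W12_def
    by (intro CollectI conjI bexI[of _ "\<lambda>x. 0"] L2_zero)
qed

lemma W12_norm_zero: "W12_norm \<Omega> (\<lambda>x. 0) = 0"
  using W12_norm_scaleR[OF W12_zero, of 0] by simp

lemma W12_0_zero: "(\<lambda>x. 0) \<in> W12_0 \<Omega>"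
proof -
  have "(\<lambda>x. 0) \<in> test_funs \<Omega>"
    by (simp add: test_funs_def times_cont_diff_const)
  moreover have "(\<lambda>k. W12_norm \<Omega> (\<lambda>x. 0 - 0)) \<longlonglongrightarrow> 0" by (simp add: W12_norm_zero)
  ultimately show ?thesis unfolding W12_0_def using W12_zero by (intro CollectI conjI exI[of _ "\<lambda>k x. 0"]) auto
qed

section \<open>Functionals on \<open>W12_0\<close> and their norm\<close>

lemma dual_add: "F \<in> W12_dual \<Omega> \<Longrightarrow> v \<in> W12_0 \<Omega> \<Longrightarrow> w \<in> W12_0 \<Omega> \<Longrightarrow> F (\<lambda>x. v x + w x) = F v + F w"
  by (simp add: W12_dual_def)

lemma dual_scaleR: "F \<in> W12_dual \<Omega> \<Longrightarrow> v \<in> W12_0 \<Omega> \<Longrightarrow> F (\<lambda>x. c *\<^sub>R v x) = c * F v"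
  by (simp add: W12_dual_def)

lemma dual_diff:
  assumes "F \<in> W12_dual \<Omega>" "v \<in> W12_0 \<Omega>" "w \<in> W12_0 \<Omega>"
  shows "F (\<lambda>x. v x - w x) = F v - F w"
  using dual_add[OF assms(1,2) W12_0_scaleR[OF assms(3), of "-1"]] dual_scaleR[OF assms(1,3), of "-1"] by simp

text \<open>The supremum in \<open>dual_norm\<close> is one of real numbers and is meaningful only
  for a set bounded above.\<close>

lemma dual_bdd:
  assumes "F \<in> W12_dual \<Omega>"
  shows "bdd_above ((\<lambda>v. \<bar>F v\<bar>) ` {v \<in> W12_0 \<Omega>. W12_norm \<Omega> v \<le> 1})"
proof -
  obtain C where C: "\<And>v. v \<in> W12_0 \<Omega> \<Longrightarrow> \<bar>F v\<bar> \<le> C * W12_norm \<Omega> v"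
    using assms unfolding W12_dual_def by blast
  show ?thesis
  proof (rule bdd_aboveI2)
    fix v assume v: "v \<in> {v \<in> W12_0 \<Omega>. W12_norm \<Omega> v \<le> 1}"
    have "\<bar>F v\<bar> \<le> C * W12_norm \<Omega> v" using C v by blast
    also have "\<dots> \<le> \<bar>C\<bar> * 1" using v W12_norm_nonneg[of v] by (intro mult_mono) auto
    finally show "\<bar>F v\<bar> \<le> \<bar>C\<bar> * 1" .
  qed
qed

lemma dual_norm_nonneg:
  assumes "F \<in> W12_dual \<Omega>"
  shows "0 \<le> dual_norm \<Omega> F"
  unfolding dual_norm_def
  by (rule cSUP_upper2[OF dual_bdd[OF assms], of "\<lambda>x. 0"]) (simp_all add: W12_0_zero W12_norm_zero)

text \<open>Rescaling to norm 1 reduces to the supremum. Since \<open>W12_norm\<close> is a seminorm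
  on representatives, elements of norm 0 cannot be rescaled; boundedness makes the functional vanish
  on them.\<close>

lemma dual_norm_bound:
  assumes F: "F \<in> W12_dual \<Omega>" and v: "v \<in> W12_0 \<Omega>"
  shows "\<bar>F v\<bar> \<le> dual_norm \<Omega> F * W12_norm \<Omega> v"
proof (cases "W12_norm \<Omega> v = 0")
  case True
  obtain C where C: "\<And>v. v \<in> W12_0 \<Omega> \<Longrightarrow> \<bar>F v\<bar> \<le> C * W12_norm \<Omega> v"
    using F unfolding W12_dual_def by blast
  show ?thesis using C[OF v] True by simp
next
  case False
  then have p: "0 < W12_norm \<Omega> v" using W12_norm_nonneg[of v] by simp
  let ?c = "inverse (W12_norm \<Omega> v)"
  have "\<bar>F (\<lambda>x. ?c *\<^sub>R v x)\<bar> \<le> dual_norm \<Omega> F"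
    unfolding dual_norm_def
  proof (rule cSUP_upper[OF _ dual_bdd[OF F]])
    show "(\<lambda>x. ?c *\<^sub>R v x) \<in> {v \<in> W12_0 \<Omega>. W12_norm \<Omega> v \<le> 1}"
      using W12_0_scaleR[OF v, of ?c] W12_norm_scaleR[OF W12_0_W12[OF v], of ?c] p by simp
  qed
  then have "?c * \<bar>F v\<bar> \<le> dual_norm \<Omega> F"
    using dual_scaleR[OF F v, of ?c] p by (simp add: abs_mult)
  then show ?thesis using p by (simp add: field_simps)
qed

lemma dual_normI:
  assumes "\<And>v. v \<in> W12_0 \<Omega> \<Longrightarrow> \<bar>F v\<bar> \<le> C * W12_norm \<Omega> v" "0 \<le> C"
  shows "dual_norm \<Omega> F \<le> C"
  unfolding dual_norm_def
proof (rule cSUP_least)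
  show "{v \<in> W12_0 \<Omega>. W12_norm \<Omega> v \<le> 1} \<noteq> {}" using W12_0_zero W12_norm_zero by auto
  fix v assume v: "v \<in> {v \<in> W12_0 \<Omega>. W12_norm \<Omega> v \<le> 1}"
  then have "\<bar>F v\<bar> \<le> C * W12_norm \<Omega> v" using assms(1) by blast
  also have "\<dots> \<le> C * 1" using v assms(2) by (intro mult_left_mono) auto
  finally show "\<bar>F v\<bar> \<le> C" by simp
qed

lemma dual_minus:
  assumes F: "F \<in> W12_dual \<Omega>" and G: "G \<in> W12_dual \<Omega>"
  shows "(\<lambda>v. F v - G v) \<in> W12_dual \<Omega>"
    and "dual_norm \<Omega> (\<lambda>v. F v - G v) \<le> dual_norm \<Omega> F + dual_norm \<Omega> G"
proof -
  have b: "\<bar>F v - G v\<bar> \<le> (dual_norm \<Omega> F + dual_norm \<Omega> G) * W12_norm \<Omega> v" if "v \<in> W12_0 \<Omega>" for v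
    using dual_norm_bound[OF F that] dual_norm_bound[OF G that] by (simp add: distrib_right)
  show "(\<lambda>v. F v - G v) \<in> W12_dual \<Omega>"
    unfolding W12_dual_def
  proof (intro CollectI conjI ballI allI)
    show "\<exists>C. \<forall>v\<in>W12_0 \<Omega>. \<bar>F v - G v\<bar> \<le> C * W12_norm \<Omega> v" using b by blast
  qed (simp_all add: dual_add dual_scaleR F G right_diff_distrib)
  show "dual_norm \<Omega> (\<lambda>v. F v - G v) \<le> dual_norm \<Omega> F + dual_norm \<Omega> G"
    using b dual_norm_nonneg[OF F] dual_norm_nonneg[OF G] by (intro dual_normI) auto
qed

end

subsection \<open>Bochner spaces\<close>

text \<open>The everywhere defined \<open>lim\<close> is measurable and agrees with \<open>g\<close>
  off a null set, so completeness applies. This reduces measurability of norms and pairings of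
  Bochner functions to simple functions.\<close>

lemma borel_measurable_lebesgue_on_AE_limit:
  fixes f :: "nat \<Rightarrow> real \<Rightarrow> real"
  assumes I: "I \<in> sets lebesgue" and f: "\<And>k. f k \<in> borel_measurable (lebesgue_on I)"
    and lim: "AE t in lebesgue_on I. (\<lambda>k. f k t) \<longlonglongrightarrow> g t"
  shows "g \<in> borel_measurable (lebesgue_on I)"
proof (rule AE_eq_borel_measurable_lebesgue_on[OF I])
  show "(\<lambda>t. lim (\<lambda>k. f k t)) \<in> borel_measurable (lebesgue_on I)"
    by (rule borel_measurable_lim_metric[OF f])
  show "AE t in lebesgue_on I. lim (\<lambda>k. f k t) = g t"
    using lim by eventually_elim (rule limI)
qed

lemma simple_function_borel:
  fixes f :: "_ \<Rightarrow> real"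
  shows "simple_function M f \<Longrightarrow> f \<in> borel_measurable M"
  by (rule borel_measurable_simple_function)

text \<open>Subtraction is the only operation that \<open>bochner_L2\<close> mentions, so closure
  under differences and a triangle inequality for them carry the theory. One development then serves
  \<open>L2\<close>, \<open>W12_0\<close> and \<open>W12_dual\<close>, whose elements are
  representatives with seminorms.\<close>

locale seminormed_set =
  fixes X :: "('a \<Rightarrow> 'b::ab_group_add) set" and N :: "('a \<Rightarrow> 'b) \<Rightarrow> real"
  assumes zero: "(\<lambda>_. 0) \<in> X" and norm_zero: "N (\<lambda>_. 0) = 0"
    and diff: "x \<in> X \<Longrightarrow> y \<in> X \<Longrightarrow> x - y \<in> X"
    and nonneg: "x \<in> X \<Longrightarrow> 0 \<le> N x"
    and triangle: "x \<in> X \<Longrightarrow> y \<in> X \<Longrightarrow> N (x - y) \<le> N x + N y"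
begin

lemma norm_minus_commute: "x \<in> X \<Longrightarrow> y \<in> X \<Longrightarrow> N (x - y) = N (y - x)"
proof -
  have *: "N (y - x) \<le> N (x - y)" if "x \<in> X" "y \<in> X" for x y
  proof -
    have "y - x = (\<lambda>_. 0) - (x - y)" by (simp add: fun_eq_iff)
    then show ?thesis using triangle[OF zero diff[OF that]] norm_zero by simp
  qed
  show "x \<in> X \<Longrightarrow> y \<in> X \<Longrightarrow> N (x - y) = N (y - x)"
    using *[of x y] *[of y x] by simp
qed

lemma norm_self: "N (x - x) = 0"
proof -
  have "x - x = (\<lambda>_. 0)" by (simp add: fun_eq_iff)
  then show ?thesis by (simp only: norm_zero)
qed

lemma triangle3:
  assumes "x \<in> X" "y \<in> X" "z \<in> X"
  shows "N (x - z) \<le> N (x - y) + N (y - z)"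
proof -
  have "x - z = (x - y) - (z - y)" by (simp add: fun_eq_iff)
  then show ?thesis
    using triangle[OF diff[OF assms(1,2)] diff[OF assms(3,2)]] norm_minus_commute[OF assms(2,3)] by simp
qed

lemma norm_le_add: "x \<in> X \<Longrightarrow> y \<in> X \<Longrightarrow> N x \<le> N (x - y) + N y"
  using triangle3[of x y "\<lambda>_. 0"] zero by (simp add: fun_diff_def)

lemma norm_diff_diff:
  assumes "a \<in> X" "b \<in> X" "c \<in> X" "d \<in> X"
  shows "N ((a - b) - (c - d)) \<le> N (a - c) + N (b - d)"
proof -
  have "(a - b) - (c - d) = (a - c) - (b - d)" by (simp add: fun_eq_iff)
  then show ?thesis using triangle[OF diff[OF assms(1,3)] diff[OF assms(2,4)]] by (simp only:)
qed

lemma abs_norm_diff: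
  assumes "x \<in> X" "y \<in> X"
  shows "\<bar>N x - N y\<bar> \<le> N (x - y)"
  using norm_le_add[OF assms] norm_le_add[OF assms(2,1)] norm_minus_commute[OF assms] by linarith

lemma norm_measurable:
  fixes I :: "real set"
  assumes I: "I \<in> sets lebesgue" and X: "AE t in lebesgue_on I. v t \<in> X"
    and s: "\<And>k::nat. simple_function (lebesgue_on I) (s k)" "\<And>k. s k ` I \<subseteq> X"
    and lim: "AE t in lebesgue_on I. (\<lambda>k. N (s k t - v t)) \<longlonglongrightarrow> 0"
  shows "(\<lambda>t. N (v t)) \<in> borel_measurable (lebesgue_on I)"
proof (rule borel_measurable_lebesgue_on_AE_limit[OF I])
  show "(\<lambda>t. N (s k t)) \<in> borel_measurable (lebesgue_on I)" for k
    by (rule simple_function_borel[OF simple_function_compose1[OF s(1)]])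
  show "AE t in lebesgue_on I. (\<lambda>k. N (s k t)) \<longlonglongrightarrow> N (v t)"
    using X lim AE_space
  proof eventually_elim
    case (elim t)
    have "(\<lambda>k. N (s k t) - N (v t)) \<longlonglongrightarrow> 0"
    proof (rule Lim_null_comparison[OF always_eventually elim(2)], rule allI)
      show "norm (N (s k t) - N (v t)) \<le> N (s k t - v t)" for k
        using abs_norm_diff[of "s k t" "v t"] elim(1,3) s(2)[of k] by auto
    qed
    then show ?case by (rule LIM_zero_cancel)
  qed
qed

lemma bochner_norm_measurable:
  assumes I: "I \<in> sets lebesgue" and v: "v \<in> bochner_L2 I X N"
  shows "(\<lambda>t. N (v t)) \<in> borel_measurable (lebesgue_on I)"
  using v norm_measurable[OF I] unfolding bochner_L2_def by blast

lemma bochner_diff: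
  assumes I: "I \<in> sets lebesgue" and v: "v \<in> bochner_L2 I X N" and w: "w \<in> bochner_L2 I X N"
  shows "(\<lambda>t. v t - w t) \<in> bochner_L2 I X N"
proof -
  obtain s where s: "AE t in lebesgue_on I. v t \<in> X" "\<And>k::nat. simple_function (lebesgue_on I) (s k)"
    "\<And>k. s k ` I \<subseteq> X" "AE t in lebesgue_on I. (\<lambda>k. N (s k t - v t)) \<longlonglongrightarrow> 0"
    "integrable (lebesgue_on I) (\<lambda>t. (N (v t))\<^sup>2)"
    using v unfolding bochner_L2_def by blast
  obtain r where r: "AE t in lebesgue_on I. w t \<in> X" "\<And>k::nat. simple_function (lebesgue_on I) (r k)"
    "\<And>k. r k ` I \<subseteq> X" "AE t in lebesgue_on I. (\<lambda>k. N (r k t - w t)) \<longlonglongrightarrow> 0"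
    "integrable (lebesgue_on I) (\<lambda>t. (N (w t))\<^sup>2)"
    using w unfolding bochner_L2_def by blast
  have X: "AE t in lebesgue_on I. v t - w t \<in> X"
    using s(1) r(1) by eventually_elim (rule diff)
  have sr: "simple_function (lebesgue_on I) (\<lambda>t. s k t - r k t)" for k
    by (rule simple_function_compose2[OF s(2) r(2)])
  have srX: "(\<lambda>t. s k t - r k t) ` I \<subseteq> X" for k
    using s(3)[of k] r(3)[of k] diff by blast
  have lim: "AE t in lebesgue_on I. (\<lambda>k. N ((s k t - r k t) - (v t - w t))) \<longlonglongrightarrow> 0"
    using s(1,4) r(1,4) AE_space
  proof eventually_elim
    case (elim t)
    have l: "(\<lambda>k. N (s k t - v t) + N (r k t - w t)) \<longlonglongrightarrow> 0"
      using tendsto_add[OF elim(2,4)] by simp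
    show ?case
    proof (rule Lim_null_comparison[OF always_eventually l], rule allI)
      fix k
      have "s k t \<in> X" "r k t \<in> X" using elim(5) s(3)[of k] r(3)[of k] by auto
      then show "norm (N ((s k t - r k t) - (v t - w t))) \<le> N (s k t - v t) + N (r k t - w t)"
        using norm_diff_diff[of "s k t" "r k t" "v t" "w t"] elim(1,3)
          nonneg[OF diff[OF diff diff], of "s k t" "r k t" "v t" "w t"] by simp
    qed
  qed
  have m: "(\<lambda>t. N (v t - w t)) \<in> borel_measurable (lebesgue_on I)"
    by (rule norm_measurable[OF I X sr srX lim])
  have "integrable (lebesgue_on I) (\<lambda>t. (N (v t - w t))\<^sup>2)"
  proof (rule Bochner_Integration.integrable_bound)
    show "integrable (lebesgue_on I) (\<lambda>t. 2 * (N (v t))\<^sup>2 + 2 * (N (w t))\<^sup>2)"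
      using s(5) r(5) by simp
    show "AE t in lebesgue_on I. norm ((N (v t - w t))\<^sup>2) \<le> norm (2 * (N (v t))\<^sup>2 + 2 * (N (w t))\<^sup>2)"
      using s(1) r(1)
    proof eventually_elim
      case (elim t)
      have "(N (v t - w t))\<^sup>2 \<le> (N (v t) + N (w t))\<^sup>2"
        by (intro power_mono triangle nonneg diff elim)
      also have "\<dots> \<le> 2 * (N (v t))\<^sup>2 + 2 * (N (w t))\<^sup>2"
        using sum_squares_bound[of "N (v t)" "N (w t)"] by (simp add: power2_sum)
      finally show ?case by simp
    qed
  qed (use m in measurable)
  then show ?thesis
    unfolding bochner_L2_def using X sr srX lim
    by (intro CollectI conjI exI[of _ "\<lambda>k t. s k t - r k t"] allI)
qed

lemma bochner_const:
  assumes "I \<in> lmeasurable" "x \<in> X"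
  shows "(\<lambda>t. x) \<in> bochner_L2 I X N"
proof -
  interpret finite_measure "lebesgue_on I" by (rule finite_measure_lebesgue_on[OF assms(1)])
  show ?thesis
    unfolding bochner_L2_def using assms(2)
    by (intro CollectI conjI exI[of _ "\<lambda>k t. x"]) (simp_all add: norm_self image_subset_iff)
qed

lemma bochner_AE_cong:
  assumes v: "v \<in> bochner_L2 I X N" and I: "I \<in> sets lebesgue"
    and ae: "AE t in lebesgue_on I. v t = w t"
  shows "w \<in> bochner_L2 I X N"
proof -
  obtain s where s: "AE t in lebesgue_on I. v t \<in> X" "\<And>k::nat. simple_function (lebesgue_on I) (s k)"
    "\<And>k. s k ` I \<subseteq> X" "AE t in lebesgue_on I. (\<lambda>k. N (s k t - v t)) \<longlonglongrightarrow> 0"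
    "integrable (lebesgue_on I) (\<lambda>t. (N (v t))\<^sup>2)"
    using v unfolding bochner_L2_def by blast
  have X: "AE t in lebesgue_on I. w t \<in> X" using s(1) ae by eventually_elim simp
  have lim: "AE t in lebesgue_on I. (\<lambda>k. N (s k t - w t)) \<longlonglongrightarrow> 0"
    using s(4) ae by eventually_elim simp
  have m: "(\<lambda>t. N (w t)) \<in> borel_measurable (lebesgue_on I)"
    by (rule norm_measurable[OF I X s(2,3) lim])
  have "integrable (lebesgue_on I) (\<lambda>t. (N (w t))\<^sup>2)"
    by (rule integrable_cong_AE_imp[OF s(5)]) (use m ae in \<open>measurable, auto\<close>)
  then show ?thesis
    unfolding bochner_L2_def using X s(2,3) lim
    by (intro CollectI conjI exI[of _ s] allI)
qed

end

text \<open>The Lipschitz estimate takes the place of linearity of \<open>L\<close>: as a map of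
  representatives, \<open>wgrad\<close> is additive only up to null sets, yet it satisfies this
  estimate.\<close>

lemma bochner_map:
  assumes "seminormed_set X N" "seminormed_set Y N'" and I: "I \<in> sets lebesgue"
    and v: "v \<in> bochner_L2 I X N"
    and LY: "\<And>x. x \<in> X \<Longrightarrow> L x \<in> Y"
    and Ld: "\<And>x x'. x \<in> X \<Longrightarrow> x' \<in> X \<Longrightarrow> N' (L x - L x') \<le> K * N (x - x')"
    and Lb: "\<And>x. x \<in> X \<Longrightarrow> N' (L x) \<le> K * N x"
  shows "(\<lambda>t. L (v t)) \<in> bochner_L2 I Y N'"
proof -
  interpret X: seminormed_set X N by fact
  interpret Y: seminormed_set Y N' by fact
  obtain s where s: "AE t in lebesgue_on I. v t \<in> X" "\<And>k::nat. simple_function (lebesgue_on I) (s k)"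
    "\<And>k. s k ` I \<subseteq> X" "AE t in lebesgue_on I. (\<lambda>k. N (s k t - v t)) \<longlonglongrightarrow> 0"
    "integrable (lebesgue_on I) (\<lambda>t. (N (v t))\<^sup>2)"
    using v unfolding bochner_L2_def by blast
  have Y: "AE t in lebesgue_on I. L (v t) \<in> Y" using s(1) by eventually_elim (rule LY)
  have Ls: "simple_function (lebesgue_on I) (\<lambda>t. L (s k t))" for k
    by (rule simple_function_compose1[OF s(2)])
  have LsY: "(\<lambda>t. L (s k t)) ` I \<subseteq> Y" for k using s(3)[of k] LY by blast
  have lim: "AE t in lebesgue_on I. (\<lambda>k. N' (L (s k t) - L (v t))) \<longlonglongrightarrow> 0"
    using s(1,4) AE_space
  proof eventually_elim
    case (elim t)
    have l: "(\<lambda>k. K * N (s k t - v t)) \<longlonglongrightarrow> 0" by (rule tendsto_mult_right_zero[OF elim(2)])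
    show ?case
    proof (rule Lim_null_comparison[OF always_eventually l], rule allI)
      fix k
      have "s k t \<in> X" using elim(3) s(3)[of k] by auto
      then show "norm (N' (L (s k t) - L (v t))) \<le> K * N (s k t - v t)"
        using Ld[of "s k t" "v t"] Y.nonneg[OF Y.diff[OF LY LY], of "s k t" "v t"] elim(1) by simp
    qed
  qed
  have m: "(\<lambda>t. N' (L (v t))) \<in> borel_measurable (lebesgue_on I)"
    by (rule Y.norm_measurable[OF I Y Ls LsY lim])
  have "integrable (lebesgue_on I) (\<lambda>t. (N' (L (v t)))\<^sup>2)"
  proof (rule Bochner_Integration.integrable_bound)
    show "integrable (lebesgue_on I) (\<lambda>t. K\<^sup>2 * (N (v t))\<^sup>2)" using s(5) by simp
    show "AE t in lebesgue_on I. norm ((N' (L (v t)))\<^sup>2) \<le> norm (K\<^sup>2 * (N (v t))\<^sup>2)"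
      using s(1)
    proof eventually_elim
      case (elim t)
      have "(N' (L (v t)))\<^sup>2 \<le> (K * N (v t))\<^sup>2"
        by (intro power_mono Lb Y.nonneg LY elim)
      then show ?case by (simp add: power_mult_distrib)
    qed
  qed (use m in measurable)
  then show ?thesis
    unfolding bochner_L2_def using Y Ls LsY lim
    by (intro CollectI conjI exI[of _ "\<lambda>k t. L (s k t)"] allI)
qed

text \<open>Measurability by approximating both factors: B(s,r) - B(v,w) = B(s - v, r) + B(v, r -
  w), where the norm of r is at most that of r - w plus that of w. Integrability follows from ab
  \<le> a^2 + b^2 for nonnegative a, b.\<close>

lemma bochner_pairing:
  fixes B :: "('a \<Rightarrow> 'b::ab_group_add) \<Rightarrow> ('c \<Rightarrow> 'd::ab_group_add) \<Rightarrow> real"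
  assumes "seminormed_set X N" "seminormed_set Y N'" and I: "I \<in> sets lebesgue"
    and v: "v \<in> bochner_L2 I X N" and w: "w \<in> bochner_L2 I Y N'"
    and Bl: "\<And>x x' y. x \<in> X \<Longrightarrow> x' \<in> X \<Longrightarrow> y \<in> Y \<Longrightarrow> B (x - x') y = B x y - B x' y"
    and Br: "\<And>x y y'. x \<in> X \<Longrightarrow> y \<in> Y \<Longrightarrow> y' \<in> Y \<Longrightarrow> B x (y - y') = B x y - B x y'"
    and Bb: "\<And>x y. x \<in> X \<Longrightarrow> y \<in> Y \<Longrightarrow> \<bar>B x y\<bar> \<le> N x * N' y"
  shows "integrable (lebesgue_on I) (\<lambda>t. B (v t) (w t))"
proof -
  interpret X: seminormed_set X N by fact
  interpret Y: seminormed_set Y N' by fact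
  obtain s where s: "AE t in lebesgue_on I. v t \<in> X" "\<And>k::nat. simple_function (lebesgue_on I) (s k)"
    "\<And>k. s k ` I \<subseteq> X" "AE t in lebesgue_on I. (\<lambda>k. N (s k t - v t)) \<longlonglongrightarrow> 0"
    "integrable (lebesgue_on I) (\<lambda>t. (N (v t))\<^sup>2)"
    using v unfolding bochner_L2_def by blast
  obtain r where r: "AE t in lebesgue_on I. w t \<in> Y" "\<And>k::nat. simple_function (lebesgue_on I) (r k)"
    "\<And>k. r k ` I \<subseteq> Y" "AE t in lebesgue_on I. (\<lambda>k. N' (r k t - w t)) \<longlonglongrightarrow> 0"
    "integrable (lebesgue_on I) (\<lambda>t. (N' (w t))\<^sup>2)"
    using w unfolding bochner_L2_def by blast
  have m: "(\<lambda>t. B (v t) (w t)) \<in> borel_measurable (lebesgue_on I)"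
  proof (rule borel_measurable_lebesgue_on_AE_limit[OF I])
    show "(\<lambda>t. B (s k t) (r k t)) \<in> borel_measurable (lebesgue_on I)" for k
      by (rule simple_function_borel[OF simple_function_compose2[OF s(2) r(2)]])
    show "AE t in lebesgue_on I. (\<lambda>k. B (s k t) (r k t)) \<longlonglongrightarrow> B (v t) (w t)"
      using s(1,4) r(1,4) AE_space
    proof eventually_elim
      case (elim t)
      have "(\<lambda>k. N (s k t - v t) * (N' (r k t - w t) + N' (w t)) + N (v t) * N' (r k t - w t)) \<longlonglongrightarrow>
        0 * (0 + N' (w t)) + N (v t) * 0"
        by (intro tendsto_add tendsto_mult tendsto_const elim)
      then have l: "(\<lambda>k. N (s k t - v t) * (N' (r k t - w t) + N' (w t)) + N (v t) * N' (r k t - w t)) \<longlonglongrightarrow> 0"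
        by simp
      have "(\<lambda>k. B (s k t) (r k t) - B (v t) (w t)) \<longlonglongrightarrow> 0"
      proof (rule Lim_null_comparison[OF always_eventually l], rule allI)
        fix k
        have sk: "s k t \<in> X" and rk: "r k t \<in> Y" using elim(5) s(3)[of k] r(3)[of k] by auto
        have "B (s k t) (r k t) - B (v t) (w t) = B (s k t - v t) (r k t) + B (v t) (r k t - w t)"
          by (simp add: Bl Br sk rk elim)
        moreover have "\<bar>B (s k t - v t) (r k t)\<bar> \<le> N (s k t - v t) * N' (r k t)"
          by (intro Bb X.diff sk rk elim)
        moreover have "N (s k t - v t) * N' (r k t) \<le> N (s k t - v t) * (N' (r k t - w t) + N' (w t))"
          by (intro mult_left_mono Y.norm_le_add X.nonneg X.diff sk rk elim)
        moreover have "\<bar>B (v t) (r k t - w t)\<bar> \<le> N (v t) * N' (r k t - w t)"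
          by (intro Bb Y.diff rk elim)
        ultimately show "norm (B (s k t) (r k t) - B (v t) (w t)) \<le>
          N (s k t - v t) * (N' (r k t - w t) + N' (w t)) + N (v t) * N' (r k t - w t)"
          unfolding real_norm_def by linarith
      qed
      then show ?case by (rule LIM_zero_cancel)
    qed
  qed
  show ?thesis
  proof (rule Bochner_Integration.integrable_bound[OF _ m])
    show "integrable (lebesgue_on I) (\<lambda>t. (N (v t))\<^sup>2 + (N' (w t))\<^sup>2)"
      using s(5) r(5) by simp
    show "AE t in lebesgue_on I. norm (B (v t) (w t)) \<le> norm ((N (v t))\<^sup>2 + (N' (w t))\<^sup>2)"
      using s(1) r(1)
    proof eventually_elim
      case (elim t)
      have "\<bar>B (v t) (w t)\<bar> \<le> N (v t) * N' (w t)" by (intro Bb elim)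
      also have "\<dots> \<le> (N (v t))\<^sup>2 + (N' (w t))\<^sup>2"
        using sum_squares_bound[of "N (v t)" "N' (w t)"] mult_nonneg_nonneg[OF X.nonneg[OF elim(1)] Y.nonneg[OF elim(2)]]
        unfolding mult.assoc by linarith
      finally show ?case by simp
    qed
  qed
qed

lemma bochner_L2_mono:
  "X \<subseteq> X' \<Longrightarrow> v \<in> bochner_L2 I X N \<Longrightarrow> v \<in> bochner_L2 I X' N"
  unfolding bochner_L2_def by (auto elim!: eventually_mono) blast

lemma seminormed_set_L2: "seminormed_set (L2 \<Omega>) (L2_norm \<Omega>)"
proof
  show "L2_norm \<Omega> (\<lambda>_. 0) = 0" by (simp add: L2_norm_def)
qed (simp_all add: L2_zero fun_diff_def L2_diff L2_norm_nonneg L2_norm_triangle_diff)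

context bounded_open
begin

lemma seminormed_set_W12_0: "seminormed_set (W12_0 \<Omega>) (W12_norm \<Omega>)"
  by standard (simp_all add: W12_0_zero W12_norm_zero fun_diff_def W12_0_diff W12_norm_nonneg
      W12_norm_triangle_diff W12_0_W12)

lemma seminormed_set_W12_dual: "seminormed_set (W12_dual \<Omega>) (dual_norm \<Omega>)"
proof
  show "(\<lambda>_. 0) \<in> W12_dual \<Omega>"
    unfolding W12_dual_def by (auto intro!: exI[of _ 0])
  show "dual_norm \<Omega> (\<lambda>_. 0) = 0"
    unfolding dual_norm_def using W12_0_zero W12_norm_zero by (subst cSUP_const) auto
qed (simp_all add: fun_diff_def dual_minus dual_norm_nonneg)

lemma bochner_wgrad:
  assumes "I \<in> sets lebesgue" "v \<in> bochner_L2 I (W12_0 \<Omega>) (W12_norm \<Omega>)"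
  shows "(\<lambda>t. wgrad \<Omega> (v t)) \<in> bochner_L2 I (L2 \<Omega>) (L2_norm \<Omega>)"
proof (rule bochner_map[OF seminormed_set_W12_0 seminormed_set_L2 assms, where K = 1])
  fix x x' assume x: "x \<in> W12_0 \<Omega>" "x' \<in> W12_0 \<Omega>"
  show "L2_norm \<Omega> (wgrad \<Omega> x - wgrad \<Omega> x') \<le> 1 * W12_norm \<Omega> (x - x')"
    using wgrad_norm_diff[OF x[THEN W12_0_W12]] wgrad_norm_le_W12_norm[of "\<lambda>t. x t - x' t"]
    by (simp add: fun_diff_def)
qed (simp_all add: wgrad_norm_le_W12_norm wgrad(1) W12_0_W12)

lemma bochner_dual_pairing:
  assumes "I \<in> sets lebesgue" "g \<in> bochner_L2 I (W12_dual \<Omega>) (dual_norm \<Omega>)"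
    "v \<in> bochner_L2 I (W12_0 \<Omega>) (W12_norm \<Omega>)"
  shows "integrable (lebesgue_on I) (\<lambda>t. g t (v t))"
  by (rule bochner_pairing[OF seminormed_set_W12_dual seminormed_set_W12_0 assms, where B = "\<lambda>F x. F x"])
    (simp_all add: fun_diff_def dual_diff dual_norm_bound)

end

lemma bochner_L2_inner:
  assumes "I \<in> sets lebesgue" "v \<in> bochner_L2 I (L2 \<Omega>) (L2_norm \<Omega>)"
    "w \<in> bochner_L2 I (L2 \<Omega>) (L2_norm \<Omega>)"
  shows "integrable (lebesgue_on I) (\<lambda>t. L2_inner \<Omega> (v t) (w t))"
  by (rule bochner_pairing[OF seminormed_set_L2 seminormed_set_L2 assms])
    (simp_all add: fun_diff_def L2_inner_diff_left L2_inner_diff_right L2_Cauchy_Schwarz)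

lemma bochner_linear:
  fixes L :: "'b::euclidean_space \<Rightarrow> 'c::euclidean_space" and v :: "real \<Rightarrow> 'a::euclidean_space \<Rightarrow> 'b"
  assumes I: "I \<in> sets lebesgue" and v: "v \<in> bochner_L2 I (L2 \<Omega>) (L2_norm \<Omega>)" and L: "linear L"
  shows "(\<lambda>t x. L (v t x)) \<in> bochner_L2 I (L2 \<Omega>) (L2_norm \<Omega>)"
proof -
  obtain K where K: "\<And>x. norm (L x) \<le> norm x * K"
    using bounded_linear.bounded[OF linear_conv_bounded_linear[THEN iffD1, OF L]] by blast
  have K': "norm (L x) \<le> \<bar>K\<bar> * norm x" for x
    using K[of x] mult_left_mono[OF abs_ge_self[of K] norm_ge_zero[of x]] by (simp only: mult.commute)
  have b: "L2_norm \<Omega> (\<lambda>x. L (u x)) \<le> \<bar>K\<bar> * L2_norm \<Omega> u" if u: "u \<in> L2 \<Omega>" for u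
  proof (rule power2_le_imp_le)
    have "(L2_norm \<Omega> (\<lambda>x. L (u x)))\<^sup>2 \<le> (LINT x|lebesgue_on \<Omega>. K\<^sup>2 * (norm (u x))\<^sup>2)"
      unfolding L2_norm_sq
    proof (rule integral_mono[OF L2_integrable_norm_sq[OF L2_linear[OF u L]]])
      show "integrable (lebesgue_on \<Omega>) (\<lambda>x. K\<^sup>2 * (norm (u x))\<^sup>2)" using L2_integrable_norm_sq[OF u] by simp
      fix x
      have "(norm (L (u x)))\<^sup>2 \<le> (\<bar>K\<bar> * norm (u x))\<^sup>2" by (intro power_mono K') simp
      then show "(norm (L (u x)))\<^sup>2 \<le> K\<^sup>2 * (norm (u x))\<^sup>2" by (simp add: power_mult_distrib)
    qed
    also have "\<dots> = (\<bar>K\<bar> * L2_norm \<Omega> u)\<^sup>2" by (simp add: L2_norm_sq power_mult_distrib)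
    finally show "(L2_norm \<Omega> (\<lambda>x. L (u x)))\<^sup>2 \<le> (\<bar>K\<bar> * L2_norm \<Omega> u)\<^sup>2" .
  qed (simp add: L2_norm_nonneg)
  show ?thesis
  proof (rule bochner_map[OF seminormed_set_L2 seminormed_set_L2 I v, where K = "\<bar>K\<bar>" and L = "\<lambda>u x. L (u x)"])
    fix x x' :: "'a \<Rightarrow> 'b" assume x: "x \<in> L2 \<Omega>" "x' \<in> L2 \<Omega>"
    show "L2_norm \<Omega> ((\<lambda>t. L (x t)) - (\<lambda>t. L (x' t))) \<le> \<bar>K\<bar> * L2_norm \<Omega> (x - x')"
      using b[OF L2_diff[OF x]] by (simp add: fun_diff_def linear_diff[OF L])
  qed (simp_all add: b L2_linear L)
qed

subsection \<open>The energy identity in the evolution triple\<close>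

text \<open>The end points join the exceptional set, so that good times of the open interval have
  full measure in the closed one.\<close>

lemma negligible_interval_Diff:
  assumes "AE t in lebesgue_on {0<..<T}. Q t"
  shows "negligible ({0..T::real} - {t \<in> {0<..<T}. Q t})"
proof -
  have "AE t in lebesgue. t \<in> {0<..<T} \<longrightarrow> Q t"
    using assms by (subst (asm) AE_restrict_space_iff) auto
  then have "{t. \<not> (t \<in> {0<..<T} \<longrightarrow> Q t)} \<in> null_sets lebesgue"
    by (simp add: completion.AE_iff_null_sets)
  then have "negligible ({t. \<not> (t \<in> {0<..<T} \<longrightarrow> Q t)} \<union> {0, T})"
    by (intro negligible_Un) (auto simp: negligible_iff_null_sets)
  then show ?thesis
    by (rule negligible_subset) auto
qed

lemma integrable_lebesgue_on_imp_integrable_on: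
  fixes f :: "real \<Rightarrow> real"
  assumes f: "integrable (lebesgue_on {0<..<T}) f" and s: "0 \<le> s" "t \<le> T"
  shows "f integrable_on {s..t}"
proof -
  have "f integrable_on {0<..<T}" by (rule integrable_on_lebesgue_on[OF f]) auto
  then have "f integrable_on {0..T}" by (simp add: integrable_on_open_interval_real)
  then show ?thesis by (rule integrable_subinterval_real) (use s in auto)
qed

lemma LINT_open_interval_eq:
  fixes f :: "real \<Rightarrow> real"
  assumes f: "integrable (lebesgue_on {0<..<T}) f"
  shows "(LINT t|lebesgue_on {0<..<T}. f t) = integral {0..T} f"
  using lebesgue_integral_eq_integral[OF f] integral_open_interval_real[of 0 T f] by simp

lemma integral_interval_diff:
  fixes f :: "real \<Rightarrow> real"
  assumes f: "integrable (lebesgue_on {0<..<T}) f" and s: "0 \<le> s" "s \<le> t" "t \<le> T"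
  shows "integral {0..t} f - integral {0..s} f = integral {s..t} f"
  using Henstock_Kurzweil_Integration.integral_combine[of 0 s t f]
    integrable_lebesgue_on_imp_integrable_on[OF f, of 0 t] s by simp

text \<open>Otherwise \<open>h\<close> would be positive almost everywhere on the interval and yet
  have integral 0. The lemma puts partition points into a set of full measure and at the same time
  where an error is at most its average.\<close>

lemma exists_le_average:
  fixes f :: "real \<Rightarrow> real"
  assumes f: "integrable (lebesgue_on {0<..<T}) f" and ab: "0 \<le> a" "a < b" "b \<le> T"
    and E: "negligible ({0..T} - P)"
  obtains p where "p \<in> P" "a < p" "p < b" "(b - a) * f p \<le> integral {a..b} f"
proof (rule ccontr)
  assume no: "\<not> thesis"
  let ?M = "lebesgue_on {a<..<b}"
  have fi: "integrable ?M f"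
    by (rule integrable_lebesgue_on_subset[OF f]) (use ab in auto)
  interpret finite_measure ?M
    by (rule finite_measure_lebesgue_on) (metis box_real(1) lmeasurable_box)
  have c: "(LINT t|?M. f t) = integral {a..b} f"
    using lebesgue_integral_eq_integral[OF fi] integral_open_interval_real[of a b f] by simp
  define h where "h t = (b - a) * f t - integral {a..b} f" for t
  have hi: "integrable ?M h" unfolding h_def using fi by simp
  have m: "measure ?M {a<..<b} = b - a"
    using ab by (simp add: measure_restrict_space)
  have "(LINT t|?M. h t) = 0"
    unfolding h_def using fi by (simp add: c m)
  have "AE t in lebesgue. t \<notin> {0..T} - P"
    using E by (intro AE_not_in) (simp add: negligible_iff_null_sets)
  then have "AE t in ?M. t \<notin> {0..T} - P"
    by (subst AE_restrict_space_iff) (auto elim!: eventually_mono)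
  then have pos: "AE t in ?M. 0 < h t"
    using AE_space
  proof eventually_elim
    case (elim t)
    then have t: "t \<in> P" "a < t" "t < b" using ab by auto
    show ?case
    proof (rule ccontr)
      assume "\<not> 0 < h t"
      then have "(b - a) * f t \<le> integral {a..b} f" by (simp add: h_def)
      then show False using no that[OF t] by blast
    qed
  qed
  then have "AE t in ?M. 0 \<le> h t" by eventually_elim simp
  then have "AE t in ?M. h t = 0"
    using integral_nonneg_eq_0_iff_AE[OF hi] \<open>(LINT t|?M. h t) = 0\<close> by simp
  with pos have "AE t in ?M. False" by eventually_elim simp
  moreover have "{t \<in> space ?M. \<not> False} = space ?M" by blast
  ultimately have "emeasure ?M (space ?M) = 0"
    by (intro AE_iff_measurable[where P = "\<lambda>_. False", THEN iffD1] sets.top)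
  then have "measure ?M {a<..<b} = 0" by (simp add: measure_def)
  then show False using m ab by simp
qed

lemma conull_dense:
  assumes T: "0 < T" and P: "negligible ({0..T::real} - P)"
  shows "{0..T} \<subseteq> closure P"
proof
  fix t assume t: "t \<in> {0..T}"
  show "t \<in> closure P"
    unfolding closure_approachable
  proof (intro allI impI)
    fix e :: real assume e: "0 < e"
    define a where "a = max 0 (t - e / 2)"
    define b where "b = min T (t + e / 2)"
    have ab: "0 \<le> a" "a < b" "b \<le> T" using t e T unfolding a_def b_def by auto
    \<comment> \<open>For the zero function the averaging lemma yields just a point of
      \<open>P\<close> in the interval.\<close>
    have "integrable (lebesgue_on {0<..<T}) (\<lambda>_. 0::real)" by simp
    then obtain p where "p \<in> P" "a < p" "p < b"
      using exists_le_average[OF _ ab P] by blast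
    then have "p \<in> P" "dist p t < e" using e unfolding a_def b_def dist_real_def by auto
    then show "\<exists>y\<in>P. dist y t < e" by blast
  qed
qed

text \<open>Membership of \<open>v t\<close> and \<open>g t\<close> is demanded at every time, which
  avoids carrying a null set through all pointwise estimates; \<open>energy_identity\<close> later
  arranges this by changing representatives.\<close>

locale evolution = bounded_open \<Omega> for \<Omega> :: "(real^'n) set" +
  fixes T :: real and v :: "real \<Rightarrow> real^'n \<Rightarrow> real^'n" and g :: "real \<Rightarrow> (real^'n \<Rightarrow> real^'n) \<Rightarrow> real"
  assumes T: "0 < T"
    and v_mem: "v t \<in> W12_0 \<Omega>" and g_mem: "g t \<in> W12_dual \<Omega>"
    and v_L2V: "v \<in> bochner_L2 {0<..<T} (W12_0 \<Omega>) (W12_norm \<Omega>)"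
    and g_L2V: "g \<in> bochner_L2 {0<..<T} (W12_dual \<Omega>) (dual_norm \<Omega>)"
    and time_deriv: "is_time_deriv T \<Omega> v g"
begin

abbreviation "M \<equiv> lebesgue_on {0<..<T}"
abbreviation "V \<equiv> W12_0 \<Omega>"
abbreviation "N \<equiv> W12_norm \<Omega>"
abbreviation "ip \<equiv> L2_inner \<Omega>"
abbreviation "nH \<equiv> L2_norm \<Omega>"
abbreviation "m t \<equiv> dual_norm \<Omega> (g t)"

interpretation NV: seminormed_set V N by (rule seminormed_set_W12_0)

lemma I_sets: "{0<..<T} \<in> sets lebesgue" by simp

lemma I_lmeasurable: "{0<..<T} \<in> lmeasurable" by (metis box_real(1) lmeasurable_box)

lemma v_L2: "v t \<in> L2 \<Omega>" by (rule W12_0_L2[OF v_mem])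

lemma g_bound: "x \<in> V \<Longrightarrow> \<bar>g t x\<bar> \<le> m t * N x" by (rule dual_norm_bound[OF g_mem])

lemma m_nonneg: "0 \<le> m t" by (rule dual_norm_nonneg[OF g_mem])

lemma m_sq_integrable: "integrable M (\<lambda>t. (m t)\<^sup>2)"
  using g_L2V unfolding bochner_L2_def by blast

lemma n_sq_integrable: "integrable M (\<lambda>t. (N (v t))\<^sup>2)"
  using v_L2V unfolding bochner_L2_def by blast

lemma g_integrable: "x \<in> V \<Longrightarrow> integrable M (\<lambda>t. g t x)"
  by (rule bochner_dual_pairing[OF I_sets g_L2V NV.bochner_const[OF I_lmeasurable]])

lemma gv_integrable: "integrable M (\<lambda>t. g t (v t))"
  by (rule bochner_dual_pairing[OF I_sets g_L2V v_L2V])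

lemma ip_integrable: "x \<in> V \<Longrightarrow> integrable M (\<lambda>t. ip (v t) x)"
proof -
  assume x: "x \<in> V"
  have v: "v \<in> bochner_L2 {0<..<T} (L2 \<Omega>) nH"
    by (rule bochner_map[OF seminormed_set_W12_0 seminormed_set_L2 I_sets v_L2V, where K = 1 and L = "\<lambda>x. x"])
      (simp_all add: W12_0_L2 L2_norm_le_W12_norm)
  show ?thesis
    by (rule bochner_L2_inner[OF I_sets v seminormed_set.bochner_const[OF seminormed_set_L2 I_lmeasurable W12_0_L2[OF x]]])
qed

text \<open>The integrand dominates both \<open>m t\<close> and its square, so one constant bounds
  the linear and the quadratic estimates.\<close>

definition mass :: real where "mass = integral {0..T} (\<lambda>t. 1 + (m t)\<^sup>2)"

lemma one_m_sq_integrable: "integrable M (\<lambda>t. 1 + (m t)\<^sup>2)"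
proof -
  interpret finite_measure M by (rule finite_measure_lebesgue_on[OF I_lmeasurable])
  show ?thesis using m_sq_integrable by simp
qed

lemma mass_nonneg: "0 \<le> mass"
  unfolding mass_def by (rule integral_nonneg[OF integrable_lebesgue_on_imp_integrable_on[OF one_m_sq_integrable]]) auto

text \<open>Continuity in \<open>x\<close>, uniformly in time: it allows the limit in the test
  element when the values of simple functions approach a value of \<open>v\<close>.\<close>

lemma indefinite_bound:
  assumes x: "x \<in> V" and t: "t \<in> {0..T}"
  shows "\<bar>integral {0..t} (\<lambda>r. g r x)\<bar> \<le> mass * N x"
proof -
  have b: "\<bar>g r x\<bar> \<le> (1 + (m r)\<^sup>2) * N x" for r
  proof -
    have "m r \<le> 1 + (m r)\<^sup>2"
      using sum_squares_bound[of 1 "m r"] m_nonneg[of r] by simp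
    then have "m r * N x \<le> (1 + (m r)\<^sup>2) * N x" by (rule mult_right_mono[OF _ W12_norm_nonneg])
    then show ?thesis using g_bound[OF x, of r] by linarith
  qed
  have i: "(\<lambda>r. (1 + (m r)\<^sup>2) * N x) integrable_on {0..T}"
    by (rule integrable_lebesgue_on_imp_integrable_on) (use one_m_sq_integrable in auto)
  then have i': "(\<lambda>r. (1 + (m r)\<^sup>2) * N x) integrable_on {0..t}"
    by (rule integrable_subinterval_real) (use t in auto)
  have "norm (integral {0..t} (\<lambda>r. g r x)) \<le> integral {0..t} (\<lambda>r. (1 + (m r)\<^sup>2) * N x)"
    by (rule integral_norm_bound_integral[OF integrable_lebesgue_on_imp_integrable_on[OF g_integrable[OF x]] i'])
      (use t b in auto)
  also have "\<dots> \<le> integral {0..T} (\<lambda>r. (1 + (m r)\<^sup>2) * N x)"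
    by (rule integral_subset_le[OF _ i' i]) (use t in \<open>auto intro!: mult_nonneg_nonneg W12_norm_nonneg\<close>)
  also have "\<dots> = mass * N x" by (simp add: mass_def)
  finally show ?thesis by simp
qed

text \<open>Du Bois-Reymond's null set depends on the test element. Only the countable set
  \<open>D\<close> of values of the approximating simple functions is used, which leaves one null
  set; \<open>P\<close> also requires these functions to converge at the time in question. The
  identity is continuous in the test element, so it extends from \<open>S k \<tau>\<close> to
  \<open>v \<tau>\<close>.\<close>

lemma exists_good_set:
  obtains P where "P \<subseteq> {0<..<T}" "negligible ({0..T} - P)"
    "\<And>s t \<tau>. s \<in> P \<Longrightarrow> t \<in> P \<Longrightarrow> \<tau> \<in> P \<Longrightarrow> s \<le> t \<Longrightarrow>
      ip (v t) (v \<tau>) - ip (v s) (v \<tau>) = integral {s..t} (\<lambda>r. g r (v \<tau>))"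
proof -
  obtain S where S: "\<And>k::nat. simple_function M (S k)" "\<And>k. S k ` {0<..<T} \<subseteq> V"
    "AE t in M. (\<lambda>k. N (S k t - v t)) \<longlonglongrightarrow> 0"
    using v_L2V unfolding bochner_L2_def by blast
  have "\<exists>c. AE t in M. ip (v t) w = c + integral {0..t} (\<lambda>r. g r w)" if w: "w \<in> V" for w
  proof (rule weak_deriv_imp_AE_indefinite_integral[OF T ip_integrable[OF w] g_integrable[OF w]])
    fix \<phi> :: "real \<Rightarrow> real" assume "\<phi> \<in> test_funs {0<..<T}"
    then show "(LINT t|M. deriv \<phi> t * ip (v t) w) = - (LINT t|M. \<phi> t * g t w)"
      using time_deriv w unfolding is_time_deriv_def by blast
  qed blast
  then have "\<forall>w\<in>V. \<exists>c. AE t in M. ip (v t) w = c + integral {0..t} (\<lambda>r. g r w)" by blast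
  from bchoice[OF this] obtain c
    where c: "\<forall>w\<in>V. AE t in M. ip (v t) w = c w + integral {0..t} (\<lambda>r. g r w)" ..
  define D where "D = (\<Union>k. S k ` {0<..<T})"
  have D: "countable D" "D \<subseteq> V"
  proof -
    have "finite (S k ` {0<..<T})" for k
      using S(1)[of k] by (simp add: simple_function_def)
    then show "countable D" unfolding D_def by (intro countable_UN) (auto intro: countable_finite)
    show "D \<subseteq> V" unfolding D_def using S(2) by blast
  qed
  have "AE t in M. \<forall>w\<in>D. ip (v t) w = c w + integral {0..t} (\<lambda>r. g r w)"
    by (subst AE_ball_countable[OF D(1)]) (use c D(2) in blast)
  then have ae: "AE t in M. (\<forall>w\<in>D. ip (v t) w = c w + integral {0..t} (\<lambda>r. g r w)) \<and> (\<lambda>k. N (S k t - v t)) \<longlonglongrightarrow> 0"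
    using S(3) by eventually_elim blast
  define P where "P = {t \<in> {0<..<T}. (\<forall>w\<in>D. ip (v t) w = c w + integral {0..t} (\<lambda>r. g r w)) \<and> (\<lambda>k. N (S k t - v t)) \<longlonglongrightarrow> 0}"
  show thesis
  proof (rule that[of P])
    show "P \<subseteq> {0<..<T}" unfolding P_def by blast
    show "negligible ({0..T} - P)" unfolding P_def by (rule negligible_interval_Diff[OF ae])
    fix s t \<tau> assume st: "s \<in> P" "t \<in> P" "\<tau> \<in> P" "s \<le> t"
    then have I: "s \<in> {0<..<T}" "t \<in> {0<..<T}" "\<tau> \<in> {0<..<T}" unfolding P_def by auto
    \<comment> \<open>The defect of the claimed identity as a function of the test element; in the
      difference of two times the constant \<open>c w\<close> cancels.\<close>
    define \<Delta> where "\<Delta> w = ip (v t) w - ip (v s) w - (integral {0..t} (\<lambda>r. g r w) - integral {0..s} (\<lambda>r. g r w))" for w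
    have \<Delta>S: "\<Delta> (S k \<tau>) = 0" for k
    proof -
      have "S k \<tau> \<in> D" unfolding D_def using I by blast
      then show ?thesis using st unfolding P_def \<Delta>_def by simp
    qed
    have \<Delta>d: "\<Delta> (x - y) = \<Delta> x - \<Delta> y" if x: "x \<in> V" and y: "y \<in> V" for x y
    proof -
      have "integral {0..u} (\<lambda>r. g r (x - y)) = integral {0..u} (\<lambda>r. g r x) - integral {0..u} (\<lambda>r. g r y)"
        if "u \<le> T" for u
        using that dual_diff[OF g_mem x y]
          Henstock_Kurzweil_Integration.integral_diff[of "\<lambda>r. g r x" "{0..u}" "\<lambda>r. g r y"]
          integrable_lebesgue_on_imp_integrable_on[OF g_integrable[OF x], of 0 u]
          integrable_lebesgue_on_imp_integrable_on[OF g_integrable[OF y], of 0 u]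
        by (simp add: fun_diff_def)
      moreover have "ip (v u) (x - y) = ip (v u) x - ip (v u) y" for u
        using L2_inner_diff_right[OF W12_0_L2[OF x] W12_0_L2[OF y] v_L2] by (simp add: fun_diff_def)
      ultimately show ?thesis using I unfolding \<Delta>_def by simp
    qed
    have ipb: "\<bar>ip (v u) x\<bar> \<le> nH (v u) * N x" if x: "x \<in> V" for u x
      using L2_Cauchy_Schwarz[OF v_L2 W12_0_L2[OF x], of u]
        mult_left_mono[OF L2_norm_le_W12_norm[of x] L2_norm_nonneg[of \<Omega> "v u"]] by linarith
    define C where "C = nH (v t) + nH (v s) + 2 * mass"
    have \<Delta>b: "\<bar>\<Delta> x\<bar> \<le> C * N x" if x: "x \<in> V" for x
      using ipb[OF x, of t] ipb[OF x, of s] indefinite_bound[OF x, of t] indefinite_bound[OF x, of s] I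
      unfolding \<Delta>_def C_def by (simp add: distrib_right)
    have "(\<lambda>k. N (S k \<tau> - v \<tau>)) \<longlonglongrightarrow> 0" using st unfolding P_def by blast
    then have l: "(\<lambda>k. C * N (S k \<tau> - v \<tau>)) \<longlonglongrightarrow> 0" by (rule tendsto_mult_right_zero)
    have "\<bar>\<Delta> (v \<tau>)\<bar> \<le> C * N (S k \<tau> - v \<tau>)" for k
    proof -
      have Sk: "S k \<tau> \<in> V" using S(2)[of k] I by blast
      have "\<Delta> (S k \<tau> - v \<tau>) = - \<Delta> (v \<tau>)" using \<Delta>d[OF Sk v_mem] \<Delta>S by simp
      then show ?thesis using \<Delta>b[OF NV.diff[OF Sk v_mem], of \<tau>] by simp
    qed
    then have "\<bar>\<Delta> (v \<tau>)\<bar> \<le> 0"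
      by (intro LIMSEQ_le_const[OF l]) blast
    then show "ip (v t) (v \<tau>) - ip (v s) (v \<tau>) = integral {s..t} (\<lambda>r. g r (v \<tau>))"
      using integral_interval_diff[OF g_integrable[OF v_mem], of s t \<tau>] I st(4) unfolding \<Delta>_def by simp
  qed
qed

text \<open>A quantitative Lusin property: off a small set \<open>v\<close> is uniformly close to finitely many values
  that are selected by a continuous function.\<close>

lemma approx_modulus:
  assumes \<epsilon>: "0 < \<epsilon>"
  obtains \<rho> \<delta> where "0 < \<delta>" "\<And>t. 0 \<le> \<rho> t" "integrable M (\<lambda>t. (\<rho> t)\<^sup>2)" "integral {0..T} (\<lambda>t. (\<rho> t)\<^sup>2) \<le> \<epsilon>"
    "\<And>s t. s \<in> {0<..<T} \<Longrightarrow> t \<in> {0<..<T} \<Longrightarrow> \<bar>t - s\<bar> < \<delta> \<Longrightarrow> N (v t - v s) \<le> \<rho> t + \<rho> s"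
proof -
  interpret finite_measure M by (rule finite_measure_lebesgue_on[OF I_lmeasurable])
  obtain S0 where S0: "\<And>k::nat. simple_function M (S0 k)" "\<And>k. S0 k ` {0<..<T} \<subseteq> V"
    "AE t in M. (\<lambda>k. N (S0 k t - v t)) \<longlonglongrightarrow> 0"
    using v_L2V unfolding bochner_L2_def by blast
  have nm[measurable]: "(\<lambda>t. N (v t)) \<in> borel_measurable M"
    by (rule NV.bochner_norm_measurable[OF I_sets v_L2V])
  \<comment> \<open>Values of norm above \<open>2 * N (v t)\<close> are replaced by 0. This bounds
    the error by \<open>3 * N (v t)\<close> and so supplies a majorant for dominated
    convergence.\<close>
  define S where "S k t = (if N (S0 k t) \<le> 2 * N (v t) then S0 k t else (\<lambda>_. 0))" for k t
  have S_simple: "simple_function M (S k)" for k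
  proof -
    have [measurable]: "(\<lambda>t. N (S0 k t)) \<in> borel_measurable M"
      by (rule simple_function_borel[OF simple_function_compose1[OF S0(1)]])
    have "{t \<in> space M. N (S0 k t) \<le> 2 * N (v t)} \<in> sets M" by measurable
    then show ?thesis
      unfolding S_def by (intro simple_function_If S0 simple_function_const)
  qed
  have SV: "S k t \<in> V" if "t \<in> {0<..<T}" for k t
    using S0(2)[of k] that W12_0_zero unfolding S_def by auto
  have SN: "N (S k t) \<le> 2 * N (v t)" for k t
    unfolding S_def using W12_norm_nonneg[of "v t"] W12_norm_zero by simp
  have vSm: "(\<lambda>t. N (v t - S k t)) \<in> borel_measurable M" for k
  proof -
    have "S k \<in> bochner_L2 {0<..<T} V N"
      unfolding bochner_L2_def
    proof (intro CollectI conjI exI[of _ "\<lambda>_. S k"] allI)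
      show "AE t in M. S k t \<in> V" by (rule AE_I2) (simp add: SV)
      show "integrable M (\<lambda>t. (N (S k t))\<^sup>2)"
      proof (rule Bochner_Integration.integrable_bound)
        show "integrable M (\<lambda>t. 4 * (N (v t))\<^sup>2)" using n_sq_integrable by simp
        show "(\<lambda>t. (N (S k t))\<^sup>2) \<in> borel_measurable M"
          by (rule simple_function_borel[OF simple_function_compose1[OF S_simple]])
        show "AE t in M. norm ((N (S k t))\<^sup>2) \<le> norm (4 * (N (v t))\<^sup>2)"
        proof (rule AE_I2)
          fix t
          have "(N (S k t))\<^sup>2 \<le> (2 * N (v t))\<^sup>2"
            by (intro power_mono SN W12_norm_nonneg)
          then show "norm ((N (S k t))\<^sup>2) \<le> norm (4 * (N (v t))\<^sup>2)" by (simp add: power_mult_distrib)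
        qed
      qed
    qed (use S_simple SV in \<open>auto simp: NV.norm_self\<close>)
    then show ?thesis
      by (intro NV.bochner_norm_measurable[OF I_sets] NV.bochner_diff[OF I_sets] v_L2V)
  qed
  have vSb: "N (v t - S k t) \<le> 3 * N (v t)" if "t \<in> {0<..<T}" for k t
    using NV.triangle[OF v_mem SV[OF that], of t k] SN[of k t] by simp
  have lim: "AE t in M. (\<lambda>k. N (v t - S k t)) \<longlonglongrightarrow> 0"
    using S0(3) AE_space
  proof eventually_elim
    case (elim t)
    then have t: "t \<in> {0<..<T}" by simp
    \<comment> \<open>Where \<open>N (v t)\<close> is positive, the truncation is eventually
      inactive; where it is 0, the bound \<open>vSb\<close> alone forces the error to be 0.\<close>
    show ?case
    proof (cases "N (v t) = 0")
      case True
      then have "N (v t - S k t) = 0" for k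
        using vSb[OF t, of k] NV.nonneg[OF NV.diff[OF v_mem SV[OF t]], of t k] by simp
      then show ?thesis by simp
    next
      case False
      then have p: "0 < N (v t)" using W12_norm_nonneg[of "v t"] by simp
      have ev: "eventually (\<lambda>k. N (S0 k t - v t) < N (v t)) sequentially"
        by (rule order_tendstoD(2)[OF elim(1) p])
      show ?thesis
      proof (rule Lim_transform_eventually[OF elim(1)], rule eventually_mono[OF ev])
        fix k assume k: "N (S0 k t - v t) < N (v t)"
        have S0V: "S0 k t \<in> V" using S0(2)[of k] t by blast
        have "N (S0 k t) \<le> N (S0 k t - v t) + N (v t)" by (rule NV.norm_le_add[OF S0V v_mem])
        then have "S k t = S0 k t" using k unfolding S_def by simp
        then show "N (S0 k t - v t) = N (v t - S k t)"
          using NV.norm_minus_commute[OF S0V v_mem] by simp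
      qed
    qed
  qed
  have "(\<lambda>k. LINT t|M. (N (v t - S k t))\<^sup>2) \<longlonglongrightarrow> (LINT t|M. 0)"
  proof (rule integral_dominated_convergence)
    show "integrable M (\<lambda>t. 9 * (N (v t))\<^sup>2)" using n_sq_integrable by simp
    show "AE t in M. (\<lambda>k. (N (v t - S k t))\<^sup>2) \<longlonglongrightarrow> 0"
      using lim by eventually_elim (auto intro: tendsto_eq_intros)
    show "AE t in M. norm ((N (v t - S k t))\<^sup>2) \<le> 9 * (N (v t))\<^sup>2" for k
    proof (rule AE_I2)
      fix t assume t: "t \<in> space M"
      have "(N (v t - S k t))\<^sup>2 \<le> (3 * N (v t))\<^sup>2"
        using t by (intro power_mono vSb W12_norm_nonneg) simp
      then show "norm ((N (v t - S k t))\<^sup>2) \<le> 9 * (N (v t))\<^sup>2" by (simp add: power_mult_distrib)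
    qed
  qed (use vSm in measurable)
  \<comment> \<open>Squaring the two-term \<rho> below costs a factor 2, so a quarter of \<epsilon>
    here, and a quarter divided by \<open>K\<^sup>2\<close> for the bad set, leave half of
    \<epsilon> for each term.\<close>
  then have "eventually (\<lambda>k. (LINT t|M. (N (v t - S k t))\<^sup>2) < \<epsilon> / 4) sequentially"
    using \<epsilon> by (intro order_tendstoD(2)) auto
  then obtain k where k: "(LINT t|M. (N (v t - S k t))\<^sup>2) < \<epsilon> / 4"
    by (auto simp: eventually_sequentially)
  define A where "A = S k ` {0<..<T}"
  have A: "finite A" "A \<subseteq> V"
    using S_simple[of k] SV unfolding A_def by (auto simp: simple_function_def)
  \<comment> \<open>A bound for the distance of any two values of the simple function; the 1 keeps
    it positive.\<close>
  define K where "K = 1 + (\<Sum>x\<in>A. \<Sum>y\<in>A. N (x - y))"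
  have Nxy: "0 \<le> N (x - y)" for x y by (rule W12_norm_nonneg)
  have K: "0 < K" "\<And>x y. x \<in> A \<Longrightarrow> y \<in> A \<Longrightarrow> N (x - y) \<le> K"
  proof -
    have "0 \<le> (\<Sum>x\<in>A. \<Sum>y\<in>A. N (x - y))" by (intro sum_nonneg Nxy)
    then show "0 < K" unfolding K_def by simp
    fix x y assume xy: "x \<in> A" "y \<in> A"
    have "N (x - y) \<le> (\<Sum>y\<in>A. N (x - y))" by (rule member_le_sum[OF xy(2) Nxy A(1)])
    also have "\<dots> \<le> (\<Sum>x\<in>A. \<Sum>y\<in>A. N (x - y))"
      by (rule member_le_sum[OF xy(1) _ A(1)]) (intro sum_nonneg Nxy)
    finally show "N (x - y) \<le> K" unfolding K_def by simp
  qed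
  \<comment> \<open>The finitely many values get distinct integer codes, so that the simple function
    is represented by the real function \<open>q\<close>, to which continuous approximation
    applies.\<close>
  obtain \<iota> :: "(real^'n \<Rightarrow> real^'n) \<Rightarrow> nat" where \<iota>: "inj_on \<iota> A"
    using finite_imp_inj_to_nat_seg[OF A(1)] by blast
  define q where "q t = real (\<iota> (S k t))" for t
  have qm: "q \<in> borel_measurable M"
    unfolding q_def by (rule simple_function_borel[OF simple_function_compose1[OF S_simple]])
  \<comment> \<open>By definition \<open>measurable_on\<close> provides continuous functions
    converging off a negligible set, which takes the place of Lusin's theorem.\<close>
  then have "q measurable_on {0<..<T}"
    by (simp add: measurable_on_iff_borel_measurable)
  then obtain E h where E: "negligible E" and h: "\<And>j::nat. continuous_on UNIV (h j)"
    and hq: "\<And>t. t \<notin> E \<Longrightarrow> (\<lambda>j. h j t) \<longlonglongrightarrow> (if t \<in> {0<..<T} then q t else 0)"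
    unfolding measurable_on_def by blast
  \<comment> \<open>Off this set two errors below 1/4 and an oscillation of \<open>h j\<close> below
    1/4 add up to less than 1, so the integer codes at two nearby times coincide.\<close>
  define B where "B j = {t. 1/4 \<le> \<bar>h j t - q t\<bar>}" for j
  have hm: "h j \<in> borel_measurable M" for j
    by (rule continuous_imp_measurable_on_sets_lebesgue[OF continuous_on_subset[OF h subset_UNIV] I_sets])
  have Bm: "(\<lambda>t. indicator (B j) t :: real) \<in> borel_measurable M" for j
  proof -
    have "(\<lambda>t. if 1/4 \<le> \<bar>h j t - q t\<bar> then 1 else 0 :: real) \<in> borel_measurable M"
      using hm[of j] qm by measurable
    moreover have "(\<lambda>t. if 1/4 \<le> \<bar>h j t - q t\<bar> then 1 else 0 :: real) = indicator (B j)"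
      by (auto simp: B_def indicator_def fun_eq_iff)
    ultimately show ?thesis by simp
  qed
  have "(\<lambda>j. LINT t|M. indicator (B j) t) \<longlonglongrightarrow> (LINT t|M. (0::real))"
  proof (rule integral_dominated_convergence)
    show "integrable M (\<lambda>t. 1::real)" by simp
    show "AE t in M. norm (indicator (B j) t :: real) \<le> 1" for j by (auto simp: indicator_def)
    have "AE t in lebesgue. t \<notin> E" using E by (intro AE_not_in) (simp add: negligible_iff_null_sets)
    then have "AE t in M. t \<notin> E" by (subst AE_restrict_space_iff) (auto elim!: eventually_mono)
    then show "AE t in M. (\<lambda>j. indicator (B j) t :: real) \<longlonglongrightarrow> 0"
      using AE_space
    proof eventually_elim
      case (elim t)
      then have "(\<lambda>j. h j t) \<longlonglongrightarrow> q t" using hq[of t] by simp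
      then have "eventually (\<lambda>j. dist (h j t) (q t) < 1/4) sequentially" by (rule tendstoD) simp
      then have "eventually (\<lambda>j. 0 = (indicator (B j) t :: real)) sequentially"
        by eventually_elim (auto simp: B_def dist_real_def)
      then show ?case by (rule Lim_transform_eventually[OF tendsto_const])
    qed
  qed (use Bm in auto)
  moreover have "0 < \<epsilon> / (4 * K\<^sup>2)" using \<epsilon> K(1) by simp
  ultimately have "eventually (\<lambda>j. (LINT t|M. indicator (B j) t) < \<epsilon> / (4 * K\<^sup>2)) sequentially"
    by (intro order_tendstoD(2)) auto
  then obtain j where j: "(LINT t|M. indicator (B j) t) < \<epsilon> / (4 * K\<^sup>2)"
    by (auto simp: eventually_sequentially)
  have "uniformly_continuous_on {0..T} (h j)"
    by (rule compact_uniformly_continuous[OF continuous_on_subset[OF h]]) auto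
  then obtain \<delta> where \<delta>: "0 < \<delta>" "\<And>s t. s \<in> {0..T} \<Longrightarrow> t \<in> {0..T} \<Longrightarrow> dist t s < \<delta> \<Longrightarrow> dist (h j t) (h j s) < 1/4"
    unfolding uniformly_continuous_on_def by (metis zero_less_divide_1_iff zero_less_numeral)
  define \<rho> where "\<rho> t = N (v t - S k t) + K * indicator (B j) t" for t
  have vSk_nonneg: "0 \<le> N (v t - S k t)" for t by (rule W12_norm_nonneg)
  have \<rho>_sq: "(\<rho> t)\<^sup>2 \<le> 2 * (N (v t - S k t))\<^sup>2 + 2 * K\<^sup>2 * indicator (B j) t" for t
  proof -
    have "(\<rho> t)\<^sup>2 \<le> 2 * (N (v t - S k t))\<^sup>2 + 2 * (K * indicator (B j) t)\<^sup>2"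
      using sum_squares_bound[of "N (v t - S k t)" "K * indicator (B j) t"] unfolding \<rho>_def by (simp add: power2_sum)
    then show ?thesis by (cases "t \<in> B j") (simp_all add: power_mult_distrib)
  qed
  have Si: "integrable M (\<lambda>t. (N (v t - S k t))\<^sup>2)"
  proof (rule Bochner_Integration.integrable_bound)
    show "integrable M (\<lambda>t. 9 * (N (v t))\<^sup>2)" using n_sq_integrable by simp
    show "AE t in M. norm ((N (v t - S k t))\<^sup>2) \<le> norm (9 * (N (v t))\<^sup>2)"
    proof (rule AE_I2)
      fix t assume t: "t \<in> space M"
      have "(N (v t - S k t))\<^sup>2 \<le> (3 * N (v t))\<^sup>2"
        using t by (intro power_mono vSb W12_norm_nonneg) simp
      then show "norm ((N (v t - S k t))\<^sup>2) \<le> norm (9 * (N (v t))\<^sup>2)" by (simp add: power_mult_distrib)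
    qed
  qed (use vSm[of k] in measurable)
  have Bi: "integrable M (\<lambda>t. indicator (B j) t :: real)"
    by (rule Bochner_Integration.integrable_bound[of _ "\<lambda>_. 1::real"]) (use Bm in \<open>auto simp: indicator_def\<close>)
  have domi: "integrable M (\<lambda>t. 2 * (N (v t - S k t))\<^sup>2 + 2 * K\<^sup>2 * indicator (B j) t)"
    using Si Bi by simp
  have \<rho>m: "(\<lambda>t. (\<rho> t)\<^sup>2) \<in> borel_measurable M"
    unfolding \<rho>_def using vSm[of k] Bm[of j] by measurable
  have \<rho>i: "integrable M (\<lambda>t. (\<rho> t)\<^sup>2)"
    by (rule Bochner_Integration.integrable_bound[OF domi \<rho>m]) (use \<rho>_sq in \<open>auto intro: order_trans[OF _ abs_ge_self]\<close>)
  show thesis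
  proof (rule that[of \<delta> \<rho>])
    show "0 < \<delta>" by fact
    show "0 \<le> \<rho> t" for t unfolding \<rho>_def using vSk_nonneg K(1) by (simp add: indicator_def)
    show "integrable M (\<lambda>t. (\<rho> t)\<^sup>2)" by fact
    have "(LINT t|M. (\<rho> t)\<^sup>2) \<le> (LINT t|M. 2 * (N (v t - S k t))\<^sup>2 + 2 * K\<^sup>2 * indicator (B j) t)"
      by (rule integral_mono[OF \<rho>i domi \<rho>_sq])
    also have "\<dots> = 2 * (LINT t|M. (N (v t - S k t))\<^sup>2) + 2 * K\<^sup>2 * (LINT t|M. indicator (B j) t)"
      using Si Bi by simp
    also have "\<dots> \<le> 2 * (\<epsilon> / 4) + 2 * K\<^sup>2 * (\<epsilon> / (4 * K\<^sup>2))"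
      using k j by (intro add_mono mult_left_mono less_imp_le) auto
    also have "\<dots> = \<epsilon>" using K(1) by (simp add: field_simps)
    finally show "integral {0..T} (\<lambda>t. (\<rho> t)\<^sup>2) \<le> \<epsilon>"
      by (simp add: LINT_open_interval_eq[OF \<rho>i])
    fix s t assume st: "s \<in> {0<..<T}" "t \<in> {0<..<T}" "\<bar>t - s\<bar> < \<delta>"
    have Ss: "S k s \<in> A" "S k t \<in> A" unfolding A_def using st by auto
    have vS: "N (v s - S k s) = N (S k s - v s)" by (rule NV.norm_minus_commute[OF v_mem SV[OF st(1)]])
    have a1: "N (v t - v s) \<le> N (v t - S k t) + N (S k t - v s)"
      by (rule NV.triangle3[OF v_mem SV[OF st(2)] v_mem])
    have a2: "N (S k t - v s) \<le> N (S k t - S k s) + N (S k s - v s)"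
      by (rule NV.triangle3[OF SV[OF st(2)] SV[OF st(1)] v_mem])
    have b: "N (v t - v s) \<le> N (v t - S k t) + N (S k t - S k s) + N (v s - S k s)"
      using a1 a2 vS
      by linarith
    show "N (v t - v s) \<le> \<rho> t + \<rho> s"
    proof (cases "t \<in> B j \<or> s \<in> B j")
      case True
      then have "K \<le> K * indicator (B j) t + K * indicator (B j) s"
        using K(1) by (auto simp: indicator_def)
      then show ?thesis using b K(2)[OF Ss(2,1)] unfolding \<rho>_def by linarith
    next
      case False
      have "\<bar>h j t - h j s\<bar> < 1/4"
        using \<delta>(2)[of s t] st by (simp add: dist_real_def)
      moreover have "\<not> 1/4 \<le> \<bar>h j t - q t\<bar>" "\<not> 1/4 \<le> \<bar>h j s - q s\<bar>"
        using False unfolding B_def by blast+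
      ultimately have "\<bar>q t - q s\<bar> < 1" by linarith
      then have "\<iota> (S k t) = \<iota> (S k s)" unfolding q_def by linarith
      then have "S k t = S k s" using \<iota> Ss by (auto dest: inj_onD)
      then have "N (S k t - S k s) = 0" by (simp only: NV.norm_self)
      then show ?thesis using b K(1) unfolding \<rho>_def by (simp add: indicator_def)
    qed
  qed
qed

end

section \<open>Constancy of the energy defect\<close>

context evolution
begin

interpretation NV: seminormed_set V N by (rule seminormed_set_W12_0)

lemma g_diff: "x \<in> V \<Longrightarrow> y \<in> V \<Longrightarrow> g t (x - y) = g t x - g t y"
  using dual_diff[OF g_mem] by (simp add: fun_diff_def)

lemma hk_integrable:
  fixes f :: "real \<Rightarrow> real"
  assumes "integrable M f" "s \<in> {0<..<T}" "t \<in> {0<..<T}"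
  shows "f integrable_on {s..t}"
  by (rule integrable_lebesgue_on_imp_integrable_on[OF assms(1)]) (use assms in auto)

text \<open>Energy minus twice the accumulated duality pairing; the energy identity says that this
  is constant in time.\<close>

definition energy_defect :: "real \<Rightarrow> real" where
  "energy_defect t = (nH (v t))\<^sup>2 - 2 * integral {0..t} (\<lambda>r. g r (v r))"

context
  fixes P
  assumes P_sub: "P \<subseteq> {0<..<T}" and P_null: "negligible ({0..T} - P)"
    and P_id: "\<And>s t \<tau>. s \<in> P \<Longrightarrow> t \<in> P \<Longrightarrow> \<tau> \<in> P \<Longrightarrow> s \<le> t \<Longrightarrow>
      ip (v t) (v \<tau>) - ip (v s) (v \<tau>) = integral {s..t} (\<lambda>r. g r (v \<tau>))"
begin

lemma PI: "t \<in> P \<Longrightarrow> t \<in> {0<..<T}" using P_sub by blast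

text \<open>By symmetry, (v t - v s, v t) + (v t - v s, v s) = |v t|^2 - |v s|^2; so the increment
  identity is tested with the values at both ends.\<close>

lemma energy_defect_diff:
  assumes "s \<in> P" "t \<in> P" "s \<le> t"
  shows "energy_defect t - energy_defect s = integral {s..t} (\<lambda>r. g r (v t - v r) - g r (v r - v s))"
proof -
  note I = PI[OF assms(1)] PI[OF assms(2)]
  note i = hk_integrable[OF g_integrable[OF v_mem] I] and iv = hk_integrable[OF gv_integrable I]
  have "energy_defect t - energy_defect s =
    (ip (v t) (v t) - ip (v s) (v t)) + (ip (v t) (v s) - ip (v s) (v s)) - 2 * integral {s..t} (\<lambda>r. g r (v r))"
    using integral_interval_diff[OF gv_integrable, of s t] assms(3) I
    unfolding energy_defect_def by (simp add: L2_inner_self L2_inner_commute[of \<Omega> "v s" "v t"])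
  also have "\<dots> = integral {s..t} (\<lambda>r. g r (v t)) + integral {s..t} (\<lambda>r. g r (v s)) - 2 * integral {s..t} (\<lambda>r. g r (v r))"
    using P_id[OF assms(1,2,2,3)] P_id[OF assms(1,2,1,3)] by simp
  also have "\<dots> = integral {s..t} (\<lambda>r. (g r (v t) + g r (v s)) - 2 * g r (v r))"
    using i[of t] i[of s] iv by (simp add: Henstock_Kurzweil_Integration.integral_diff Henstock_Kurzweil_Integration.integral_add integrable_add)
  also have "\<dots> = integral {s..t} (\<lambda>r. g r (v t - v r) - g r (v r - v s))"
    by (intro Henstock_Kurzweil_Integration.integral_cong) (simp add: g_diff v_mem)
  finally show ?thesis .
qed

text \<open>Young's inequality with weight \<kappa> separates the dual norm from the error of
  \<open>v\<close>. The error at the end points enters with the factor \<open>t - s\<close>, which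
  is why partition points with small \<rho> are wanted.\<close>

lemma energy_defect_step:
  assumes st: "s \<in> P" "t \<in> P" "s \<le> t" "t - s < \<delta>" and \<kappa>: "0 < \<kappa>"
    and \<rho>i: "integrable M (\<lambda>t. (\<rho> t)\<^sup>2)"
    and \<rho>: "\<And>s t. s \<in> {0<..<T} \<Longrightarrow> t \<in> {0<..<T} \<Longrightarrow> \<bar>t - s\<bar> < \<delta> \<Longrightarrow> N (v t - v s) \<le> \<rho> t + \<rho> s"
  shows "\<bar>energy_defect t - energy_defect s\<bar> \<le> \<kappa> / 2 * integral {s..t} (\<lambda>r. (m r)\<^sup>2)
    + 4 / \<kappa> * integral {s..t} (\<lambda>r. (\<rho> r)\<^sup>2) + 2 / \<kappa> * (t - s) * ((\<rho> t)\<^sup>2 + (\<rho> s)\<^sup>2)"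
proof -
  note I = PI[OF st(1)] PI[OF st(2)]
  let ?b = "\<lambda>r. (\<kappa> / 2 * (m r)\<^sup>2 + 4 / \<kappa> * (\<rho> r)\<^sup>2) + 2 / \<kappa> * ((\<rho> t)\<^sup>2 + (\<rho> s)\<^sup>2)"
  have mi: "(\<lambda>r. (m r)\<^sup>2) integrable_on {s..t}" by (rule hk_integrable[OF m_sq_integrable I])
  have ri: "(\<lambda>r. (\<rho> r)\<^sup>2) integrable_on {s..t}" by (rule hk_integrable[OF \<rho>i I])
  have mi': "(\<lambda>r. \<kappa> / 2 * (m r)\<^sup>2) integrable_on {s..t}" using mi \<kappa> by simp
  have ri': "(\<lambda>r. 4 / \<kappa> * (\<rho> r)\<^sup>2) integrable_on {s..t}" using ri \<kappa> by simp
  have bi: "?b integrable_on {s..t}"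
    by (intro integrable_add mi' ri' integrable_const_ivl)
  have gi: "(\<lambda>r. g r (v t - v r) - g r (v r - v s)) integrable_on {s..t}"
  proof -
    have eq: "(\<lambda>r. g r (v t - v r) - g r (v r - v s)) = (\<lambda>r. (g r (v t) + g r (v s)) - 2 * g r (v r))"
      by (simp add: fun_eq_iff g_diff v_mem)
    have i2: "(\<lambda>r. 2 * g r (v r)) integrable_on {s..t}"
      using hk_integrable[OF gv_integrable I] by simp
    show ?thesis
      unfolding eq by (intro integrable_diff integrable_add i2 hk_integrable[OF g_integrable[OF v_mem] I])
  qed
  have pt: "\<bar>g r (v t - v r) - g r (v r - v s)\<bar> \<le> ?b r" if r: "r \<in> {s..t}" for r
  proof -
    have rI: "r \<in> {0<..<T}" using r I by auto
    have a1: "\<bar>g r (v t - v r)\<bar> \<le> m r * N (v t - v r)" by (rule g_bound[OF NV.diff[OF v_mem v_mem]])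
    have a2: "\<bar>g r (v r - v s)\<bar> \<le> m r * N (v r - v s)" by (rule g_bound[OF NV.diff[OF v_mem v_mem]])
    have "N (v t - v r) \<le> \<rho> t + \<rho> r" using \<rho>[OF rI I(2)] r st by auto
    moreover have "N (v r - v s) \<le> \<rho> r + \<rho> s" using \<rho>[OF I(1) rI] r st by auto
    ultimately have le: "N (v t - v r) + N (v r - v s) \<le> \<rho> t + \<rho> s + 2 * \<rho> r" by linarith
    let ?c = "\<rho> t + \<rho> s + 2 * \<rho> r"
    have "\<bar>g r (v t - v r) - g r (v r - v s)\<bar> \<le> m r * (N (v t - v r) + N (v r - v s))"
      using a1 a2 by (simp add: distrib_left)
    also have "\<dots> \<le> m r * ?c" by (rule mult_left_mono[OF le m_nonneg])
    also have "\<dots> \<le> \<kappa> / 2 * (m r)\<^sup>2 + 1 / (2 * \<kappa>) * ?c\<^sup>2"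
    proof -
      \<comment> \<open>Young's inequality as a completed square.\<close>
      have "0 \<le> (\<kappa> * m r - ?c)\<^sup>2 / (2 * \<kappa>)" using \<kappa> by simp
      also have "\<dots> = \<kappa> / 2 * (m r)\<^sup>2 + 1 / (2 * \<kappa>) * ?c\<^sup>2 - m r * ?c"
        using \<kappa> by (simp add: power2_diff power2_eq_square field_simps)
      finally show ?thesis by simp
    qed
    also have "1 / (2 * \<kappa>) * ?c\<^sup>2 \<le> 1 / (2 * \<kappa>) * (4 * (\<rho> t)\<^sup>2 + 4 * (\<rho> s)\<^sup>2 + 8 * (\<rho> r)\<^sup>2)"
    proof (rule mult_left_mono)
      \<comment> \<open>The gap in the inequality is written out as a sum of squares.\<close>
      have "?c\<^sup>2 + ((\<rho> t - \<rho> s)\<^sup>2 + 2 * (\<rho> t - \<rho> r)\<^sup>2 + 2 * (\<rho> s - \<rho> r)\<^sup>2) = 4 * (\<rho> t)\<^sup>2 + 4 * (\<rho> s)\<^sup>2 + 8 * (\<rho> r)\<^sup>2"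
        by (simp add: power2_eq_square algebra_simps)
      moreover have "0 \<le> (\<rho> t - \<rho> s)\<^sup>2 + 2 * (\<rho> t - \<rho> r)\<^sup>2 + 2 * (\<rho> s - \<rho> r)\<^sup>2" by simp
      ultimately show "?c\<^sup>2 \<le> 4 * (\<rho> t)\<^sup>2 + 4 * (\<rho> s)\<^sup>2 + 8 * (\<rho> r)\<^sup>2" by linarith
    qed (use \<kappa> in simp)
    also have "1 / (2 * \<kappa>) * (4 * (\<rho> t)\<^sup>2 + 4 * (\<rho> s)\<^sup>2 + 8 * (\<rho> r)\<^sup>2) = 4 / \<kappa> * (\<rho> r)\<^sup>2 + 2 / \<kappa> * ((\<rho> t)\<^sup>2 + (\<rho> s)\<^sup>2)"
      using \<kappa> by (simp add: field_simps)
    finally show ?thesis by (simp only: add.assoc)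
  qed
  have "norm (integral {s..t} (\<lambda>r. g r (v t - v r) - g r (v r - v s))) \<le> integral {s..t} ?b"
    by (rule integral_norm_bound_integral[OF gi bi]) (use pt in auto)
  also have "\<dots> = integral {s..t} (\<lambda>r. \<kappa> / 2 * (m r)\<^sup>2 + 4 / \<kappa> * (\<rho> r)\<^sup>2)
    + integral {s..t} (\<lambda>r. 2 / \<kappa> * ((\<rho> t)\<^sup>2 + (\<rho> s)\<^sup>2))"
    by (rule Henstock_Kurzweil_Integration.integral_add[OF integrable_add[OF mi' ri'] integrable_const_ivl])
  also have "integral {s..t} (\<lambda>r. \<kappa> / 2 * (m r)\<^sup>2 + 4 / \<kappa> * (\<rho> r)\<^sup>2)
    = integral {s..t} (\<lambda>r. \<kappa> / 2 * (m r)\<^sup>2) + integral {s..t} (\<lambda>r. 4 / \<kappa> * (\<rho> r)\<^sup>2)"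
    by (rule Henstock_Kurzweil_Integration.integral_add[OF mi' ri'])
  also have "integral {s..t} (\<lambda>r. \<kappa> / 2 * (m r)\<^sup>2) = \<kappa> / 2 * integral {s..t} (\<lambda>r. (m r)\<^sup>2)"
    by (rule integral_mult_right)
  also have "integral {s..t} (\<lambda>r. 4 / \<kappa> * (\<rho> r)\<^sup>2) = 4 / \<kappa> * integral {s..t} (\<lambda>r. (\<rho> r)\<^sup>2)"
    by (rule integral_mult_right)
  also have "integral {s..t} (\<lambda>r. 2 / \<kappa> * ((\<rho> t)\<^sup>2 + (\<rho> s)\<^sup>2)) = (t - s) * (2 / \<kappa> * ((\<rho> t)\<^sup>2 + (\<rho> s)\<^sup>2))"
    using st(3) by simp
  finally show ?thesis
    unfolding energy_defect_diff[OF st(1-3)] real_norm_def by (simp only: mult.commute mult.left_commute mult.assoc)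
qed

text \<open>\<kappa> weighs Young's inequality while its square bounds the integral of
  \<open>\<rho>\<^sup>2\<close>, so every factor 1/\<kappa> meets a \<open>\<kappa>\<^sup>2\<close>.
  In the constant, \<open>mass\<close> comes from the dual norms, 4 from the integral of
  \<open>\<rho>\<^sup>2\<close>, and 24 = 4 (3 + 3) from \<rho> at the partition points, counted
  once as right and once as left ends.\<close>

lemma energy_defect_bound:
  assumes st: "s \<in> P" "t \<in> P" "s < t" and \<kappa>: "0 < \<kappa>"
  shows "\<bar>energy_defect t - energy_defect s\<bar> \<le> \<kappa> * (mass + 28)"
proof -
  note I = PI[OF st(1)] PI[OF st(2)]
  obtain \<rho> \<delta> where \<delta>: "0 < \<delta>" and \<rho>0: "\<And>t. 0 \<le> \<rho> t" and \<rho>i: "integrable M (\<lambda>t. (\<rho> t)\<^sup>2)"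
    and \<rho>\<kappa>: "integral {0..T} (\<lambda>t. (\<rho> t)\<^sup>2) \<le> \<kappa>\<^sup>2"
    and \<rho>: "\<And>s t. s \<in> {0<..<T} \<Longrightarrow> t \<in> {0<..<T} \<Longrightarrow> \<bar>t - s\<bar> < \<delta> \<Longrightarrow> N (v t - v s) \<le> \<rho> t + \<rho> s"
    using approx_modulus[of "\<kappa>\<^sup>2"] \<kappa> by (metis zero_less_power)
  define C where "C = (\<rho> s)\<^sup>2 + (\<rho> t)\<^sup>2"
  have C0: "0 \<le> C" unfolding C_def by simp
  \<comment> \<open>The first bound makes two adjacent cells together shorter than \<delta>; the
    second makes \<open>h * C\<close>, the price of the prescribed end points, at most
    \<open>\<kappa>\<^sup>2\<close>.\<close>
  obtain k :: nat where k: "max (2 * (t - s) / \<delta>) (C * (t - s) / \<kappa>\<^sup>2) < real k"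
    using reals_Archimedean2 by blast
  define h where "h = (t - s) / real (Suc k)"
  have h0: "0 < h" using st unfolding h_def by simp
  have h\<delta>: "2 * h < \<delta>"
  proof -
    have "2 * (t - s) < real k * \<delta>" using k \<delta> by (simp add: pos_divide_less_eq)
    also have "\<dots> \<le> real (Suc k) * \<delta>" using \<delta> by simp
    finally show ?thesis unfolding h_def by (simp add: pos_divide_less_eq mult.commute)
  qed
  have hC: "h * C \<le> \<kappa>\<^sup>2"
  proof -
    have "C * (t - s) < real k * \<kappa>\<^sup>2" using k \<kappa> by (simp add: pos_divide_less_eq)
    also have "\<dots> \<le> real (Suc k) * \<kappa>\<^sup>2" by (intro mult_right_mono) auto
    finally show ?thesis unfolding h_def by (simp add: pos_divide_le_eq mult.commute)
  qed
  have hk: "s + real (Suc k) * h = t" unfolding h_def by simp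
  have k0: "0 < k"
  proof -
    have "0 < 2 * (t - s) / \<delta>" using st \<delta> by simp
    also have "\<dots> < real k" using k by (simp only: max_less_iff_conj)
    finally show ?thesis by simp
  qed
  define a where "a i = s + real i * h" for i
  have a_mono: "a i \<le> a j" if "i \<le> j" for i j
    using that h0 unfolding a_def by simp
  have a_Suc: "a (Suc i) = a i + h" for i unfolding a_def by (simp add: algebra_simps)
  have a0: "a 0 = s" and aK: "a (Suc k) = t" using hk unfolding a_def by simp_all
  have aI: "a i \<in> {s..t}" if "i \<le> Suc k" for i
    using a_mono[of 0 i] a_mono[OF that] a0 aK by auto
  have "\<exists>p. p \<in> P \<and> a i < p \<and> p < a (Suc i) \<and> h * (\<rho> p)\<^sup>2 \<le> integral {a i..a (Suc i)} (\<lambda>t. (\<rho> t)\<^sup>2)"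
    if i: "i \<le> k" for i
  proof -
    have "0 \<le> a i" "a i < a (Suc i)" "a (Suc i) \<le> T" "a (Suc i) - a i = h"
      using aI[of i] aI[of "Suc i"] i I h0 by (auto simp: a_Suc)
    then show ?thesis
      using exists_le_average[OF \<rho>i _ _ _ P_null, of "a i" "a (Suc i)"] by metis
  qed
  then obtain p0 where p0: "\<And>i. i \<le> k \<Longrightarrow> p0 i \<in> P \<and> a i < p0 i \<and> p0 i < a (Suc i) \<and>
      h * (\<rho> (p0 i))\<^sup>2 \<le> integral {a i..a (Suc i)} (\<lambda>t. (\<rho> t)\<^sup>2)"
    by metis
  \<comment> \<open>One point in each of the \<open>Suc k\<close> cells, hence \<open>k\<close>
    steps of length at most \<open>2 * h\<close>. The first and the last point are prescribed to be
    \<open>s\<close> and \<open>t\<close>, where \<rho> need not be at most average.\<close>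
  define p where "p i = (if i = 0 then s else if i = k then t else p0 i)" for i
  define R where "R u = integral {0..u} (\<lambda>t. (\<rho> t)\<^sup>2)" for u
  have R_diff: "integral {x..y} (\<lambda>t. (\<rho> t)\<^sup>2) = R y - R x" if "0 \<le> x" "x \<le> y" "y \<le> T" for x y
    unfolding R_def using integral_interval_diff[OF \<rho>i that] by simp
  have R_mono: "R x \<le> R y" if "0 \<le> x" "x \<le> y" "y \<le> T" for x y
    using R_diff[OF that] integral_nonneg[OF integrable_lebesgue_on_imp_integrable_on[OF \<rho>i that(1) that(3)]] by simp
  define Q where "Q u = integral {0..u} (\<lambda>t. (m t)\<^sup>2)" for u
  have Q_diff: "integral {x..y} (\<lambda>t. (m t)\<^sup>2) = Q y - Q x" if "0 \<le> x" "x \<le> y" "y \<le> T" for x y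
    unfolding Q_def using integral_interval_diff[OF m_sq_integrable that] by simp
  have pP: "p i \<in> P" if "i \<le> k" for i
    unfolding p_def using st p0[OF that] by simp
  have pa: "a i \<le> p i" "p i \<le> a (Suc i)" if "i \<le> k" for i
    using p0[OF that] a0 aK a_Suc[of 0] h0 a_mono[of k "Suc k"] unfolding p_def by auto
  have p\<rho>: "h * (\<rho> (p i))\<^sup>2 \<le> (R (a (Suc i)) - R (a i)) + (if i = 0 \<or> i = k then h * C else 0)" if i: "i \<le> k" for i
  proof -
    have aa: "0 \<le> a i" "a i \<le> a (Suc i)" "a (Suc i) \<le> T"
      using aI[of i] aI[of "Suc i"] a_mono[of i "Suc i"] i I by auto
    have nn: "0 \<le> R (a (Suc i)) - R (a i)" using R_mono[OF aa] by simp
    show ?thesis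
    proof (cases "i = 0 \<or> i = k")
      case True
      then have "(\<rho> (p i))\<^sup>2 \<le> C" unfolding p_def C_def using k0 by auto
      then have "h * (\<rho> (p i))\<^sup>2 \<le> h * C" using h0 by (intro mult_left_mono) auto
      then show ?thesis using True nn by simp
    next
      case False
      then show ?thesis using p0[OF i] R_diff[OF aa] unfolding p_def by simp
    qed
  qed
  \<comment> \<open>One \<open>\<kappa>\<^sup>2\<close> from the integral of
    \<open>\<rho>\<^sup>2\<close> and one from \<open>h * C\<close> for each of the two end cells,
    which are distinct since \<open>k\<close> is positive.\<close>
  have sum_h: "(\<Sum>i\<le>k. h * (\<rho> (p i))\<^sup>2) \<le> 3 * \<kappa>\<^sup>2"
  proof -
    have "(\<Sum>i\<le>k. h * (\<rho> (p i))\<^sup>2) \<le> (\<Sum>i\<le>k. (R (a (Suc i)) - R (a i)) + (if i = 0 \<or> i = k then h * C else 0))"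
      by (rule sum_mono) (use p\<rho> in auto)
    also have "\<dots> = (\<Sum>i<Suc k. R (a (Suc i)) - R (a i)) + (\<Sum>i\<le>k. if i = 0 \<or> i = k then h * C else 0)"
      by (simp only: sum.distrib lessThan_Suc_atMost)
    also have "(\<Sum>i<Suc k. R (a (Suc i)) - R (a i)) = R t - R s"
      by (subst sum_lessThan_telescope) (simp only: a0 aK)
    also have "(\<Sum>i\<le>k. if i = 0 \<or> i = k then h * C else 0) = (\<Sum>i\<in>{0, k}. h * C)"
    proof -
      have "{..k} \<inter> {i. i = 0 \<or> i = k} = {0, k}" by auto
      then show ?thesis by (simp add: sum.If_cases)
    qed
    also have "(\<Sum>i\<in>{0, k}. h * C) = 2 * (h * C)" using k0 by simp
    also have "R t - R s \<le> \<kappa>\<^sup>2"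
    proof -
      have "0 \<le> R s" using R_mono[of 0 s] I by (simp add: R_def)
      moreover have "R t \<le> R T" using R_mono[of t T] I by simp
      ultimately show ?thesis using \<rho>\<kappa> unfolding R_def by linarith
    qed
    finally show ?thesis using hC by simp
  qed
  have "energy_defect t - energy_defect s = (\<Sum>i<k. energy_defect (p (Suc i)) - energy_defect (p i))"
  proof -
    have "p k = t" "p 0 = s" using k0 unfolding p_def by simp_all
    then show ?thesis by (subst sum_lessThan_telescope) simp
  qed
  then have "\<bar>energy_defect t - energy_defect s\<bar> \<le> (\<Sum>i<k. \<bar>energy_defect (p (Suc i)) - energy_defect (p i)\<bar>)"
    by (simp only: sum_abs)
  also have "\<dots> \<le> (\<Sum>i<k. \<kappa> / 2 * (Q (p (Suc i)) - Q (p i)) + 4 / \<kappa> * (R (p (Suc i)) - R (p i))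
      + 4 / \<kappa> * (h * (\<rho> (p (Suc i)))\<^sup>2 + h * (\<rho> (p i))\<^sup>2))"
  proof (rule sum_mono)
    fix i assume "i \<in> {..<k}"
    then have i: "i \<le> k" "Suc i \<le> k" by auto
    have le: "p i \<le> p (Suc i)" using pa(2)[OF i(1)] pa(1)[OF i(2)] by simp
    have d: "p (Suc i) - p i \<le> 2 * h" using pa(1)[OF i(1)] pa(2)[OF i(2)] by (simp add: a_Suc)
    have pI: "p i \<in> {0<..<T}" "p (Suc i) \<in> {0<..<T}" using pP i PI by blast+
    have "2 / \<kappa> * (p (Suc i) - p i) * ((\<rho> (p (Suc i)))\<^sup>2 + (\<rho> (p i))\<^sup>2) \<le>
      2 / \<kappa> * (2 * h) * ((\<rho> (p (Suc i)))\<^sup>2 + (\<rho> (p i))\<^sup>2)"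
      using d \<kappa> by (intro mult_right_mono mult_left_mono) auto
    also have "\<dots> = 4 / \<kappa> * (h * (\<rho> (p (Suc i)))\<^sup>2 + h * (\<rho> (p i))\<^sup>2)"
      by (simp add: algebra_simps)
    finally have e: "2 / \<kappa> * (p (Suc i) - p i) * ((\<rho> (p (Suc i)))\<^sup>2 + (\<rho> (p i))\<^sup>2) \<le>
      4 / \<kappa> * (h * (\<rho> (p (Suc i)))\<^sup>2 + h * (\<rho> (p i))\<^sup>2)" .
    have "p (Suc i) - p i < \<delta>" using d h\<delta> by linarith
    from energy_defect_step[OF pP[OF i(1)] pP[OF i(2)] le this \<kappa> \<rho>i \<rho>]
    show "\<bar>energy_defect (p (Suc i)) - energy_defect (p i)\<bar> \<le>
      \<kappa> / 2 * (Q (p (Suc i)) - Q (p i)) + 4 / \<kappa> * (R (p (Suc i)) - R (p i))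
      + 4 / \<kappa> * (h * (\<rho> (p (Suc i)))\<^sup>2 + h * (\<rho> (p i))\<^sup>2)"
      using e Q_diff[OF _ le] R_diff[OF _ le] pI by simp
  qed
  also have "\<dots> = \<kappa> / 2 * (\<Sum>i<k. Q (p (Suc i)) - Q (p i)) + 4 / \<kappa> * (\<Sum>i<k. R (p (Suc i)) - R (p i))
      + 4 / \<kappa> * ((\<Sum>i<k. h * (\<rho> (p (Suc i)))\<^sup>2) + (\<Sum>i<k. h * (\<rho> (p i))\<^sup>2))"
    by (simp only: sum.distrib sum_distrib_left distrib_left)
  also have "\<dots> \<le> \<kappa> / 2 * (2 * mass) + 4 / \<kappa> * \<kappa>\<^sup>2 + 4 / \<kappa> * (3 * \<kappa>\<^sup>2 + 3 * \<kappa>\<^sup>2)"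
  proof (intro add_mono mult_left_mono)
    have pk: "p k = t" "p 0 = s" using k0 unfolding p_def by simp_all
    have Q0: "Q x \<le> Q y" if "0 \<le> x" "x \<le> y" "y \<le> T" for x y
      using Q_diff[OF that] integral_nonneg[OF integrable_lebesgue_on_imp_integrable_on[OF m_sq_integrable that(1) that(3)]] by simp
    have "(\<Sum>i<k. Q (p (Suc i)) - Q (p i)) = Q t - Q s"
      by (subst sum_lessThan_telescope) (simp only: pk)
    moreover have "0 \<le> Q s" using Q0[of 0 s] I by (simp add: Q_def)
    moreover have "Q t \<le> Q T" using Q0[of t T] I by simp
    moreover have "Q T \<le> mass"
      unfolding Q_def mass_def
      by (rule integral_le) (auto intro!: integrable_lebesgue_on_imp_integrable_on m_sq_integrable one_m_sq_integrable)
    ultimately show "(\<Sum>i<k. Q (p (Suc i)) - Q (p i)) \<le> 2 * mass" using mass_nonneg by linarith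
    have "(\<Sum>i<k. R (p (Suc i)) - R (p i)) = R t - R s"
      by (subst sum_lessThan_telescope) (simp only: pk)
    moreover have "0 \<le> R s" using R_mono[of 0 s] I by (simp add: R_def)
    moreover have "R t \<le> R T" using R_mono[of t T] I by simp
    ultimately show "(\<Sum>i<k. R (p (Suc i)) - R (p i)) \<le> \<kappa>\<^sup>2" using \<rho>\<kappa> unfolding R_def by linarith
    have nn: "0 \<le> h * (\<rho> (p i))\<^sup>2" for i using h0 by simp
    have "(\<Sum>i<k. h * (\<rho> (p (Suc i)))\<^sup>2) = (\<Sum>i\<in>Suc ` {..<k}. h * (\<rho> (p i))\<^sup>2)"
      by (simp add: sum.reindex)
    also have "\<dots> \<le> (\<Sum>i\<le>k. h * (\<rho> (p i))\<^sup>2)"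
      by (rule sum_mono2) (use nn in auto)
    finally show "(\<Sum>i<k. h * (\<rho> (p (Suc i)))\<^sup>2) \<le> 3 * \<kappa>\<^sup>2" using sum_h by linarith
    have "(\<Sum>i<k. h * (\<rho> (p i))\<^sup>2) \<le> (\<Sum>i\<le>k. h * (\<rho> (p i))\<^sup>2)"
      by (rule sum_mono2) (use nn in auto)
    then show "(\<Sum>i<k. h * (\<rho> (p i))\<^sup>2) \<le> 3 * \<kappa>\<^sup>2" using sum_h by linarith
  qed (use \<kappa> in auto)
  also have "\<dots> = \<kappa> * (mass + 28)"
    using \<kappa> by (simp add: power2_eq_square field_simps)
  finally show ?thesis .
qed

lemma energy_defect_const:
  assumes "s \<in> P" "t \<in> P"
  shows "energy_defect s = energy_defect t"
proof -
  have *: "energy_defect s = energy_defect t" if st: "s \<in> P" "t \<in> P" "s < t" for s t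
  proof (rule ccontr)
    assume "energy_defect s \<noteq> energy_defect t"
    then have d: "0 < \<bar>energy_defect t - energy_defect s\<bar>" by simp
    \<comment> \<open>With this \<kappa> the bound is half of the positive difference it should
      dominate.\<close>
    define \<kappa> where "\<kappa> = \<bar>energy_defect t - energy_defect s\<bar> / (2 * (mass + 28))"
    have "0 < \<kappa>" unfolding \<kappa>_def using d mass_nonneg by (intro divide_pos_pos) auto
    note b = energy_defect_bound[OF st this]
    have c: "x / (2 * c) * c = x / 2" if "c \<noteq> 0" for x c :: real using that by simp
    have c0: "mass + 28 \<noteq> 0" using mass_nonneg by linarith
    from b have "\<bar>energy_defect t - energy_defect s\<bar> \<le> \<bar>energy_defect t - energy_defect s\<bar> / 2"
      unfolding \<kappa>_def c[OF c0] .
    then show False using d by simp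
  qed
  consider "s < t" | "t < s" | "s = t" by linarith
  then show ?thesis
  proof cases
    case 1
    then show ?thesis by (rule *[OF assms])
  next
    case 2
    then show ?thesis by (rule *[OF assms(2,1), symmetric])
  next
    case 3
    then show ?thesis by (rule arg_cong)
  qed
qed

section \<open>From the identity at good times to the continuous representative\<close>

lemma energy_identity_good:
  assumes "s \<in> P" "t \<in> P" "s \<le> t"
  shows "(nH (v t))\<^sup>2 - (nH (v s))\<^sup>2 = 2 * integral {s..t} (\<lambda>r. g r (v r))"
  using energy_defect_const[OF assms(1,2)] integral_interval_diff[OF gv_integrable, of s t] PI[OF assms(1)] PI[OF assms(2)] assms(3)
  unfolding energy_defect_def by simp

text \<open>Its increments control the squared increments of \<open>v\<close> in
  \<open>L2 \<Omega>\<close>. The 4 consists of 2 for \<open>N (v r)\<close> and 2 for the norm at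
  an intermediate time, where it is at most average.\<close>

definition energy_mass :: "real \<Rightarrow> real" where
  "energy_mass t = integral {0..t} (\<lambda>r. (m r)\<^sup>2 + 4 * (N (v r))\<^sup>2)"

lemma energy_mass_integrable: "integrable M (\<lambda>r. (m r)\<^sup>2 + 4 * (N (v r))\<^sup>2)"
  using m_sq_integrable n_sq_integrable by simp

lemma energy_mass_mono:
  assumes "0 \<le> s" "s \<le> t" "t \<le> T"
  shows "energy_mass s \<le> energy_mass t"
  using integral_interval_diff[OF energy_mass_integrable assms]
    integral_nonneg[OF integrable_lebesgue_on_imp_integrable_on[OF energy_mass_integrable assms(1) assms(3)]]
  unfolding energy_mass_def by simp

lemma energy_mass_cont: "continuous_on {0..T} energy_mass"
  unfolding energy_mass_def
  by (rule indefinite_integral_continuous_1[OF integrable_lebesgue_on_imp_integrable_on[OF energy_mass_integrable]]) auto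

text \<open>Going through an intermediate time at which \<open>N (v c)\<close> is at most average makes the estimate
  uniform in \<open>a\<close> and \<open>b\<close>.\<close>

lemma good_diff_bound:
  assumes ab: "a \<in> P" "b \<in> P" "a < b"
  shows "nH (\<lambda>x. v b x - v a x) \<le> 2 * sqrt (energy_mass b - energy_mass a)"
proof -
  note I = PI[OF ab(1)] PI[OF ab(2)]
  obtain c where c: "c \<in> P" "a < c" "c < b" "(b - a) * (N (v c))\<^sup>2 \<le> integral {a..b} (\<lambda>r. (N (v r))\<^sup>2)"
    using exists_le_average[OF n_sq_integrable _ ab(3) _ P_null] I by auto
  note cI = PI[OF c(1)]
  \<comment> \<open>A majorant of \<open>2 * g r (v r - v c)\<close> obtained from 2ab \<le> a^2 +
    b^2; its integral over the whole of \<open>{a..b}\<close> bounds those over all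
    subintervals.\<close>
  define F where "F r = (m r)\<^sup>2 + 2 * (N (v r))\<^sup>2 + 2 * (N (v c))\<^sup>2" for r
  have Fi: "F integrable_on {a..b}"
    unfolding F_def using hk_integrable[OF m_sq_integrable I] hk_integrable[OF n_sq_integrable I]
    by (intro integrable_add integrable_const_ivl) auto
  have F0: "0 \<le> F r" for r unfolding F_def by simp
  have FI: "integral {a..b} F \<le> energy_mass b - energy_mass a"
  proof -
    note mi = hk_integrable[OF m_sq_integrable I] and ni = hk_integrable[OF n_sq_integrable I]
    have ni2: "(\<lambda>r. 2 * (N (v r))\<^sup>2) integrable_on {a..b}" using ni by simp
    have ni4: "(\<lambda>r. 4 * (N (v r))\<^sup>2) integrable_on {a..b}" using ni by simp
    have "integral {a..b} F = integral {a..b} (\<lambda>r. (m r)\<^sup>2 + 2 * (N (v r))\<^sup>2) + integral {a..b} (\<lambda>r. 2 * (N (v c))\<^sup>2)"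
      unfolding F_def by (rule Henstock_Kurzweil_Integration.integral_add[OF integrable_add[OF mi ni2] integrable_const_ivl])
    also have "integral {a..b} (\<lambda>r. (m r)\<^sup>2 + 2 * (N (v r))\<^sup>2) = integral {a..b} (\<lambda>r. (m r)\<^sup>2) + integral {a..b} (\<lambda>r. 2 * (N (v r))\<^sup>2)"
      by (rule Henstock_Kurzweil_Integration.integral_add[OF mi ni2])
    finally have "integral {a..b} F = integral {a..b} (\<lambda>r. (m r)\<^sup>2) + 2 * integral {a..b} (\<lambda>r. (N (v r))\<^sup>2) + (b - a) * (2 * (N (v c))\<^sup>2)"
      using ab(3) by simp
    also have "\<dots> \<le> integral {a..b} (\<lambda>r. (m r)\<^sup>2) + 4 * integral {a..b} (\<lambda>r. (N (v r))\<^sup>2)"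
      using c(4) by simp
    also have "\<dots> = integral {a..b} (\<lambda>r. (m r)\<^sup>2 + 4 * (N (v r))\<^sup>2)"
      using mi ni4 by (simp add: Henstock_Kurzweil_Integration.integral_add)
    also have "\<dots> = energy_mass b - energy_mass a"
      unfolding energy_mass_def using integral_interval_diff[OF energy_mass_integrable, of a b] I ab(3) by simp
    finally show ?thesis .
  qed
  have pt: "\<bar>2 * g r (v r - v c)\<bar> \<le> F r" for r
  proof -
    have "\<bar>g r (v r - v c)\<bar> \<le> m r * N (v r - v c)" by (rule g_bound[OF NV.diff[OF v_mem v_mem]])
    also have "\<dots> \<le> m r * (N (v r) + N (v c))"
      by (intro mult_left_mono NV.triangle v_mem m_nonneg)
    finally have "\<bar>2 * g r (v r - v c)\<bar> \<le> 2 * m r * (N (v r) + N (v c))" by simp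
    also have "\<dots> \<le> (m r)\<^sup>2 + (N (v r) + N (v c))\<^sup>2" by (rule sum_squares_bound)
    also have "\<dots> \<le> F r"
      unfolding F_def using sum_squares_bound[of "N (v r)" "N (v c)"] by (simp add: power2_sum)
    finally show ?thesis .
  qed
  have gi: "(\<lambda>r. 2 * g r (v r - v c)) integrable_on {x..y}" if "x \<in> {0<..<T}" "y \<in> {0<..<T}" for x y
  proof -
    have eq: "(\<lambda>r. 2 * g r (v r - v c)) = (\<lambda>r. 2 * g r (v r) - 2 * g r (v c))"
      by (simp add: fun_eq_iff g_diff v_mem)
    have "(\<lambda>r. 2 * g r (v r)) integrable_on {x..y}" "(\<lambda>r. 2 * g r (v c)) integrable_on {x..y}"
      using hk_integrable[OF gv_integrable that] hk_integrable[OF g_integrable[OF v_mem] that, of c] by simp_all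
    then show ?thesis unfolding eq by (rule integrable_diff)
  qed
  have sub: "\<bar>integral {x..y} (\<lambda>r. 2 * g r (v r - v c))\<bar> \<le> energy_mass b - energy_mass a"
    if xy: "x \<in> {a..b}" "y \<in> {a..b}" for x y
  proof -
    have F': "F integrable_on {x..y}" by (rule integrable_subinterval_real[OF Fi]) (use xy in auto)
    have "norm (integral {x..y} (\<lambda>r. 2 * g r (v r - v c))) \<le> integral {x..y} F"
      by (rule integral_norm_bound_integral[OF gi F']) (use xy I pt in auto)
    also have "\<dots> \<le> integral {a..b} F"
      by (rule integral_subset_le[OF _ F' Fi]) (use xy F0 in auto)
    finally show ?thesis using FI by simp
  qed
  have eq: "integral {x..y} (\<lambda>r. 2 * g r (v r - v c)) = 2 * integral {x..y} (\<lambda>r. g r (v r)) - 2 * integral {x..y} (\<lambda>r. g r (v c))"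
    if "x \<in> {0<..<T}" "y \<in> {0<..<T}" for x y
    using hk_integrable[OF gv_integrable that] hk_integrable[OF g_integrable[OF v_mem] that, of c]
    by (simp add: g_diff v_mem Henstock_Kurzweil_Integration.integral_diff)
  have sq: "nH (\<lambda>x. v p x - v q x) \<le> sqrt (energy_mass b - energy_mass a)"
    if "(nH (v p))\<^sup>2 - 2 * ip (v p) (v q) + (nH (v q))\<^sup>2 = z" "\<bar>z\<bar> \<le> energy_mass b - energy_mass a" for p q z
    using that by (intro real_le_rsqrt) (simp add: L2_norm_diff_sq[OF v_L2 v_L2])
  \<comment> \<open>|v b - v c|^2 = (|v b|^2 - |v c|^2) - 2 (v b - v c, v c) combines the energy
    identity with a tested increment. Below, |v c - v a|^2 = 2 (v c - v a, v c) - (|v c|^2 - |v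
    a|^2), so that again only \<open>v c\<close> is a test element.\<close>
  have "nH (\<lambda>x. v b x - v c x) \<le> sqrt (energy_mass b - energy_mass a)"
  proof (rule sq)
    show "(nH (v b))\<^sup>2 - 2 * ip (v b) (v c) + (nH (v c))\<^sup>2 = integral {c..b} (\<lambda>r. 2 * g r (v r - v c))"
      using energy_identity_good[OF c(1) ab(2)] P_id[OF c(1) ab(2) c(1)] c(3) eq[OF cI I(2)]
      by (simp add: L2_inner_self)
  qed (rule sub, use c in auto)
  moreover have "nH (\<lambda>x. v c x - v a x) \<le> sqrt (energy_mass b - energy_mass a)"
  proof (rule sq)
    show "(nH (v c))\<^sup>2 - 2 * ip (v c) (v a) + (nH (v a))\<^sup>2 = - integral {a..c} (\<lambda>r. 2 * g r (v r - v c))"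
      using energy_identity_good[OF ab(1) c(1)] P_id[OF ab(1) c(1) c(1)] c(2) eq[OF I(1) cI]
      by (simp add: L2_inner_self L2_inner_commute[of \<Omega> "v a" "v c"])
    show "\<bar>- integral {a..c} (\<lambda>r. 2 * g r (v r - v c))\<bar> \<le> energy_mass b - energy_mass a"
      using sub[of a c] c by simp
  qed
  ultimately show ?thesis
    using L2_norm_triangle3[OF v_L2 v_L2 v_L2, of b a c] by linarith
qed

lemma good_diff_bound':
  assumes "a \<in> P" "b \<in> P"
  shows "nH (\<lambda>x. v b x - v a x) \<le> 2 * sqrt \<bar>energy_mass b - energy_mass a\<bar>"
proof -
  consider "a < b" | "b < a" | "a = b" by linarith
  then show ?thesis
  proof cases
    case 1
    then show ?thesis
      using good_diff_bound[OF assms 1] energy_mass_mono[of a b] PI[OF assms(1)] PI[OF assms(2)] by simp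
  next
    case 2
    then show ?thesis
      using good_diff_bound[OF assms(2,1) 2] energy_mass_mono[of b a] PI[OF assms(1)] PI[OF assms(2)]
        L2_norm_minus_commute[of \<Omega> "v b" "v a"] by (simp add: abs_minus_commute)
  next
    case 3
    then show ?thesis by (simp add: L2_norm_def)
  qed
qed

lemma P_dense: "{0..T} \<subseteq> closure P"
  by (rule conull_dense[OF T P_null])

text \<open>Good times along which \<open>energy_mass\<close> approaches its value at
  \<open>t\<close> give a Cauchy sequence by the increment bound. The bound survives the limit, so
  it holds against every good time \<open>s\<close>, independently of the sequence.\<close>

lemma exists_limit:
  assumes t: "t \<in> {0..T}"
  shows "\<exists>c. c \<in> L2 \<Omega> \<and> (\<forall>s\<in>P. nH (\<lambda>x. v s x - c x) \<le> 2 * sqrt \<bar>energy_mass s - energy_mass t\<bar>)"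
proof -
  have "\<exists>p\<in>P. \<bar>energy_mass p - energy_mass t\<bar> < e" if e: "0 < e" for e
  proof -
    obtain d where d: "0 < d" "\<And>s. s \<in> {0..T} \<Longrightarrow> dist s t < d \<Longrightarrow> dist (energy_mass s) (energy_mass t) < e"
      using energy_mass_cont t e unfolding continuous_on_iff by blast
    obtain p where p: "p \<in> P" "dist p t < d"
      using P_dense t d(1) unfolding closure_approachable[symmetric] by (meson closure_approachable subsetD)
    then have "p \<in> {0..T}" using PI[OF p(1)] by simp
    then show ?thesis using d(2)[of p] p by (auto simp: dist_real_def)
  qed
  \<comment> \<open>Two consecutive errors add up to at most 4^-k / 4, with root 2^-k / 2; the
    factor 2 of the increment bound then gives the rate 2^-k required by
    \<open>L2_complete\<close>.\<close>
  then have "\<forall>k. \<exists>p. p \<in> P \<and> \<bar>energy_mass p - energy_mass t\<bar> < ((1/2) ^ k)\<^sup>2 / 8"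
    by (metis zero_less_divide_iff zero_less_numeral zero_less_power zero_less_one)
  then obtain p where p: "\<And>k::nat. p k \<in> P" "\<And>k. \<bar>energy_mass (p k) - energy_mass t\<bar> < ((1/2) ^ k)\<^sup>2 / 8"
    by metis
  obtain c where c: "c \<in> L2 \<Omega>" "(\<lambda>k. nH (\<lambda>x. v (p k) x - c x)) \<longlonglongrightarrow> 0"
  proof (rule L2_complete[OF dom_lmeasurable, of "\<lambda>k. v (p k)"])
    show "v (p k) \<in> L2 \<Omega>" for k by (rule v_L2)
    fix k
    have "((1/2) ^ Suc k)\<^sup>2 \<le> ((1/2::real) ^ k)\<^sup>2" by (intro power_mono power_decreasing) auto
    then have "\<bar>energy_mass (p (Suc k)) - energy_mass (p k)\<bar> \<le> ((1/2) ^ k)\<^sup>2 / 4"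
      using p(2)[of k] p(2)[of "Suc k"] by linarith
    then have "sqrt \<bar>energy_mass (p (Suc k)) - energy_mass (p k)\<bar> \<le> sqrt (((1/2) ^ k)\<^sup>2 / 4)"
      by (rule real_sqrt_le_mono)
    also have "\<dots> = (1/2) ^ k / 2" by (simp add: real_sqrt_divide)
    finally show "nH (\<lambda>x. v (p (Suc k)) x - v (p k) x) \<le> (1/2) ^ k"
      using good_diff_bound'[OF p(1)[of k] p(1)[of "Suc k"]] by simp
  qed
  have lim: "(\<lambda>k. energy_mass (p k)) \<longlonglongrightarrow> energy_mass t"
  proof -
    have z: "(\<lambda>k. ((1/2::real) ^ k)\<^sup>2 / 8) \<longlonglongrightarrow> 0\<^sup>2 / 8"
      by (intro tendsto_intros LIMSEQ_power_zero) auto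
    then have z: "(\<lambda>k. ((1/2::real) ^ k)\<^sup>2 / 8) \<longlonglongrightarrow> 0" by simp
    have "(\<lambda>k. energy_mass (p k) - energy_mass t) \<longlonglongrightarrow> 0"
      by (rule Lim_null_comparison[OF always_eventually z]) (use p(2) in \<open>auto intro: less_imp_le\<close>)
    then show ?thesis by (rule LIM_zero_cancel)
  qed
  show ?thesis
  proof (intro exI conjI ballI)
    show "c \<in> L2 \<Omega>" by fact
    fix s assume s: "s \<in> P"
    have l: "(\<lambda>k. 2 * sqrt \<bar>energy_mass s - energy_mass (p k)\<bar> + nH (\<lambda>x. v (p k) x - c x)) \<longlonglongrightarrow>
      2 * sqrt \<bar>energy_mass s - energy_mass t\<bar> + 0"
      by (intro tendsto_intros lim c(2))
    have "nH (\<lambda>x. v s x - c x) \<le> 2 * sqrt \<bar>energy_mass s - energy_mass (p k)\<bar> + nH (\<lambda>x. v (p k) x - c x)" for k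
      using L2_norm_triangle3[OF v_L2 v_L2 c(1), of s "p k"] good_diff_bound'[OF p(1)[of k] s] by linarith
    then have "nH (\<lambda>x. v s x - c x) \<le> 2 * sqrt \<bar>energy_mass s - energy_mass t\<bar> + 0"
      by (intro LIMSEQ_le_const[OF l]) blast
    then show "nH (\<lambda>x. v s x - c x) \<le> 2 * sqrt \<bar>energy_mass s - energy_mass t\<bar>" by simp
  qed
qed

text \<open>The limits at all times inherit the modulus of continuity by density of
  \<open>P\<close>, and agree with \<open>v\<close> at good times. Identity and continuity then
  extend to the end points, which are not good times themselves.\<close>

lemma energy_cont_rep_good:
  "\<exists>c. is_cont_rep T \<Omega> v c \<and> (nH (c T))\<^sup>2 - (nH (c 0))\<^sup>2 = 2 * (LINT t|M. g t (v t))"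
proof -
  have "\<forall>t\<in>{0..T}. \<exists>c. c \<in> L2 \<Omega> \<and> (\<forall>s\<in>P. nH (\<lambda>x. v s x - c x) \<le> 2 * sqrt \<bar>energy_mass s - energy_mass t\<bar>)"
    using exists_limit by blast
  from bchoice[OF this] obtain c where
    "\<forall>t\<in>{0..T}. c t \<in> L2 \<Omega> \<and> (\<forall>s\<in>P. nH (\<lambda>x. v s x - c t x) \<le> 2 * sqrt \<bar>energy_mass s - energy_mass t\<bar>)" ..
  then have cL: "\<And>t. t \<in> {0..T} \<Longrightarrow> c t \<in> L2 \<Omega>"
    and cb: "\<And>s t. t \<in> {0..T} \<Longrightarrow> s \<in> P \<Longrightarrow> nH (\<lambda>x. v s x - c t x) \<le> 2 * sqrt \<bar>energy_mass s - energy_mass t\<bar>"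
    by blast+
  have cc: "nH (\<lambda>x. c s x - c t x) \<le> 2 * sqrt \<bar>energy_mass s - energy_mass t\<bar>"
    if st: "s \<in> {0..T}" "t \<in> {0..T}" for s t
  proof -
    \<comment> \<open>With \<open>s\<close> and \<open>t\<close> fixed, the bound by
      \<open>?f q\<close> holds at good \<open>q\<close> and passes to the closure by continuity; at
      p = s the first term vanishes.\<close>
    let ?f = "\<lambda>p. 2 * sqrt \<bar>energy_mass p - energy_mass s\<bar> + 2 * sqrt \<bar>energy_mass p - energy_mass t\<bar>"
    have cl: "closure P \<subseteq> {0..T}" by (rule closure_minimal) (use PI in force, simp)
    have "continuous_on (closure P) ?f"
      by (intro continuous_intros continuous_on_subset[OF energy_mass_cont cl])
    then have "nH (\<lambda>x. c s x - c t x) \<le> ?f p" if p: "p \<in> closure P" for p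
    proof (rule continuous_ge_on_closure[OF _ p])
      fix q assume q: "q \<in> P"
      have "nH (\<lambda>x. c s x - v q x) = nH (\<lambda>x. v q x - c s x)" by (rule L2_norm_minus_commute)
      then show "nH (\<lambda>x. c s x - c t x) \<le> ?f q"
        using L2_norm_triangle3[OF cL[OF st(1)] v_L2[of q] cL[OF st(2)]] cb[OF st(1) q] cb[OF st(2) q] by linarith
    qed
    from this[of s] show ?thesis using P_dense st(1) by auto
  qed
  have ae: "AE x in lebesgue_on \<Omega>. c t x = v t x" if t: "t \<in> P" for t
  proof -
    have tI: "t \<in> {0..T}" using PI[OF t] by auto
    have "nH (\<lambda>x. v t x - c t x) = 0"
      using cb[OF tI t] L2_norm_nonneg[of \<Omega> "\<lambda>x. v t x - c t x"] by simp
    then have "AE x in lebesgue_on \<Omega>. v t x - c t x = 0"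
      using L2_norm_eq_0_iff[OF L2_diff[OF v_L2 cL[OF tI]]] by blast
    then show ?thesis by eventually_elim simp
  qed
  have cont: "((\<lambda>s. nH (\<lambda>x. c s x - c t x)) \<longlongrightarrow> 0) (at t within {0..T})" if t: "t \<in> {0..T}" for t
  proof -
    have "((\<lambda>s. 2 * sqrt \<bar>energy_mass s - energy_mass t\<bar>) \<longlongrightarrow> 2 * sqrt \<bar>energy_mass t - energy_mass t\<bar>) (at t within {0..T})"
      using energy_mass_cont t unfolding continuous_on_def by (intro tendsto_intros) auto
    then have l: "((\<lambda>s. 2 * sqrt \<bar>energy_mass s - energy_mass t\<bar>) \<longlongrightarrow> 0) (at t within {0..T})" by simp
    show ?thesis
    proof (rule Lim_null_comparison[OF _ l])
      have "norm (nH (\<lambda>x. c s x - c t x)) \<le> 2 * sqrt \<bar>energy_mass s - energy_mass t\<bar>" if "s \<in> {0..T}" for s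
        using cc[OF that t] L2_norm_nonneg[of \<Omega> "\<lambda>x. c s x - c t x"] by (simp only: real_norm_def abs_of_nonneg)
      then show "\<forall>\<^sub>F s in at t within {0..T}. norm (nH (\<lambda>x. c s x - c t x)) \<le> 2 * sqrt \<bar>energy_mass s - energy_mass t\<bar>"
        unfolding eventually_at_filter by (intro always_eventually) simp
    qed
  qed
  have "AE t in M. t \<in> P"
  proof -
    have "AE t in lebesgue. t \<notin> {0..T} - P"
      using P_null by (intro AE_not_in) (simp add: negligible_iff_null_sets)
    then show ?thesis by (subst AE_restrict_space_iff) (auto elim!: eventually_mono)
  qed
  then have rep: "is_cont_rep T \<Omega> v c"
    unfolding is_cont_rep_def using cL cont by (auto elim!: eventually_mono dest: ae)
  have contn: "continuous_on {0..T} (\<lambda>t. nH (c t))"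
    unfolding continuous_on_def
  proof
    fix t assume t: "t \<in> {0..T}"
    have "((\<lambda>s. nH (c s) - nH (c t)) \<longlongrightarrow> 0) (at t within {0..T})"
    proof (rule Lim_null_comparison[OF _ cont[OF t]])
      have "norm (nH (c s) - nH (c t)) \<le> nH (\<lambda>x. c s x - c t x)" if "s \<in> {0..T}" for s
        using seminormed_set.abs_norm_diff[OF seminormed_set_L2 cL[OF that] cL[OF t]] by (simp add: fun_diff_def)
      then show "\<forall>\<^sub>F s in at t within {0..T}. norm (nH (c s) - nH (c t)) \<le> nH (\<lambda>x. c s x - c t x)"
        unfolding eventually_at_filter by (intro always_eventually) simp
    qed
    then show "((\<lambda>t. nH (c t)) \<longlongrightarrow> nH (c t)) (at t within {0..T})" by (rule LIM_zero_cancel)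
  qed
  \<comment> \<open>The energy defect of the continuous representative: continuous on the closed
    interval and constant on a dense set.\<close>
  define e where "e t = (nH (c t))\<^sup>2 - 2 * integral {0..t} (\<lambda>r. g r (v r))" for t
  have contI: "continuous_on {0..T} (\<lambda>t. integral {0..t} (\<lambda>r. g r (v r)))"
    by (rule indefinite_integral_continuous_1[OF integrable_lebesgue_on_imp_integrable_on[OF gv_integrable]]) auto
  have conte: "continuous_on {0..T} e"
    unfolding e_def by (intro continuous_intros contn contI)
  have cl: "closure P \<subseteq> {0..T}" by (rule closure_minimal) (use PI in force, simp)
  have eP: "e t = energy_defect t" if t: "t \<in> P" for t
  proof -
    have "t \<in> {0..T}" using PI[OF t] by auto
    then have "nH (c t) = nH (v t)" by (intro L2_norm_AE_cong cL v_L2 ae t)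
    then show ?thesis unfolding e_def energy_defect_def by simp
  qed
  obtain p where p: "p \<in> P" using P_dense T by (metis closure_empty atLeastAtMost_iff ex_in_conv less_imp_le order_refl subsetD)
  have "e t = energy_defect p" if t: "t \<in> {0..T}" for t
  proof (rule continuous_constant_on_closure[OF continuous_on_subset[OF conte cl]])
    show "e x = energy_defect p" if "x \<in> P" for x using eP[OF that] energy_defect_const[OF that p] by simp
    show "t \<in> closure P" using P_dense t by blast
  qed
  from this[of 0] this[of T] have "e T = e 0" using T by simp
  then have "(nH (c T))\<^sup>2 - (nH (c 0))\<^sup>2 = 2 * integral {0..T} (\<lambda>r. g r (v r))"
    unfolding e_def by simp
  then show ?thesis using rep LINT_open_interval_eq[OF gv_integrable] by auto
qed

end

lemma energy_cont_rep:
  "\<exists>c. is_cont_rep T \<Omega> v c \<and> (nH (c T))\<^sup>2 - (nH (c 0))\<^sup>2 = 2 * (LINT t|M. g t (v t))"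
  by (rule exists_good_set) (rule energy_cont_rep_good)

end

text \<open>The distance of the two representatives is continuous in time and vanishes at almost
  every, hence at a dense set of times. So \<open>eval_at\<close> is determined up to null sets at
  each time, end points included.\<close>

lemma cont_rep_unique:
  assumes T: "0 < T" and c: "is_cont_rep T \<Omega> v c" and d: "is_cont_rep T \<Omega> v d" and t: "t \<in> {0..T}"
  shows "L2_norm \<Omega> (\<lambda>x. c t x - d t x) = 0"
proof -
  have cL: "c s \<in> L2 \<Omega>" and dL: "d s \<in> L2 \<Omega>" if "s \<in> {0..T}" for s
    using c d that unfolding is_cont_rep_def by blast+
  define f where "f s = L2_norm \<Omega> (\<lambda>x. c s x - d s x)" for s
  have cont: "continuous_on {0..T} f"
    unfolding continuous_on_def
  proof
    fix t assume t: "t \<in> {0..T}"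
    have "((\<lambda>s. L2_norm \<Omega> (\<lambda>x. c s x - c t x) + L2_norm \<Omega> (\<lambda>x. d s x - d t x)) \<longlongrightarrow> 0 + 0) (at t within {0..T})"
      using c d t unfolding is_cont_rep_def by (intro tendsto_add) blast+
    then have l: "((\<lambda>s. L2_norm \<Omega> (\<lambda>x. c s x - c t x) + L2_norm \<Omega> (\<lambda>x. d s x - d t x)) \<longlongrightarrow> 0) (at t within {0..T})"
      by simp
    have "((\<lambda>s. f s - f t) \<longlongrightarrow> 0) (at t within {0..T})"
    proof (rule Lim_null_comparison[OF _ l])
      have "norm (f s - f t) \<le> L2_norm \<Omega> (\<lambda>x. c s x - c t x) + L2_norm \<Omega> (\<lambda>x. d s x - d t x)" if s: "s \<in> {0..T}" for s
      proof -
        have "norm (f s - f t) \<le> L2_norm \<Omega> ((\<lambda>x. c s x - d s x) - (\<lambda>x. c t x - d t x))"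
          unfolding f_def real_norm_def
          by (rule seminormed_set.abs_norm_diff[OF seminormed_set_L2 L2_diff[OF cL[OF s] dL[OF s]] L2_diff[OF cL[OF t] dL[OF t]]])
        also have "(\<lambda>x. c s x - d s x) - (\<lambda>x. c t x - d t x) = (\<lambda>x. (c s x - c t x) - (d s x - d t x))"
          by (simp add: fun_eq_iff)
        also have "L2_norm \<Omega> \<dots> \<le> L2_norm \<Omega> (\<lambda>x. c s x - c t x) + L2_norm \<Omega> (\<lambda>x. d s x - d t x)"
          by (intro L2_norm_triangle_diff L2_diff cL dL s t)
        finally show ?thesis .
      qed
      then show "\<forall>\<^sub>F s in at t within {0..T}. norm (f s - f t) \<le> L2_norm \<Omega> (\<lambda>x. c s x - c t x) + L2_norm \<Omega> (\<lambda>x. d s x - d t x)"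
        unfolding eventually_at_filter by (intro always_eventually) simp
    qed
    then show "(f \<longlongrightarrow> f t) (at t within {0..T})" by (rule LIM_zero_cancel)
  qed
  have "AE t in lebesgue_on {0<..<T}. AE x in lebesgue_on \<Omega>. c t x = v t x"
    "AE t in lebesgue_on {0<..<T}. AE x in lebesgue_on \<Omega>. d t x = v t x"
    using c d unfolding is_cont_rep_def by blast+
  then have ae: "AE t in lebesgue_on {0<..<T}. AE x in lebesgue_on \<Omega>. c t x - d t x = 0"
    by eventually_elim (elim AE_mp, auto)
  define S where "S = {t \<in> {0<..<T}. AE x in lebesgue_on \<Omega>. c t x - d t x = 0}"
  have null: "negligible ({0..T} - S)" unfolding S_def by (rule negligible_interval_Diff[OF ae])
  have dense: "t \<in> closure S" using conull_dense[OF T null] t by blast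
  have S: "S \<subseteq> {0..T}" unfolding S_def by auto
  have cl: "closure S \<subseteq> {0..T}" by (rule closure_minimal[OF S]) simp
  have "f t = 0"
  proof (rule continuous_constant_on_closure[OF continuous_on_subset[OF cont cl] _ dense])
    fix s assume s: "s \<in> S"
    then have sI: "s \<in> {0..T}" using S by blast
    show "f s = 0"
      unfolding f_def using s L2_norm_eq_0_iff[OF L2_diff[OF cL[OF sI] dL[OF sI]]] unfolding S_def by blast
  qed
  then show ?thesis unfolding f_def .
qed

lemma cont_rep_diff:
  assumes c: "is_cont_rep T \<Omega> v c" and d: "is_cont_rep T \<Omega> w d"
  shows "is_cont_rep T \<Omega> (\<lambda>t x. v t x - w t x) (\<lambda>t x. c t x - d t x)"
  unfolding is_cont_rep_def
proof (intro conjI ballI)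
  have cL: "c s \<in> L2 \<Omega>" and dL: "d s \<in> L2 \<Omega>" if "s \<in> {0..T}" for s
    using c d that unfolding is_cont_rep_def by blast+
  fix t assume t: "t \<in> {0..T}"
  show "(\<lambda>x. c t x - d t x) \<in> L2 \<Omega>" by (rule L2_diff[OF cL[OF t] dL[OF t]])
  have "((\<lambda>s. L2_norm \<Omega> (\<lambda>x. c s x - c t x) + L2_norm \<Omega> (\<lambda>x. d s x - d t x)) \<longlongrightarrow> 0 + 0) (at t within {0..T})"
    using c d t unfolding is_cont_rep_def by (intro tendsto_add) blast+
  then have l: "((\<lambda>s. L2_norm \<Omega> (\<lambda>x. c s x - c t x) + L2_norm \<Omega> (\<lambda>x. d s x - d t x)) \<longlongrightarrow> 0) (at t within {0..T})"
    by simp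
  show "((\<lambda>s. L2_norm \<Omega> (\<lambda>x. (c s x - d s x) - (c t x - d t x))) \<longlongrightarrow> 0) (at t within {0..T})"
  proof (rule Lim_null_comparison[OF _ l])
    have "norm (L2_norm \<Omega> (\<lambda>x. (c s x - d s x) - (c t x - d t x))) \<le>
      L2_norm \<Omega> (\<lambda>x. c s x - c t x) + L2_norm \<Omega> (\<lambda>x. d s x - d t x)" if s: "s \<in> {0..T}" for s
    proof -
      have "(\<lambda>x. (c s x - d s x) - (c t x - d t x)) = (\<lambda>x. (c s x - c t x) - (d s x - d t x))"
        by (simp add: fun_eq_iff)
      then show ?thesis
        using L2_norm_triangle_diff[OF L2_diff[OF cL[OF s] cL[OF t]] L2_diff[OF dL[OF s] dL[OF t]]]
          L2_norm_nonneg[of \<Omega> "\<lambda>x. (c s x - c t x) - (d s x - d t x)"] by simp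
    qed
    then show "\<forall>\<^sub>F s in at t within {0..T}. norm (L2_norm \<Omega> (\<lambda>x. (c s x - d s x) - (c t x - d t x))) \<le>
      L2_norm \<Omega> (\<lambda>x. c s x - c t x) + L2_norm \<Omega> (\<lambda>x. d s x - d t x)"
      unfolding eventually_at_filter by (intro always_eventually) simp
  qed
next
  have "AE t in lebesgue_on {0<..<T}. AE x in lebesgue_on \<Omega>. c t x = v t x"
    "AE t in lebesgue_on {0<..<T}. AE x in lebesgue_on \<Omega>. d t x = w t x"
    using c d unfolding is_cont_rep_def by blast+
  then show "AE t in lebesgue_on {0<..<T}. AE x in lebesgue_on \<Omega>. c t x - d t x = v t x - w t x"
    by eventually_elim (elim AE_mp, auto)
qed

text \<open>Integrability is asked of one side alone; the other side, often built from choices, gets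
  its measurability from completeness.\<close>

lemma lebesgue_on_AE_cong:
  fixes f g :: "'a::euclidean_space \<Rightarrow> real"
  assumes S: "S \<in> sets lebesgue" and ae: "AE x in lebesgue_on S. f x = g x" and g: "integrable (lebesgue_on S) g"
  shows "integrable (lebesgue_on S) f" "(LINT x|lebesgue_on S. f x) = (LINT x|lebesgue_on S. g x)"
proof -
  have ae': "AE x in lebesgue_on S. g x = f x" using ae by eventually_elim simp
  have f: "f \<in> borel_measurable (lebesgue_on S)"
    by (rule AE_eq_borel_measurable_lebesgue_on[OF S borel_measurable_integrable[OF g] ae'])
  show "integrable (lebesgue_on S) f" by (rule integrable_cong_AE_imp[OF g f ae'])
  show "(LINT x|lebesgue_on S. f x) = (LINT x|lebesgue_on S. g x)"
    by (rule integral_cong_AE[OF f borel_measurable_integrable[OF g] ae])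
qed

context bounded_open
begin

lemma bochner_W12_0_L2:
  assumes "I \<in> sets lebesgue" "v \<in> bochner_L2 I (W12_0 \<Omega>) (W12_norm \<Omega>)"
  shows "v \<in> bochner_L2 I (L2 \<Omega>) (L2_norm \<Omega>)"
  by (rule bochner_map[OF seminormed_set_W12_0 seminormed_set_L2 assms, where K = 1 and L = "\<lambda>x. x"])
    (simp_all add: W12_0_L2 L2_norm_le_W12_norm)

text \<open>The representatives are set to 0 on a null set of times to meet the pointwise demands of
  \<open>evolution\<close>; weak derivative, continuous representative and integral do not
  notice.\<close>

lemma energy_identity:
  assumes T: "0 < T" and v: "v \<in> L2_V T \<Omega>" and g: "g \<in> L2_Vdual T \<Omega>" and td: "is_time_deriv T \<Omega> v g"
  shows "\<exists>c. is_cont_rep T \<Omega> v c \<and>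
    (L2_norm \<Omega> (c T))\<^sup>2 - (L2_norm \<Omega> (c 0))\<^sup>2 = 2 * (LINT t|lebesgue_on {0<..<T}. g t (v t))"
proof -
  let ?I = "{0<..<T}"
  let ?M = "lebesgue_on ?I"
  have Is: "?I \<in> sets lebesgue" and Im: "?I \<in> lmeasurable" by (simp, metis box_real(1) lmeasurable_box)
  have v: "v \<in> bochner_L2 ?I (W12_0 \<Omega>) (W12_norm \<Omega>)" using v unfolding L2_V_def .
  have g: "g \<in> bochner_L2 ?I (W12_dual \<Omega>) (dual_norm \<Omega>)" using g unfolding L2_Vdual_def .
  define v' where "v' t = (if v t \<in> W12_0 \<Omega> then v t else (\<lambda>_. 0))" for t
  define g' where "g' t = (if g t \<in> W12_dual \<Omega> then g t else (\<lambda>_. 0))" for t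
  have "AE t in ?M. v t \<in> W12_0 \<Omega>" using v unfolding bochner_L2_def by blast
  then have vv: "AE t in ?M. v t = v' t" by eventually_elim (simp add: v'_def)
  have "AE t in ?M. g t \<in> W12_dual \<Omega>" using g unfolding bochner_L2_def by blast
  then have gg: "AE t in ?M. g t = g' t" by eventually_elim (simp add: g'_def)
  have v': "v' \<in> bochner_L2 ?I (W12_0 \<Omega>) (W12_norm \<Omega>)"
    by (rule seminormed_set.bochner_AE_cong[OF seminormed_set_W12_0 v Is vv])
  have g': "g' \<in> bochner_L2 ?I (W12_dual \<Omega>) (dual_norm \<Omega>)"
    by (rule seminormed_set.bochner_AE_cong[OF seminormed_set_W12_dual g Is gg])
  have td': "is_time_deriv T \<Omega> v' g'"
    unfolding is_time_deriv_def
  proof (intro ballI)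
    fix \<phi> :: "real \<Rightarrow> real" and w
    assume \<phi>: "\<phi> \<in> test_funs ?I" and w: "w \<in> W12_0 \<Omega>"
    have "integrable ?M (\<lambda>t. deriv \<phi> t * L2_inner \<Omega> (v t) w)"
      by (intro test_fun_product_integrable test_fun_deriv(2)[OF \<phi>]
          bochner_L2_inner[OF Is bochner_W12_0_L2[OF Is v]] seminormed_set.bochner_const[OF seminormed_set_L2 Im W12_0_L2[OF w]])
    then have "(LINT t|?M. deriv \<phi> t * L2_inner \<Omega> (v' t) w) = (LINT t|?M. deriv \<phi> t * L2_inner \<Omega> (v t) w)"
      by (rule lebesgue_on_AE_cong(2)[OF Is, rotated]) (use vv in \<open>eventually_elim, simp\<close>)
    also have "\<dots> = - (LINT t|?M. \<phi> t * g t w)"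
      using td \<phi> w unfolding is_time_deriv_def by blast
    also have "(LINT t|?M. \<phi> t * g t w) = (LINT t|?M. \<phi> t * g' t w)"
    proof (rule lebesgue_on_AE_cong(2)[OF Is])
      show "integrable ?M (\<lambda>t. \<phi> t * g' t w)"
        by (intro test_fun_product_integrable test_fun_deriv(3)[OF \<phi>]
            bochner_dual_pairing[OF Is g'] seminormed_set.bochner_const[OF seminormed_set_W12_0 Im w])
    qed (use gg in \<open>eventually_elim, simp\<close>)
    finally show "(LINT t|?M. deriv \<phi> t * L2_inner \<Omega> (v' t) w) = - (LINT t|?M. \<phi> t * g' t w)" .
  qed
  interpret evolution \<Omega> T v' g'
  proof
    show "v' t \<in> W12_0 \<Omega>" for t unfolding v'_def using W12_0_zero by simp
    show "g' t \<in> W12_dual \<Omega>" for t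
      unfolding g'_def using seminormed_set.zero[OF seminormed_set_W12_dual] by simp
  qed (fact T v' g' td')+
  obtain c where c: "is_cont_rep T \<Omega> v' c" "(L2_norm \<Omega> (c T))\<^sup>2 - (L2_norm \<Omega> (c 0))\<^sup>2 = 2 * (LINT t|?M. g' t (v' t))"
    using energy_cont_rep by blast
  have "AE t in ?M. AE x in lebesgue_on \<Omega>. c t x = v t x"
  proof -
    have "AE t in ?M. AE x in lebesgue_on \<Omega>. c t x = v' t x" using c(1) unfolding is_cont_rep_def by blast
    then show ?thesis using vv by eventually_elim simp
  qed
  then have "is_cont_rep T \<Omega> v c" using c(1) unfolding is_cont_rep_def by blast
  moreover have "(LINT t|?M. g t (v t)) = (LINT t|?M. g' t (v' t))"
    by (rule lebesgue_on_AE_cong(2)[OF Is _ bochner_dual_pairing[OF Is g' v']]) (use vv gg in \<open>eventually_elim, simp\<close>)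
  ultimately show ?thesis using c(2) by auto
qed

text \<open>Existence makes the choice in \<open>eval_at\<close> succeed, and uniqueness transfers
  the energy identity from the constructed representative to the chosen one.\<close>

lemma eval_at_cont_rep:
  assumes T: "0 < T" and v: "v \<in> L2_V T \<Omega>" and g: "g \<in> L2_Vdual T \<Omega>" and td: "is_time_deriv T \<Omega> v g"
  shows "is_cont_rep T \<Omega> v (eval_at T \<Omega> v)"
    and "(L2_norm \<Omega> (eval_at T \<Omega> v T))\<^sup>2 - (L2_norm \<Omega> (eval_at T \<Omega> v 0))\<^sup>2 =
      2 * (LINT t|lebesgue_on {0<..<T}. g t (v t))"
proof -
  obtain c where c: "is_cont_rep T \<Omega> v c" "(L2_norm \<Omega> (c T))\<^sup>2 - (L2_norm \<Omega> (c 0))\<^sup>2 = 2 * (LINT t|lebesgue_on {0<..<T}. g t (v t))"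
    using energy_identity[OF assms] by blast
  show e: "is_cont_rep T \<Omega> v (eval_at T \<Omega> v)"
    unfolding eval_at_def by (rule someI[where P = "is_cont_rep T \<Omega> v"]) (rule c(1))
  have "L2_norm \<Omega> (eval_at T \<Omega> v t) = L2_norm \<Omega> (c t)" if t: "t \<in> {0..T}" for t
  proof -
    have L: "eval_at T \<Omega> v t \<in> L2 \<Omega>" "c t \<in> L2 \<Omega>" using e c(1) t unfolding is_cont_rep_def by blast+
    show ?thesis
      using seminormed_set.abs_norm_diff[OF seminormed_set_L2 L] cont_rep_unique[OF T e c(1) t]
      by (simp add: fun_diff_def)
  qed
  from this[of T] this[of 0] show "(L2_norm \<Omega> (eval_at T \<Omega> v T))\<^sup>2 - (L2_norm \<Omega> (eval_at T \<Omega> v 0))\<^sup>2 =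
      2 * (LINT t|lebesgue_on {0<..<T}. g t (v t))"
    using c(2) T by simp
qed

end

subsection \<open>Linear elasticity\<close>

lemma trace_scaleR: "trace (c *\<^sub>R A) = c * trace (A :: real^'n^'n)"
  by (simp add: trace_def sum_distrib_left)

lemma inner_mat_1: "A \<bullet> mat 1 = trace (A :: real^'n^'n)"
proof -
  have "A $ i \<bullet> (mat 1 :: real^'n^'n) $ i = A $ i $ i" for i
    by (simp add: inner_vec_def mat_def if_distrib[of "\<lambda>x. _ * x"] cong: if_cong)
  then show ?thesis by (simp add: inner_vec_def[of A] trace_def)
qed

text \<open>Cauchy-Schwarz against the identity matrix, whose squared Frobenius norm is the
  dimension; equality holds on its multiples.\<close>

lemma trace_sq_le: "(trace A)\<^sup>2 \<le> real CARD('n) * (A \<bullet> A)" for A :: "real^'n^'n"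
proof -
  have "(A \<bullet> mat 1)\<^sup>2 \<le> (A \<bullet> A) * (mat 1 \<bullet> (mat 1 :: real^'n^'n))" by (rule Cauchy_Schwarz_ineq)
  then show ?thesis by (simp add: inner_mat_1 trace_I mult.commute)
qed

lemma inner_transpose: "transpose A \<bullet> transpose B = A \<bullet> (B :: real^'n^'n)"
  unfolding inner_vec_def transpose_def by (simp, rule sum.swap)

lemma transpose_add: "transpose (A + B) = transpose A + transpose (B :: real^'n^'n)"
  by (simp add: transpose_def vec_eq_iff)

lemma linear_sym_part: "linear (sym_part :: real^'n^'n \<Rightarrow> _)"
  by (rule linearI) (simp_all add: sym_part_def transpose_add transpose_scalar algebra_simps)

lemma sym_part_sym: "sym_part A \<in> sym_mats"
  by (simp add: sym_part_def sym_mats_def transpose_add transpose_scalar transpose_transpose add.commute)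

lemma inner_sym_part:
  assumes "A \<in> sym_mats"
  shows "A \<bullet> sym_part B = A \<bullet> B"
proof -
  have "A \<bullet> transpose B = A \<bullet> B"
    using inner_transpose[of A B] assms by (simp add: sym_mats_def)
  then show ?thesis by (simp add: sym_part_def inner_add_right)
qed

lemma sym_mats_add: "A \<in> sym_mats \<Longrightarrow> B \<in> sym_mats \<Longrightarrow> A + B \<in> sym_mats"
  by (simp add: sym_mats_def transpose_add)

lemma sym_mats_scaleR: "A \<in> sym_mats \<Longrightarrow> c *\<^sub>R A \<in> sym_mats"
  by (simp add: sym_mats_def transpose_scalar)

lemma sym_mats_diff: "A \<in> sym_mats \<Longrightarrow> B \<in> sym_mats \<Longrightarrow> A - B \<in> sym_mats"
  using sym_mats_add[of A "(-1) *\<^sub>R B"] sym_mats_scaleR[of B "-1"] by simp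

lemma sym_mats_mat: "mat c \<in> sym_mats"
  by (simp add: sym_mats_def transpose_mat)

lemma linear_elast: "linear (elast \<mu> \<kappa>)"
  by (rule linearI) (simp_all add: elast_def trace_add trace_scaleR algebra_simps)

lemma elast_sym: "A \<in> sym_mats \<Longrightarrow> elast \<mu> \<kappa> A \<in> sym_mats"
  unfolding elast_def by (intro sym_mats_add sym_mats_scaleR sym_mats_mat)

lemma elast_inner: "elast \<mu> \<kappa> A \<bullet> B = 2 * \<mu> * (A \<bullet> B) + \<kappa> * trace A * trace B"
  by (simp add: elast_def inner_add_left inner_commute[of "mat 1"] inner_mat_1)

text \<open>\<open>a \<mapsto> 2 \<mu> a + \<kappa> tr a I\<close> acts as multiplication by \<open>2 \<mu>\<close> on trace-free matrices and by
  \<open>2 \<mu> + d \<kappa>\<close> on multiples of the identity; the parameters of powers of it are read off from this.\<close>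

lemma elast_elast:
  fixes A :: "real^'n^'n"
  shows "elast \<mu> \<kappa> (elast \<mu>' \<kappa>' A) =
    elast (2 * \<mu> * \<mu>') (2 * \<mu> * \<kappa>' + 2 * \<kappa> * \<mu>' + real CARD('n) * \<kappa> * \<kappa>') A"
  by (simp add: elast_def trace_add trace_scaleR trace_I algebra_simps)

section \<open>Square root and inverse of the elasticity tensor\<close>

locale lame =
  fixes \<mu> \<kappa> :: real and dim :: "'n::finite itself"
  assumes \<mu>: "0 < \<mu>" and \<kappa>: "- (2 / real CARD('n)) * \<mu> < \<kappa>"
begin

abbreviation "C \<equiv> elast \<mu> \<kappa> :: real^'n^'n \<Rightarrow> real^'n^'n"
abbreviation "B \<equiv> elast_sqrt \<mu> \<kappa> :: real^'n^'n \<Rightarrow> real^'n^'n"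

text \<open>This is the eigenvalue of \<open>C\<close> on multiples of the identity, so the
  hypothesis on \<kappa> is positivity in that direction.\<close>

lemma bulk_pos: "0 < 2 * \<mu> + real CARD('n) * \<kappa>"
proof -
  have "real CARD('n) * (- (2 / real CARD('n)) * \<mu>) < real CARD('n) * \<kappa>"
    using \<kappa> by (intro mult_strict_left_mono) auto
  then show ?thesis by simp
qed

text \<open>A square root exists within the same two-parameter family: its eigenvalues are b = sqrt
  (2 \<mu>) on trace-free matrices and s = sqrt (2 \<mu> + d \<kappa>) on multiples of the identity,
  hence the parameters b / 2 and \<beta> = (s - b) / d. This witness makes the choice in
  \<open>sqrt_map\<close> succeed; from then on only the defining properties of the chosen map
  enter.\<close>

lemma elast_sqrt: "pos_def_on sym_mats B" "A \<in> sym_mats \<Longrightarrow> B (B A) = C A"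
proof -
  define d where "d = real CARD('n)"
  have d: "0 < d" unfolding d_def by simp
  define b where "b = sqrt (2 * \<mu>)"
  define s where "s = sqrt (2 * \<mu> + d * \<kappa>)"
  define \<beta> where "\<beta> = (s - b) / d"
  have b: "0 < b" "b\<^sup>2 = 2 * \<mu>" using \<mu> unfolding b_def by simp_all
  have s: "0 < s" "s\<^sup>2 = 2 * \<mu> + d * \<kappa>" using bulk_pos unfolding s_def d_def by simp_all
  have sb: "s = b + d * \<beta>" using d unfolding \<beta>_def by simp
  have "d * (2 * b * \<beta> + d * \<beta> * \<beta>) = s\<^sup>2 - b\<^sup>2"
    unfolding sb by (simp add: power2_eq_square algebra_simps)
  then have "d * (2 * b * \<beta> + d * \<beta> * \<beta>) = d * \<kappa>" using s b by simp
  then have \<kappa>eq: "2 * b * \<beta> + d * \<beta> * \<beta> = \<kappa>" using d by simp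
  let ?B = "elast (b / 2) \<beta> :: real^'n^'n \<Rightarrow> real^'n^'n"
  have pos: "0 < ?B a \<bullet> a" if "a \<noteq> 0" for a
  proof -
    have e: "?B a \<bullet> a = b * (a \<bullet> a) + \<beta> * (trace a)\<^sup>2"
      by (simp add: elast_inner power2_eq_square)
    have a: "0 < a \<bullet> a" using that by simp
    show ?thesis
    proof (cases "0 \<le> \<beta>")
      case True
      then show ?thesis unfolding e using a b by (intro add_pos_nonneg mult_pos_pos mult_nonneg_nonneg) auto
    next
      case False
      \<comment> \<open>For negative \<beta> the trace term is worst on multiples of the identity,
        where \<open>trace_sq_le\<close> is sharp and the eigenvalue is \<open>s\<close>.\<close>
      have "0 < s * (a \<bullet> a)" using a s by simp
      also have "\<dots> = b * (a \<bullet> a) + \<beta> * (d * (a \<bullet> a))" unfolding sb by (simp add: algebra_simps)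
      also have "\<dots> \<le> b * (a \<bullet> a) + \<beta> * (trace a)\<^sup>2"
        using False trace_sq_le[of a] unfolding d_def by (intro add_left_mono mult_left_mono_neg) auto
      finally show ?thesis unfolding e .
    qed
  qed
  have "pos_def_on sym_mats ?B"
    unfolding pos_def_on_def
  proof (intro conjI ballI impI)
    show "?B ` sym_mats \<subseteq> sym_mats" using elast_sym by blast
    show "?B a \<bullet> c = a \<bullet> ?B c" for a c by (simp add: elast_inner inner_commute[of a "?B c"] inner_commute[of a c])
  qed (use linear_elast pos in auto)
  moreover have "?B (?B a) = C a" for a
    unfolding elast_elast d_def[symmetric] using b \<kappa>eq by (simp add: power2_eq_square mult_ac)
  ultimately have "\<exists>B. pos_def_on sym_mats B \<and> (\<forall>a\<in>sym_mats. B (B a) = C a)" by blast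
  from someI_ex[OF this] show "pos_def_on sym_mats B" "A \<in> sym_mats \<Longrightarrow> B (B A) = C A"
    unfolding elast_sqrt_def sqrt_map_def by blast+
qed

lemma B_linear: "linear B" and B_sym: "a \<in> sym_mats \<Longrightarrow> B a \<in> sym_mats"
  and B_self_adjoint: "a \<in> sym_mats \<Longrightarrow> c \<in> sym_mats \<Longrightarrow> B a \<bullet> c = a \<bullet> B c"
  and B_pos: "a \<in> sym_mats \<Longrightarrow> a \<noteq> 0 \<Longrightarrow> 0 < B a \<bullet> a"
  using elast_sqrt(1) unfolding pos_def_on_def by blast+

text \<open>The inverse of \<open>C\<close> in the same family, with eigenvalues 1 / (2 \<mu>) and 1
  / (2 \<mu> + d \<kappa>); the second parameter is the difference of these divided by d.\<close>

definition Cinv :: "real^'n^'n \<Rightarrow> real^'n^'n" where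
  "Cinv = elast (1 / (4 * \<mu>)) (- \<kappa> / (2 * \<mu> * (2 * \<mu> + real CARD('n) * \<kappa>)))"

lemma C_Cinv: "C (Cinv a) = a" and Cinv_C: "Cinv (C a) = a"
proof -
  define D where "D = 2 * \<mu> + real CARD('n) * \<kappa>"
  have D: "0 < D" using bulk_pos unfolding D_def .
  have n: "real CARD('n) * \<kappa> = D - 2 * \<mu>" unfolding D_def by simp
  have "2 * \<mu> * (- \<kappa> / (2 * \<mu> * D)) + 2 * \<kappa> * (1 / (4 * \<mu>)) + real CARD('n) * \<kappa> * (- \<kappa> / (2 * \<mu> * D)) = 0"
    unfolding n using \<mu> D by (simp add: field_simps)
  then have z: "2 * \<mu> * (- \<kappa> / (2 * \<mu> * D)) + 2 * \<kappa> * (1 / (4 * \<mu>)) + real CARD('n) * \<kappa> * (- \<kappa> / (2 * \<mu> * D)) = 0" .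
  have o: "2 * \<mu> * (1 / (4 * \<mu>)) = 1 / 2" using \<mu> by simp
  have id: "elast (1 / 2) 0 a = a" by (simp add: elast_def)
  show "C (Cinv a) = a" unfolding Cinv_def elast_elast D_def[symmetric] z o by (rule id)
  have swap: "2 * q * \<kappa> + 2 * E * \<mu> + real CARD('n) * E * \<kappa> = 2 * \<mu> * E + 2 * \<kappa> * q + real CARD('n) * \<kappa> * E" for q E :: real
    by (simp add: algebra_simps)
  have z': "2 * (1 / (4 * \<mu>)) * \<kappa> + 2 * (- \<kappa> / (2 * \<mu> * D)) * \<mu> + real CARD('n) * (- \<kappa> / (2 * \<mu> * D)) * \<kappa> = 0"
    by (rule trans[OF swap z])
  have o': "2 * (1 / (4 * \<mu>)) * \<mu> = 1 / 2" using \<mu> by simp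
  show "Cinv (C a) = a" unfolding Cinv_def elast_elast D_def[symmetric] z' o' by (rule id)
qed

text \<open>The power -1/2 as the product of the powers 1/2 and -1. Unlike \<open>inv_into\<close>,
  the right-hand side is linear on all matrices, so the rules for linear maps of Bochner functions
  apply to it.\<close>

lemma elast_inv_sqrt_eq:
  assumes x: "x \<in> sym_mats"
  shows "elast_inv_sqrt \<mu> \<kappa> x = B (Cinv x)"
proof -
  have inj: "inj_on B sym_mats"
  proof (rule inj_onI)
    fix a c assume ac: "a \<in> sym_mats" "c \<in> sym_mats" "B a = B c"
    then have "B (a - c) = 0" by (simp add: linear_diff[OF B_linear])
    then show "a = c" using B_pos[OF sym_mats_diff[OF ac(1,2)]] by force
  qed
  have s: "Cinv x \<in> sym_mats" unfolding Cinv_def by (rule elast_sym[OF x])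
  have "B (B (Cinv x)) = x" using elast_sqrt(2)[OF s] C_Cinv by simp
  then show ?thesis
    unfolding elast_inv_sqrt_def using inv_into_f_f[OF inj B_sym[OF s]] by simp
qed

lemma linear_J: "linear (\<lambda>x. B (Cinv x))"
  using linear_compose[OF linear_elast B_linear] unfolding Cinv_def comp_def .

text \<open>In the cross term the powers -1/2 and 1/2 cancel by self-adjointness, which leaves the
  plain product of \<open>p\<close> and \<open>e\<close>.\<close>

lemma expand_square:
  assumes p: "p \<in> sym_mats" and e: "e \<in> sym_mats"
  shows "(norm (elast_inv_sqrt \<mu> \<kappa> (p - C e)))\<^sup>2 =
    (norm (B (Cinv p)))\<^sup>2 - 2 * (p \<bullet> e) + (norm (B e))\<^sup>2"
proof -
  have s: "Cinv p \<in> sym_mats" unfolding Cinv_def by (rule elast_sym[OF p])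
  have "elast_inv_sqrt \<mu> \<kappa> (p - C e) = B (Cinv (p - C e))"
    by (rule elast_inv_sqrt_eq[OF sym_mats_diff[OF p elast_sym[OF e]]])
  also have "\<dots> = B (Cinv p) - B e"
    by (simp add: linear_diff[OF linear_J] Cinv_C)
  finally have 1: "elast_inv_sqrt \<mu> \<kappa> (p - C e) = B (Cinv p) - B e" .
  have "B (Cinv p) \<bullet> B e = Cinv p \<bullet> C e"
    using B_self_adjoint[OF s B_sym[OF e]] elast_sqrt(2)[OF e] by simp
  also have "\<dots> = C (Cinv p) \<bullet> e"
    by (simp add: elast_inner inner_commute[of "Cinv p" "C e"] inner_commute[of "Cinv p" e])
  finally have 2: "B (Cinv p) \<bullet> B e = p \<bullet> e" by (simp add: C_Cinv)
  have 3: "B e \<bullet> B (Cinv p) = p \<bullet> e" using 2 by (simp only: inner_commute)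
  show ?thesis
    unfolding 1 power2_norm_eq_inner inner_diff_left inner_diff_right 2 3 by simp
qed

end

section \<open>The error identity for the Navier-Lame equations\<close>

lemma norm_Q_sq:
  "(norm_Q T \<Omega> w)\<^sup>2 = (LINT t|lebesgue_on {0<..<T}. LINT x|lebesgue_on \<Omega>. (norm (w t x))\<^sup>2)"
  unfolding norm_Q_def by (rule real_sqrt_pow2) (intro integral_nonneg_AE AE_I2 zero_le_power2)

lemma W_space_time_deriv:
  assumes "v \<in> W_space T \<Omega>"
  shows "v \<in> L2_V T \<Omega>" "time_deriv T \<Omega> v \<in> L2_Vdual T \<Omega>" "is_time_deriv T \<Omega> v (time_deriv T \<Omega> v)"
proof -
  have "\<exists>g. g \<in> L2_Vdual T \<Omega> \<and> is_time_deriv T \<Omega> v g" using assms unfolding W_space_def by blast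
  from someI_ex[OF this] show "time_deriv T \<Omega> v \<in> L2_Vdual T \<Omega>" "is_time_deriv T \<Omega> v (time_deriv T \<Omega> v)"
    unfolding time_deriv_def by blast+
  show "v \<in> L2_V T \<Omega>" using assms unfolding W_space_def by blast
qed

context bounded_open
begin

text \<open>Since \<open>time_deriv\<close> is a choice, the difference of two fields is paired with
  the difference of the chosen derivatives; that functional is the one the two evolution equations
  determine.\<close>

lemma time_deriv_diff:
  assumes v: "v \<in> L2_V T \<Omega>" "g \<in> L2_Vdual T \<Omega>" "is_time_deriv T \<Omega> v g"
    and w: "w \<in> L2_V T \<Omega>" "h \<in> L2_Vdual T \<Omega>" "is_time_deriv T \<Omega> w h"
  shows "(\<lambda>t x. v t x - w t x) \<in> L2_V T \<Omega>" "(\<lambda>t F. g t F - h t F) \<in> L2_Vdual T \<Omega>"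
    and "is_time_deriv T \<Omega> (\<lambda>t x. v t x - w t x) (\<lambda>t F. g t F - h t F)"
proof -
  let ?I = "{0<..<T}"
  let ?M = "lebesgue_on ?I"
  have Is: "?I \<in> sets lebesgue" and Im: "?I \<in> lmeasurable" by (simp, metis box_real(1) lmeasurable_box)
  note v1 = v(1)[unfolded L2_V_def] and w1 = w(1)[unfolded L2_V_def]
  note g1 = v(2)[unfolded L2_Vdual_def] and h1 = w(2)[unfolded L2_Vdual_def]
  show "(\<lambda>t x. v t x - w t x) \<in> L2_V T \<Omega>"
    using seminormed_set.bochner_diff[OF seminormed_set_W12_0 Is v1 w1] unfolding L2_V_def fun_diff_def .
  show "(\<lambda>t F. g t F - h t F) \<in> L2_Vdual T \<Omega>"
    using seminormed_set.bochner_diff[OF seminormed_set_W12_dual Is g1 h1] unfolding L2_Vdual_def fun_diff_def .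
  show "is_time_deriv T \<Omega> (\<lambda>t x. v t x - w t x) (\<lambda>t F. g t F - h t F)"
    unfolding is_time_deriv_def
  proof (intro ballI)
    fix \<phi> :: "real \<Rightarrow> real" and q
    assume \<phi>: "\<phi> \<in> test_funs ?I" and q: "q \<in> W12_0 \<Omega>"
    have iv: "integrable ?M (\<lambda>t. deriv \<phi> t * L2_inner \<Omega> (v t) q)" "integrable ?M (\<lambda>t. deriv \<phi> t * L2_inner \<Omega> (w t) q)"
      by (intro test_fun_product_integrable test_fun_deriv(2)[OF \<phi>]
          bochner_L2_inner[OF Is bochner_W12_0_L2[OF Is v1]] bochner_L2_inner[OF Is bochner_W12_0_L2[OF Is w1]]
          seminormed_set.bochner_const[OF seminormed_set_L2 Im W12_0_L2[OF q]])+
    have ig: "integrable ?M (\<lambda>t. \<phi> t * g t q)" "integrable ?M (\<lambda>t. \<phi> t * h t q)"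
      by (intro test_fun_product_integrable test_fun_deriv(3)[OF \<phi>]
          bochner_dual_pairing[OF Is g1] bochner_dual_pairing[OF Is h1]
          seminormed_set.bochner_const[OF seminormed_set_W12_0 Im q])+
    have "AE t in ?M. v t \<in> W12_0 \<Omega>" "AE t in ?M. w t \<in> W12_0 \<Omega>"
      using v1 w1 unfolding bochner_L2_def by blast+
    then have "AE t in ?M. deriv \<phi> t * L2_inner \<Omega> (\<lambda>x. v t x - w t x) q =
      deriv \<phi> t * L2_inner \<Omega> (v t) q - deriv \<phi> t * L2_inner \<Omega> (w t) q"
      by eventually_elim (simp add: L2_inner_diff_left W12_0_L2 q right_diff_distrib)
    from lebesgue_on_AE_cong(2)[OF Is this Bochner_Integration.integrable_diff[OF iv]]
    have "(LINT t|?M. deriv \<phi> t * L2_inner \<Omega> (\<lambda>x. v t x - w t x) q) =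
      (LINT t|?M. deriv \<phi> t * L2_inner \<Omega> (v t) q) - (LINT t|?M. deriv \<phi> t * L2_inner \<Omega> (w t) q)"
      unfolding Bochner_Integration.integral_diff[OF iv] .
    also have "\<dots> = - (LINT t|?M. \<phi> t * g t q) - (- (LINT t|?M. \<phi> t * h t q))"
      using v(3) w(3) \<phi> q unfolding is_time_deriv_def by (intro arg_cong2[where f = "(-)"]) blast+
    also have "\<dots> = - (LINT t|?M. \<phi> t * (g t q - h t q))"
      unfolding right_diff_distrib Bochner_Integration.integral_diff[OF ig] by simp
    finally show "(LINT t|?M. deriv \<phi> t * L2_inner \<Omega> (\<lambda>x. v t x - w t x) q) = - (LINT t|?M. \<phi> t * (g t q - h t q))" .
  qed
qed

end

theorem lemma5p6:
  fixes \<Omega> :: "(real^'n) set"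
    and T muL lambdaL :: real
    and f :: "real \<Rightarrow> (real^'n \<Rightarrow> real^'n) \<Rightarrow> real"
    and u0 :: "real^'n \<Rightarrow> real^'n"
    and u lam :: "real \<Rightarrow> real^'n \<Rightarrow> real^'n"
    and y z :: "real \<Rightarrow> real^'n \<Rightarrow> real^'n^'n"
  assumes "bounded_lipschitz_domain \<Omega>"
    and "0 < T"
    and "0 < muL"
    and "- (2 / real CARD('n)) * muL < lambdaL"
    and "f \<in> L2_Vdual T \<Omega>"
    and "u0 \<in> L2 \<Omega>"
    and "navier_lame_solution T \<Omega> muL lambdaL f u0 u"
    and "z = (\<lambda>t x. elast muL lambdaL (sym_grad \<Omega> (u t) x))"
    and "y \<in> L2_Ysym T \<Omega>"
    and "lam \<in> W_space T \<Omega>"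
    and "AE t in lebesgue_on {0<..<T}. \<forall>v\<in>W12_0 \<Omega>.
           div_dual \<Omega> (y t) v = time_deriv T \<Omega> lam t v - f t v"
  shows
    "1/2 * (norm_Q T \<Omega> (\<lambda>t x. elast_inv_sqrt muL lambdaL (y t x - z t x)))\<^sup>2
     + 1/2 * (norm_Q T \<Omega> (\<lambda>t x. elast_sqrt muL lambdaL (sym_grad \<Omega> (\<lambda>x. lam t x - u t x) x)))\<^sup>2
     + 1/2 * (L2_norm \<Omega> (eval_at T \<Omega> (\<lambda>t x. lam t x - u t x) T))\<^sup>2
     = 1/2 * (norm_Q T \<Omega> (\<lambda>t x. elast_inv_sqrt muL lambdaL
                  (y t x - elast muL lambdaL (sym_grad \<Omega> (lam t) x))))\<^sup>2
     + 1/2 * (L2_norm \<Omega> (\<lambda>x. eval_at T \<Omega> lam 0 x - u0 x))\<^sup>2"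
proof -
  interpret bounded_open \<Omega>
    using assms(1) by unfold_locales (auto simp: bounded_lipschitz_domain_def)
  interpret lame muL lambdaL "TYPE('n)"
    using assms(3,4) by unfold_locales
  let ?I = "{0<..<T}"
  let ?M = "lebesgue_on ?I"
  let ?O = "lebesgue_on \<Omega>"
  have Is: "?I \<in> sets lebesgue" by simp
  have uW: "u \<in> W_space T \<Omega>"
    and pde: "AE t in ?M. \<forall>v\<in>W12_0 \<Omega>. time_deriv T \<Omega> u t v + lame_op muL lambdaL \<Omega> (u t) v = f t v"
    and u0: "AE x in ?O. eval_at T \<Omega> u 0 x = u0 x"
    using assms(7) unfolding navier_lame_solution_def by blast+
  define w where "w t x = lam t x - u t x" for t x
  define g where "g t v = time_deriv T \<Omega> lam t v - time_deriv T \<Omega> u t v" for t v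
  note U = W_space_time_deriv[OF uW] and L = W_space_time_deriv[OF assms(10)]
  have w: "w \<in> L2_V T \<Omega>" and g: "g \<in> L2_Vdual T \<Omega>" and td: "is_time_deriv T \<Omega> w g"
    using time_deriv_diff[OF L U] unfolding w_def[abs_def] g_def[abs_def] by blast+
  have uB: "u \<in> bochner_L2 ?I (W12_0 \<Omega>) (W12_norm \<Omega>)" and lB: "lam \<in> bochner_L2 ?I (W12_0 \<Omega>) (W12_norm \<Omega>)"
    using U(1) L(1) unfolding L2_V_def by blast+
  have yB: "y \<in> bochner_L2 ?I (L2 \<Omega>) (L2_norm \<Omega>)"
    by (rule bochner_L2_mono[OF _ assms(9)[unfolded L2_Ysym_def]]) (auto simp: Y_sym_def)

  define eu where "eu t x = sym_part (wgrad \<Omega> (u t) x)" for t x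
  define el where "el t x = sym_part (wgrad \<Omega> (lam t) x)" for t x
  \<comment> \<open>The pointwise difference is symmetric everywhere and visibly a Bochner function;
    the symmetric gradient of \<open>w t\<close> agrees with it only almost everywhere.\<close>
  define e where "e t x = el t x - eu t x" for t x
  define p where "p t x = y t x - C (eu t x)" for t x
  have eu: "eu \<in> bochner_L2 ?I (L2 \<Omega>) (L2_norm \<Omega>)" and el: "el \<in> bochner_L2 ?I (L2 \<Omega>) (L2_norm \<Omega>)"
    unfolding eu_def[abs_def] el_def[abs_def]
    by (intro bochner_linear[OF Is _ linear_sym_part] bochner_wgrad[OF Is] uB lB)+
  have e: "e \<in> bochner_L2 ?I (L2 \<Omega>) (L2_norm \<Omega>)"
    using seminormed_set.bochner_diff[OF seminormed_set_L2 Is el eu] unfolding e_def[abs_def] fun_diff_def .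
  have p: "p \<in> bochner_L2 ?I (L2 \<Omega>) (L2_norm \<Omega>)"
    using seminormed_set.bochner_diff[OF seminormed_set_L2 Is yB bochner_linear[OF Is eu linear_elast]]
    unfolding p_def[abs_def] fun_diff_def .
  note Jp = bochner_linear[OF Is p linear_J] and Be = bochner_linear[OF Is e B_linear]
  \<comment> \<open>The weighted norms are formed with the linear maps \<open>B\<close> and
    \<open>B (Cinv x)\<close>, for which integrability in time is available; the inner integrals in
    the claim equal them at almost every time.\<close>
  define a where "a t = (L2_norm \<Omega> (\<lambda>x. B (Cinv (p t x))))\<^sup>2" for t
  define b where "b t = (L2_norm \<Omega> (\<lambda>x. B (e t x)))\<^sup>2" for t
  define d where "d t = L2_inner \<Omega> (p t) (e t)" for t
  have ia: "integrable ?M a" unfolding a_def[abs_def] using bochner_L2_inner[OF Is Jp Jp] by (simp add: L2_inner_self)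
  have ib: "integrable ?M b" unfolding b_def[abs_def] using bochner_L2_inner[OF Is Be Be] by (simp add: L2_inner_self)
  have id: "integrable ?M d" unfolding d_def[abs_def] by (rule bochner_L2_inner[OF Is p e])

  have mem: "AE t in ?M. u t \<in> W12_0 \<Omega> \<and> lam t \<in> W12_0 \<Omega> \<and> y t \<in> Y_sym \<Omega>"
  proof -
    have "AE t in ?M. u t \<in> W12_0 \<Omega>" "AE t in ?M. lam t \<in> W12_0 \<Omega>" "AE t in ?M. y t \<in> Y_sym \<Omega>"
      using uB lB assms(9) unfolding L2_Ysym_def bochner_L2_def by blast+
    then show ?thesis by eventually_elim blast
  qed
  let ?fa = "\<lambda>t. LINT x|?O. (norm (elast_inv_sqrt muL lambdaL (y t x - z t x)))\<^sup>2"
  let ?fb = "\<lambda>t. LINT x|?O. (norm (B (sym_grad \<Omega> (\<lambda>x. lam t x - u t x) x)))\<^sup>2"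
  let ?fc = "\<lambda>t. LINT x|?O. (norm (elast_inv_sqrt muL lambdaL (y t x - C (sym_grad \<Omega> (lam t) x))))\<^sup>2"
  have key: "?fa t = a t \<and> ?fb t = b t \<and> ?fc t = a t - 2 * d t + b t \<and>
      (LINT x|?O. y t x \<bullet> wgrad \<Omega> (w t) x) - lame_op muL lambdaL \<Omega> (u t) (w t) = d t"
    if t: "u t \<in> W12_0 \<Omega>" "lam t \<in> W12_0 \<Omega>" "y t \<in> Y_sym \<Omega>" for t
  proof -
    have ut: "u t \<in> W12 \<Omega>" and lt: "lam t \<in> W12 \<Omega>" using t W12_0_W12 by blast+
    have yL: "y t \<in> L2 \<Omega>" and ys: "AE x in ?O. y t x \<in> sym_mats"
      using t(3) unfolding Y_sym_def sym_mats_def by (auto elim!: eventually_mono)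
    have euL: "eu t \<in> L2 \<Omega>" and elL: "el t \<in> L2 \<Omega>"
      unfolding eu_def el_def by (intro L2_linear[OF _ linear_sym_part] wgrad(1) ut lt)+
    have eL: "e t \<in> L2 \<Omega>" unfolding e_def by (rule L2_diff[OF elL euL])
    have CuL: "(\<lambda>x. C (eu t x)) \<in> L2 \<Omega>" by (rule L2_linear[OF euL linear_elast])
    have pL: "p t \<in> L2 \<Omega>" unfolding p_def by (rule L2_diff[OF yL CuL])
    have JpL: "(\<lambda>x. B (Cinv (p t x))) \<in> L2 \<Omega>" by (rule L2_linear[OF pL linear_J])
    have BeL: "(\<lambda>x. B (e t x)) \<in> L2 \<Omega>" by (rule L2_linear[OF eL B_linear])
    have ia: "integrable ?O (\<lambda>x. (norm (B (Cinv (p t x))))\<^sup>2)" by (rule L2_integrable_norm_sq[OF JpL])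
    have ib: "integrable ?O (\<lambda>x. (norm (B (e t x)))\<^sup>2)" by (rule L2_integrable_norm_sq[OF BeL])
    have id: "integrable ?O (\<lambda>x. p t x \<bullet> e t x)" by (rule L2_inner_integrable[OF pL eL])
    have eus: "eu t x \<in> sym_mats" and els: "el t x \<in> sym_mats" for x
      unfolding eu_def el_def by (rule sym_part_sym)+
    have es: "e t x \<in> sym_mats" for x unfolding e_def by (rule sym_mats_diff[OF els eus])
    have ps: "AE x in ?O. p t x \<in> sym_mats"
      using ys by eventually_elim (simp add: p_def sym_mats_diff elast_sym eus)
    have zt: "z t x = C (eu t x)" for x unfolding assms(8) eu_def sym_grad_def ..
    have gw: "AE x in ?O. wgrad \<Omega> (w t) x = wgrad \<Omega> (lam t) x - wgrad \<Omega> (u t) x"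
      using W12_diff(2)[OF lt ut] unfolding w_def .
    have "AE x in ?O. (norm (elast_inv_sqrt muL lambdaL (y t x - z t x)))\<^sup>2 = (norm (B (Cinv (p t x))))\<^sup>2"
      using ps by eventually_elim (simp add: zt p_def[symmetric] elast_inv_sqrt_eq)
    from lebesgue_on_AE_cong(2)[OF dom_sets this ia] have 1: "?fa t = a t"
      by (simp add: a_def L2_norm_sq)
    have "AE x in ?O. (norm (B (sym_grad \<Omega> (\<lambda>x. lam t x - u t x) x)))\<^sup>2 = (norm (B (e t x)))\<^sup>2"
      using gw by eventually_elim
        (simp add: sym_grad_def w_def[abs_def] e_def el_def eu_def linear_diff[OF linear_sym_part])
    from lebesgue_on_AE_cong(2)[OF dom_sets this ib] have 2: "?fb t = b t"
      by (simp add: b_def L2_norm_sq)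
    have "AE x in ?O. (norm (elast_inv_sqrt muL lambdaL (y t x - C (sym_grad \<Omega> (lam t) x))))\<^sup>2 =
      (norm (B (Cinv (p t x))))\<^sup>2 - 2 * (p t x \<bullet> e t x) + (norm (B (e t x)))\<^sup>2"
      using ps
    proof eventually_elim
      case (elim x)
      \<comment> \<open>Inserting the stress of \<open>u\<close> turns the residual of
        \<open>lam\<close> into the form of \<open>expand_square\<close>.\<close>
      have "y t x - C (sym_grad \<Omega> (lam t) x) = p t x - C (e t x)"
        by (simp add: p_def e_def el_def eu_def sym_grad_def linear_diff[OF linear_elast])
      then show ?case using expand_square[OF elim es[of x]] by simp
    qed
    from lebesgue_on_AE_cong(2)[OF dom_sets this] have 3: "?fc t = a t - 2 * d t + b t"
      using ia ib id by (simp add: a_def b_def d_def L2_norm_sq L2_inner_def)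
    have yw: "integrable ?O (\<lambda>x. y t x \<bullet> e t x)" by (rule L2_inner_integrable[OF yL eL])
    \<comment> \<open>A symmetric \<open>y t x\<close> pairs only with the symmetric part of the
      gradient.\<close>
    have "AE x in ?O. y t x \<bullet> wgrad \<Omega> (w t) x = y t x \<bullet> e t x"
      using gw ys by eventually_elim
        (simp add: e_def el_def eu_def linear_diff[OF linear_sym_part, symmetric] inner_sym_part)
    from lebesgue_on_AE_cong(2)[OF dom_sets this yw]
    have 4: "(LINT x|?O. y t x \<bullet> wgrad \<Omega> (w t) x) = (LINT x|?O. y t x \<bullet> e t x)" .
    have Cw: "integrable ?O (\<lambda>x. C (eu t x) \<bullet> e t x)" by (rule L2_inner_integrable[OF CuL eL])
    have "AE x in ?O. C (sym_grad \<Omega> (u t) x) \<bullet> sym_grad \<Omega> (w t) x = C (eu t x) \<bullet> e t x"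
      using gw by eventually_elim
        (simp add: sym_grad_def e_def el_def eu_def linear_diff[OF linear_sym_part])
    from lebesgue_on_AE_cong(2)[OF dom_sets this Cw]
    have 5: "lame_op muL lambdaL \<Omega> (u t) (w t) = (LINT x|?O. C (eu t x) \<bullet> e t x)"
      unfolding lame_op_def .
    have "(LINT x|?O. y t x \<bullet> e t x) - (LINT x|?O. C (eu t x) \<bullet> e t x) = d t"
      unfolding Bochner_Integration.integral_diff[OF yw Cw, symmetric] d_def L2_inner_def p_def
      by (simp add: inner_diff_left)
    then show ?thesis using 1 2 3 4 5 by simp
  qed
  have ae: "AE t in ?M. ?fa t = a t \<and> ?fb t = b t \<and> ?fc t = a t - 2 * d t + b t \<and>
      (LINT x|?O. y t x \<bullet> wgrad \<Omega> (w t) x) - lame_op muL lambdaL \<Omega> (u t) (w t) = d t"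
    using mem by eventually_elim (rule key, blast+)
  have ae1: "AE t in ?M. ?fa t = a t" and ae2: "AE t in ?M. ?fb t = b t"
    and ae3: "AE t in ?M. ?fc t = a t - 2 * d t + b t"
    and ae4: "AE t in ?M. (LINT x|?O. y t x \<bullet> wgrad \<Omega> (w t) x) - lame_op muL lambdaL \<Omega> (u t) (w t) = d t"
    using ae by (auto elim!: eventually_mono)
  have ic: "integrable ?M (\<lambda>t. a t - 2 * d t + b t)" using ia ib id by simp
  \<comment> \<open>Both equations are tested with \<open>w t\<close> itself; on subtraction
    \<open>f\<close> cancels and -(y, \<nabla>w) + (C eu, e) = -(p, e) remains.\<close>
  have "AE t in ?M. g t (w t) = - d t"
    using ae4 mem pde assms(11)
  proof eventually_elim
    case (elim t)
    have wt: "w t \<in> W12_0 \<Omega>" using W12_0_diff[of "lam t" "u t"] elim(2) unfolding w_def by blast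
    have "time_deriv T \<Omega> u t (w t) + lame_op muL lambdaL \<Omega> (u t) (w t) = f t (w t)" using elim(3) wt by blast
    moreover have "div_dual \<Omega> (y t) (w t) = time_deriv T \<Omega> lam t (w t) - f t (w t)" using elim(4) wt by blast
    ultimately show ?case using elim(1) unfolding g_def div_dual_def by linarith
  qed
  from lebesgue_on_AE_cong(2)[OF Is this] have gd: "(LINT t|?M. g t (w t)) = - (LINT t|?M. d t)"
    using id by simp
  have energy: "(L2_norm \<Omega> (eval_at T \<Omega> w T))\<^sup>2 - (L2_norm \<Omega> (eval_at T \<Omega> w 0))\<^sup>2 = - 2 * (LINT t|?M. d t)"
    using eval_at_cont_rep(2)[OF assms(2) w g td] gd by simp
  \<comment> \<open>The values of \<open>eval_at\<close> for \<open>w\<close>, \<open>lam\<close>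
    and \<open>u\<close> are separate choices; uniqueness relates the first to the difference of the
    other two, and then \<open>u0\<close> replaces the value of \<open>u\<close> at 0.\<close>
  have init: "L2_norm \<Omega> (eval_at T \<Omega> w 0) = L2_norm \<Omega> (\<lambda>x. eval_at T \<Omega> lam 0 x - u0 x)"
  proof -
    note cu = eval_at_cont_rep(1)[OF assms(2) U] and cl = eval_at_cont_rep(1)[OF assms(2) L]
      and cw = eval_at_cont_rep(1)[OF assms(2) w g td]
    let ?c = "\<lambda>t x. eval_at T \<Omega> lam t x - eval_at T \<Omega> u t x"
    have c: "is_cont_rep T \<Omega> w ?c"
      using cont_rep_diff[OF cl cu] unfolding w_def[abs_def] .
    have 0: "0 \<in> {0..T}" using assms(2) by simp
    have cL: "?c 0 \<in> L2 \<Omega>" and wL: "eval_at T \<Omega> w 0 \<in> L2 \<Omega>"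
      using c cw 0 unfolding is_cont_rep_def by blast+
    have "L2_norm \<Omega> (eval_at T \<Omega> w 0) = L2_norm \<Omega> (?c 0)"
      using seminormed_set.abs_norm_diff[OF seminormed_set_L2 wL cL] cont_rep_unique[OF assms(2) cw c 0]
      by (simp add: fun_diff_def)
    also have "\<dots> = L2_norm \<Omega> (\<lambda>x. eval_at T \<Omega> lam 0 x - u0 x)"
    proof -
      have ae: "AE x in ?O. ?c 0 x = eval_at T \<Omega> lam 0 x - u0 x" using u0 by eventually_elim simp
      show ?thesis by (rule L2_norm_AE_cong[OF cL L2_AE_cong[OF dom_sets cL ae] ae])
    qed
    finally show ?thesis .
  qed
  have "(norm_Q T \<Omega> (\<lambda>t x. elast_inv_sqrt muL lambdaL (y t x - z t x)))\<^sup>2 = (LINT t|?M. a t)"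
    unfolding norm_Q_sq by (rule lebesgue_on_AE_cong(2)[OF Is ae1 ia])
  moreover have "(norm_Q T \<Omega> (\<lambda>t x. B (sym_grad \<Omega> (\<lambda>x. lam t x - u t x) x)))\<^sup>2 = (LINT t|?M. b t)"
    unfolding norm_Q_sq by (rule lebesgue_on_AE_cong(2)[OF Is ae2 ib])
  moreover have "(norm_Q T \<Omega> (\<lambda>t x. elast_inv_sqrt muL lambdaL (y t x - C (sym_grad \<Omega> (lam t) x))))\<^sup>2 =
    (LINT t|?M. a t) - 2 * (LINT t|?M. d t) + (LINT t|?M. b t)"
    unfolding norm_Q_sq lebesgue_on_AE_cong(2)[OF Is ae3 ic] using ia ib id by simp
  moreover have "eval_at T \<Omega> (\<lambda>t x. lam t x - u t x) = eval_at T \<Omega> w" unfolding w_def[abs_def] ..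
  \<comment> \<open>On the left |w(T)|^2 is |w(0)|^2 minus twice the integral of \<open>d\<close>;
    on the right the same term comes from the cross product in the expanded square.\<close>
  ultimately show ?thesis using energy init by (simp add: field_simps)
qed

end
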